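(* Let $A$ be a C*-algebra. Then its Cuntz semigroup $\mathrm{Cu}(A)$ satisfies axioms O1–O6. If $A$ is separable then $\mathrm{Cu}(A)$ contains a countable dense subset.
   Context: $\mathrm{Cu}(A)$ is the set of Cuntz equivalence classes $[a]$ of positive elements $a\in (A\otimes\mathcal{K})_+$, where $\mathcal{K}$ is the algebra of compact operators on a separable infinite dimensional Hilbert space. Here $a$ is Cuntz subequivalent to $b$ if $x_n^*bx_n\to a$ for some sequence $(x_n)$ in $A\otimes \mathcal{K}$, and Cuntz equivalent if each is Cuntz subequivalent to the other. The order on $\mathrm{Cu}(A)$ is induced by Cuntz subequivalence, and addition is $[a]+[b]=[a'+b']$ where $a',b'$ are orthogonal positive elements Cuntz equivalent to $a$, $b$ respectively. This makes $\mathrm{Cu}(A)$ an ordered semigroup (an abelian monoid with translation invariant order in which $0$ is the smallest element). For $s,t$ in an ordered set, $s\ll t$ means: for every increasing sequence $(t_n)$ (having a supremum) with $t\leq \sup_n t_n$ there is $n_0$ with $s\leq t_{n_0}$. Axioms on an ordered semigroup $S$: O1: every increasing sequence has a supremum. O2: every $s\in S$ is the supremum of a sequence $(s_n)$ with $s_n\ll s_{n+1}$ for all $n$. O3: if $s_i\ll t_i$ for $i=1,2$ then $s_1+s_2\ll t_1+t_2$. O4: if $(s_n),(t_n)$ are increasing then $\sup_n(s_n+t_n)=\sup_n s_n+\sup_n t_n$. O5: if $s'\ll s\leq t$ then there exists $r$ with $s'+r\leq t\leq s+r$. O6: if $s\leq r+t$ then for every $s'\ll s$ there exist $r',t'$ with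 $s'\leq r'+t'$, $r'\leq r$, $r'\leq s$, $t'\leq t$, $t'\leq s$. A subset $S'\subseteq S$ is dense if every element of $S$ is the supremum of a sequence $(s_n)$ in $S'$ with $s_n\ll s_{n+1}$ for all $n$. *)

theory Defs
  imports "HOL-Analysis.Analysis"
begin

section \<open>C*-algebras\<close>

class complex_vector = real_vector +
  fixes scaleC :: "complex \<Rightarrow> 'a \<Rightarrow> 'a"  (infixr \<open>*\<^sub>C\<close> 75)
  assumes scaleC_add_right: "c *\<^sub>C (x + y) = c *\<^sub>C x + c *\<^sub>C y"
    and scaleC_add_left: "(c + d) *\<^sub>C x = c *\<^sub>C x + d *\<^sub>C x"
    and scaleC_scaleC: "c *\<^sub>C d *\<^sub>C x = (c * d) *\<^sub>C x"
    and scaleC_of_real: "complex_of_real r *\<^sub>C x = r *\<^sub>R x"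

class star_algebra = complex_vector + real_algebra +
  fixes star :: "'a \<Rightarrow> 'a"
  assumes mult_scaleC_left: "(c *\<^sub>C x) * y = c *\<^sub>C (x * y)"
    and mult_scaleC_right: "x * (c *\<^sub>C y) = c *\<^sub>C (x * y)"
    and star_star: "star (star x) = x"
    and star_add: "star (x + y) = star x + star y"
    and star_scaleC: "star (c *\<^sub>C x) = cnj c *\<^sub>C star x"
    and star_mult: "star (x * y) = star y * star x"

text \<open>No unit is assumed.\<close>

class cstar_algebra = star_algebra + real_normed_algebra + banach +
  assumes norm_scaleC: "norm (c *\<^sub>C x) = cmod c * norm x"
    and cstar_identity: "norm (star x * x) = (norm x)\<^sup>2"

lemma scaleC_one: "1 *\<^sub>C x = (x :: 'a::complex_vector)"
  using scaleC_of_real[of 1 x] by simp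

lemma scaleC_minus_one: "(-1) *\<^sub>C x = - (x :: 'a::complex_vector)"
  using scaleC_of_real[of "-1" x] by simp

lemma scaleC_zero_left: "0 *\<^sub>C x = (0 :: 'a::complex_vector)"
  using scaleC_of_real[of 0 x] by simp

lemma scaleC_zero_right: "c *\<^sub>C 0 = (0 :: 'a::complex_vector)"
  using scaleC_add_right[of c 0 "0::'a"] by simp

lemma scaleC_minus_right: "c *\<^sub>C (- x) = - (c *\<^sub>C (x :: 'a::complex_vector))"
  by (metis scaleC_minus_one scaleC_scaleC mult.commute)

lemma scaleC_diff_right: "c *\<^sub>C (x - y) = c *\<^sub>C x - c *\<^sub>C (y :: 'a::complex_vector)"
  by (metis add_uminus_conv_diff scaleC_add_right scaleC_minus_right)

lemma star_zero: "star 0 = (0 :: 'a::star_algebra)"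
  using star_add[of 0 "0::'a"] by simp

lemma star_minus: "star (- x) = - star (x :: 'a::star_algebra)"
  by (metis add.inverse_unique add.right_inverse star_add star_zero)

lemma star_diff: "star (x - y) = star x - star (y :: 'a::star_algebra)"
  by (metis add_uminus_conv_diff star_add star_minus)

section \<open>Compact operators on a separable infinite-dimensional Hilbert space\<close>

typedef ell2 = "{x :: nat \<Rightarrow> complex. summable (\<lambda>n. (cmod (x n))\<^sup>2)}"
  morphisms coord Abs_ell2
  by (rule exI[of _ "\<lambda>_. 0"]) simp

setup_lifting type_definition_ell2

lemma ell2_summable: "summable (\<lambda>n. (cmod (coord x n))\<^sup>2)"
  using coord[of x] by simp

lemma ell2_eqI: "(\<And>n. coord x n = coord y n) \<Longrightarrow> x = y"
  by (rule coord_inject[THEN iffD1], rule ext) simp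

lemma square_summable_add:
  fixes x y :: "nat \<Rightarrow> complex"
  assumes "summable (\<lambda>n. (cmod (x n))\<^sup>2)" "summable (\<lambda>n. (cmod (y n))\<^sup>2)"
  shows "summable (\<lambda>n. (cmod (x n + y n))\<^sup>2)"
proof (rule summable_comparison_test)
  show "summable (\<lambda>n. 2 * (cmod (x n))\<^sup>2 + 2 * (cmod (y n))\<^sup>2)"
    by (intro summable_add summable_mult assms)
  have "(cmod (a + b))\<^sup>2 \<le> 2 * (cmod a)\<^sup>2 + 2 * (cmod b)\<^sup>2" for a b :: complex
  proof -
    have "(cmod (a + b))\<^sup>2 \<le> (cmod a + cmod b)\<^sup>2"
      by (simp add: norm_triangle_ineq power_mono)
    also have "\<dots> \<le> 2 * (cmod a)\<^sup>2 + 2 * (cmod b)\<^sup>2"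
      using sum_squares_bound[of "cmod a" "cmod b"] by (simp add: power2_sum)
    finally show ?thesis .
  qed
  then show "\<exists>N. \<forall>n\<ge>N. norm ((cmod (x n + y n))\<^sup>2) \<le> 2 * (cmod (x n))\<^sup>2 + 2 * (cmod (y n))\<^sup>2"
    by simp
qed

lemma square_summable_mult:
  fixes x :: "nat \<Rightarrow> complex"
  assumes "summable (\<lambda>n. (cmod (x n))\<^sup>2)"
  shows "summable (\<lambda>n. (cmod (c * x n))\<^sup>2)"
  using summable_mult[OF assms, of "(cmod c)\<^sup>2"] by (simp add: norm_mult power_mult_distrib)

instantiation ell2 :: complex_vector
begin

lift_definition zero_ell2 :: ell2 is "\<lambda>_. 0" by simp
lift_definition plus_ell2 :: "ell2 \<Rightarrow> ell2 \<Rightarrow> ell2" is "\<lambda>x y n. x n + y n"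
  by (simp add: square_summable_add)
lift_definition uminus_ell2 :: "ell2 \<Rightarrow> ell2" is "\<lambda>x n. - x n" by simp
lift_definition minus_ell2 :: "ell2 \<Rightarrow> ell2 \<Rightarrow> ell2" is "\<lambda>x y n. x n - y n"
  using square_summable_add[where y = "\<lambda>n. - y n" for y] by simp
lift_definition scaleC_ell2 :: "complex \<Rightarrow> ell2 \<Rightarrow> ell2" is "\<lambda>c x n. c * x n"
  by (simp add: square_summable_mult)
lift_definition scaleR_ell2 :: "real \<Rightarrow> ell2 \<Rightarrow> ell2" is "\<lambda>r x n. complex_of_real r * x n"
  by (simp add: square_summable_mult)

instance
  by standard (transfer; simp add: algebra_simps)+

end

text \<open>The real inner product on \<open>ell2\<close> is the real part of the usual complex one.\<close>

instantiation ell2 :: real_inner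
begin

definition inner_ell2 :: "ell2 \<Rightarrow> ell2 \<Rightarrow> real"
  where "x \<bullet> y = (\<Sum>n. coord x n \<bullet> coord y n)"
definition norm_ell2 :: "ell2 \<Rightarrow> real"
  where "norm (x::ell2) = sqrt (x \<bullet> x)"
definition dist_ell2 :: "ell2 \<Rightarrow> ell2 \<Rightarrow> real"
  where "dist (x::ell2) y = norm (x - y)"
definition sgn_ell2 :: "ell2 \<Rightarrow> ell2"
  where "sgn (x::ell2) = x /\<^sub>R norm x"
definition uniformity_ell2 :: "(ell2 \<times> ell2) filter"
  where "uniformity = (INF e\<in>{0<..}. principal {(x::ell2, y). dist x y < e})"
definition open_ell2 :: "ell2 set \<Rightarrow> bool"
  where "open (U::ell2 set) = (\<forall>x\<in>U. \<forall>\<^sub>F (x', y) in uniformity. x' = x \<longrightarrow> y \<in> U)"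

lemma ell2_inner_summable: "summable (\<lambda>n. coord x n \<bullet> coord y n)"
proof (rule summable_comparison_test)
  show "summable (\<lambda>n. (cmod (coord x n))\<^sup>2 + (cmod (coord y n))\<^sup>2)"
    by (intro summable_add ell2_summable)
  have "\<bar>a \<bullet> b\<bar> \<le> (cmod a)\<^sup>2 + (cmod b)\<^sup>2" for a b :: complex
    using Cauchy_Schwarz_ineq2[of a b] sum_squares_bound[of "cmod a" "cmod b"]
      mult_nonneg_nonneg[OF norm_ge_zero[of a] norm_ge_zero[of b]] by linarith
  then show "\<exists>N. \<forall>n\<ge>N. norm (coord x n \<bullet> coord y n) \<le> (cmod (coord x n))\<^sup>2 + (cmod (coord y n))\<^sup>2"
    by simp
qed

instance
proof
  fix x y z :: ell2 and r :: real
  show "x \<bullet> y = y \<bullet> x" by (simp add: inner_ell2_def inner_commute)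
  show "(x + y) \<bullet> z = x \<bullet> z + y \<bullet> z"
    by (simp add: inner_ell2_def plus_ell2.rep_eq inner_add_left suminf_add ell2_inner_summable)
  have *: "(complex_of_real r * u) \<bullet> v = r * (u \<bullet> v)" for u v
    by (simp add: inner_complex_def algebra_simps)
  show "(r *\<^sub>R x) \<bullet> y = r * (x \<bullet> y)"
    by (simp add: inner_ell2_def scaleR_ell2.rep_eq * suminf_mult ell2_inner_summable)
  show "0 \<le> x \<bullet> x"
    by (simp add: inner_ell2_def suminf_nonneg ell2_inner_summable)
  show "(x \<bullet> x = 0) = (x = 0)"
    using suminf_eq_zero_iff[OF ell2_inner_summable[of x x]]
    by (auto simp: inner_ell2_def zero_ell2.rep_eq intro!: ell2_eqI)
qed (simp_all add: norm_ell2_def dist_ell2_def sgn_ell2_def uniformity_ell2_def open_ell2_def)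

end

lemma ell2_norm_sq: "(norm (x::ell2))\<^sup>2 = (\<Sum>n. (cmod (coord x n))\<^sup>2)"
  unfolding power2_norm_eq_inner inner_ell2_def ..

lemma ell2_partial_norm: "(\<Sum>n<N. (cmod (coord x n))\<^sup>2) \<le> (norm x)\<^sup>2"
  unfolding ell2_norm_sq by (rule sum_le_suminf) (auto simp: ell2_summable)

lemma coord_norm_le: "cmod (coord x n) \<le> norm x"
proof -
  have "(cmod (coord x n))\<^sup>2 \<le> (\<Sum>k<Suc n. (cmod (coord x k))\<^sup>2)"
    by (simp add: sum_nonneg)
  also have "\<dots> \<le> (norm x)\<^sup>2" by (rule ell2_partial_norm)
  finally show ?thesis by (rule power2_le_imp_le) simp
qed

lemma square_summable_bounded:
  fixes z :: "nat \<Rightarrow> complex"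
  assumes "\<And>N. (\<Sum>n<N. (cmod (z n))\<^sup>2) \<le> C\<^sup>2" "0 \<le> C"
  shows "\<exists>x. coord x = z \<and> norm x \<le> C"
proof -
  have s: "summable (\<lambda>n. (cmod (z n))\<^sup>2)"
    by (rule bounded_imp_summable[where B="C\<^sup>2"]) (use assms(1)[of "Suc _"] in \<open>auto simp: lessThan_Suc_atMost\<close>)
  then have c: "coord (Abs_ell2 z) = z" by (simp add: Abs_ell2_inverse)
  have "(norm (Abs_ell2 z))\<^sup>2 \<le> C\<^sup>2"
    unfolding ell2_norm_sq c by (rule suminf_le_const[OF s assms(1)])
  then have "norm (Abs_ell2 z) \<le> C" by (rule power2_le_imp_le) (rule assms(2))
  with c show ?thesis by blast
qed

instance ell2 :: banach
proof
  fix X :: "nat \<Rightarrow> ell2"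
  assume "Cauchy X"
  have cc: "Cauchy (\<lambda>k. coord (X k) n)" for n
  proof (rule metric_CauchyI)
    fix e :: real assume "0 < e"
    then obtain M where M: "\<And>i j. i \<ge> M \<Longrightarrow> j \<ge> M \<Longrightarrow> dist (X i) (X j) < e"
      using \<open>Cauchy X\<close> by (metis metric_CauchyD)
    have "dist (coord (X i) n) (coord (X j) n) \<le> dist (X i) (X j)" for i j
      using coord_norm_le[of "X i - X j" n] by (simp add: dist_norm minus_ell2.rep_eq)
    with M show "\<exists>M. \<forall>m\<ge>M. \<forall>k\<ge>M. dist (coord (X m) n) (coord (X k) n) < e"
      by (meson order_le_less_trans)
  qed
  define l where "l n = lim (\<lambda>k. coord (X k) n)" for n
  have l: "(\<lambda>k. coord (X k) n) \<longlonglongrightarrow> l n" for n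
    using cc[of n] by (simp add: l_def Cauchy_convergent_iff convergent_LIMSEQ_iff)
  have key: "\<exists>z. coord z = (\<lambda>n. coord (X k) n - l n) \<and> norm z \<le> e"
    if e: "0 < e" and k: "\<And>j. j \<ge> k \<Longrightarrow> dist (X k) (X j) < e" for e k
  proof (rule square_summable_bounded)
    fix N
    have "(\<lambda>j. \<Sum>n<N. (cmod (coord (X k) n - coord (X j) n))\<^sup>2) \<longlonglongrightarrow> (\<Sum>n<N. (cmod (coord (X k) n - l n))\<^sup>2)"
      by (intro tendsto_intros l)
    moreover have "(\<Sum>n<N. (cmod (coord (X k) n - coord (X j) n))\<^sup>2) \<le> e\<^sup>2" if "j \<ge> k" for j
    proof -
      have "(\<Sum>n<N. (cmod (coord (X k) n - coord (X j) n))\<^sup>2) \<le> (norm (X k - X j))\<^sup>2"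
        using ell2_partial_norm[of "X k - X j" N] by (simp add: minus_ell2.rep_eq)
      also have "\<dots> \<le> e\<^sup>2" using k[OF that] by (intro power_mono) (auto simp: dist_norm)
      finally show ?thesis .
    qed
    ultimately show "(\<Sum>n<N. (cmod (coord (X k) n - l n))\<^sup>2) \<le> e\<^sup>2"
      by (meson LIMSEQ_le_const2)
  qed (use e in simp)
  obtain k0 where "\<And>j. j \<ge> k0 \<Longrightarrow> dist (X k0) (X j) < 1"
    using metric_CauchyD[OF \<open>Cauchy X\<close>, of 1] by auto
  from key[OF _ this] obtain z0 where z0: "coord z0 = (\<lambda>n. coord (X k0) n - l n)" by auto
  define L where "L = X k0 - z0"
  have L: "coord L n = l n" for n by (simp add: L_def minus_ell2.rep_eq z0)
  have "X \<longlonglongrightarrow> L"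
  proof (rule metric_LIMSEQ_I)
    fix e :: real assume "0 < e"
    then have e2: "0 < e / 2" by simp
    obtain M where M: "\<And>i j. i \<ge> M \<Longrightarrow> j \<ge> M \<Longrightarrow> dist (X i) (X j) < e / 2"
      using metric_CauchyD[OF \<open>Cauchy X\<close> e2] by blast
    have "dist (X k) L < e" if "k \<ge> M" for k
    proof -
      have "dist (X k) (X j) < e / 2" if "j \<ge> k" for j
        using M[of k j] that \<open>k \<ge> M\<close> by simp
      from key[OF e2 this] obtain z where z: "coord z = (\<lambda>n. coord (X k) n - l n)" "norm z \<le> e / 2"
        by blast
      have "z = X k - L" by (rule ell2_eqI) (simp add: z L minus_ell2.rep_eq)
      with z(2) \<open>0 < e\<close> show ?thesis by (simp add: dist_norm)
    qed
    then show "\<exists>no. \<forall>n\<ge>no. dist (X n) L < e" by blast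
  qed
  then show "convergent X" by (auto simp: convergent_def)
qed

lemma norm_scaleC_ell2: "norm (c *\<^sub>C (x::ell2)) = cmod c * norm x"
proof -
  have "(norm (c *\<^sub>C x))\<^sup>2 = (cmod c * norm x)\<^sup>2"
    unfolding ell2_norm_sq power_mult_distrib scaleC_ell2.rep_eq norm_mult
    by (simp add: suminf_mult ell2_summable ell2_norm_sq)
  then show ?thesis by (simp add: power2_eq_iff_nonneg)
qed

lemma inner_scaleC_ell2: "(c *\<^sub>C x) \<bullet> y = x \<bullet> (cnj c *\<^sub>C (y::ell2))"
  by (simp add: inner_ell2_def scaleC_ell2.rep_eq inner_complex_def algebra_simps)

lift_definition ell2_single :: "nat \<Rightarrow> complex \<Rightarrow> ell2" is "\<lambda>m c n. if n = m then c else 0"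
proof -
  fix m :: nat and c :: complex
  have "(\<lambda>n. (cmod (if n = m then c else 0))\<^sup>2) = (\<lambda>n. if n = m then (cmod c)\<^sup>2 else 0)" by auto
  then show "summable (\<lambda>n. (cmod (if n = m then c else 0))\<^sup>2)" by simp
qed

lemma ell2_single_add: "ell2_single m (c + d) = ell2_single m c + ell2_single m d"
  by transfer auto

lemma ell2_single_scaleR: "ell2_single m (r *\<^sub>R c) = r *\<^sub>R ell2_single m c"
  by transfer (auto simp: scaleR_conv_of_real)

lemma coord_sum: "coord (sum f A) n = (\<Sum>i\<in>A. coord (f i) n)"
  by (induction A rule: infinite_finite_induct) (auto simp: zero_ell2.rep_eq plus_ell2.rep_eq)

lemma ell2_truncations_tendsto: "(\<lambda>N. \<Sum>m<N. ell2_single m (coord x m)) \<longlonglongrightarrow> x"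
proof -
  define T where "T N = (\<Sum>m<N. ell2_single m (coord x m))" for N
  have cT: "coord (T N) n = (if n < N then coord x n else 0)" for N n
    by (simp add: T_def coord_sum ell2_single.rep_eq)
  have "(norm (x - T N))\<^sup>2 = (\<Sum>n. (cmod (coord x n))\<^sup>2) - (\<Sum>n<N. (cmod (coord x n))\<^sup>2)" for N
  proof -
    have "(norm (x - T N))\<^sup>2 = (\<Sum>n. if n < N then 0 else (cmod (coord x n))\<^sup>2)"
      unfolding ell2_norm_sq by (intro arg_cong[where f=suminf]) (auto simp: minus_ell2.rep_eq cT)
    also have "\<dots> = (\<Sum>n. (cmod (coord x n))\<^sup>2 - (if n < N then (cmod (coord x n))\<^sup>2 else 0))"
      by (intro arg_cong[where f=suminf]) auto
    also have "\<dots> = (\<Sum>n. (cmod (coord x n))\<^sup>2) - (\<Sum>n. if n < N then (cmod (coord x n))\<^sup>2 else 0)"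
      by (intro suminf_diff[symmetric] ell2_summable summable_finite[of "{..<N}"]) auto
    also have "(\<Sum>n. if n < N then (cmod (coord x n))\<^sup>2 else 0) = (\<Sum>n<N. (cmod (coord x n))\<^sup>2)"
      by (subst suminf_finite[of "{..<N}"]) auto
    finally show ?thesis .
  qed
  moreover have "(\<lambda>N. (\<Sum>n. (cmod (coord x n))\<^sup>2) - (\<Sum>n<N. (cmod (coord x n))\<^sup>2)) \<longlonglongrightarrow> 0"
    using tendsto_diff[OF tendsto_const[of "\<Sum>n. (cmod (coord x n))\<^sup>2"] summable_LIMSEQ[OF ell2_summable[of x]]]
    by simp
  ultimately have "(\<lambda>N. (norm (x - T N))\<^sup>2) \<longlonglongrightarrow> 0" by simp
  then have "(\<lambda>N. sqrt ((norm (x - T N))\<^sup>2)) \<longlonglongrightarrow> sqrt 0" by (rule tendsto_real_sqrt)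
  then have "(\<lambda>N. norm (T N - x)) \<longlonglongrightarrow> 0" by (simp add: norm_minus_commute)
  then show ?thesis unfolding T_def using LIM_zero_cancel tendsto_norm_zero_iff by blast
qed

lemma ell2_riesz:
  assumes "bounded_linear (f :: ell2 \<Rightarrow> real)"
  shows "\<exists>z. \<forall>x. f x = x \<bullet> z"
proof -
  interpret f: bounded_linear f by fact
  obtain K where K: "\<And>x. norm (f x) \<le> norm x * K" "0 < K" using f.pos_bounded by blast
  define z where "z n = Complex (f (ell2_single n 1)) (f (ell2_single n \<i>))" for n
  have fs: "f (ell2_single n c) = c \<bullet> z n" for n c
  proof -
    have "c = Re c *\<^sub>R 1 + Im c *\<^sub>R \<i>" by (simp add: complex_eq_iff)
    then have "f (ell2_single n c) = f (Re c *\<^sub>R ell2_single n 1 + Im c *\<^sub>R ell2_single n \<i>)"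
      by (metis ell2_single_add ell2_single_scaleR)
    also have "\<dots> = c \<bullet> z n" by (simp add: f.add f.scale z_def inner_complex_def)
    finally show ?thesis .
  qed
  have "(\<Sum>n<N. (cmod (z n))\<^sup>2) \<le> K\<^sup>2" for N
  proof -
    define v where "v = (\<Sum>n<N. ell2_single n (z n))"
    define s where "s = (\<Sum>n<N. (cmod (z n))\<^sup>2)"
    have s0: "0 \<le> s" by (simp add: s_def sum_nonneg)
    have cv: "coord v n = (if n < N then z n else 0)" for n
      by (simp add: v_def coord_sum ell2_single.rep_eq)
    have nv: "(norm v)\<^sup>2 = s"
      unfolding ell2_norm_sq s_def by (subst suminf_finite[of "{..<N}"]) (auto simp: cv)
    have "f v = s" by (simp add: v_def f.sum fs s_def flip: power2_norm_eq_inner)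
    with K(1)[of v] s0 have "(norm v)\<^sup>2 \<le> norm v * K" by (simp add: nv)
    then have "norm v \<le> K" using K(2) by (cases "norm v = 0") (auto simp: power2_eq_square)
    then have "(norm v)\<^sup>2 \<le> K\<^sup>2" by (simp add: power_mono)
    then show ?thesis by (simp add: nv s_def)
  qed
  then obtain w where w: "coord w = z" using square_summable_bounded[of z K] K(2) by auto
  have "f x = x \<bullet> w" for x
  proof -
    have "(\<lambda>N. f (\<Sum>m<N. ell2_single m (coord x m))) \<longlonglongrightarrow> f x"
      by (rule f.tendsto[OF ell2_truncations_tendsto])
    then have "(\<lambda>N. \<Sum>m<N. coord x m \<bullet> coord w m) \<longlonglongrightarrow> f x"
      by (simp add: f.sum fs w)
    moreover have "(\<lambda>N. \<Sum>m<N. coord x m \<bullet> coord w m) \<longlonglongrightarrow> x \<bullet> w"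
      unfolding inner_ell2_def by (rule summable_LIMSEQ[OF ell2_inner_summable])
    ultimately show ?thesis using LIMSEQ_unique by blast
  qed
  then show ?thesis by blast
qed

text \<open>For complex-linear \<open>T\<close>, the adjoint with respect to the real part of the inner product is the usual
  Hilbert space adjoint.\<close>

definition blinfun_adjoint :: "(ell2 \<Rightarrow>\<^sub>L ell2) \<Rightarrow> (ell2 \<Rightarrow>\<^sub>L ell2)"
  where "blinfun_adjoint T = (THE S. \<forall>x y. blinfun_apply T x \<bullet> y = x \<bullet> blinfun_apply S y)"

lemma inner_ext: "(\<And>x. x \<bullet> y = x \<bullet> z) \<Longrightarrow> y = (z :: 'a::real_inner)"
  using vector_eq_ldot by blast

lemma blinfun_adjoint_works: "blinfun_apply T x \<bullet> y = x \<bullet> blinfun_apply (blinfun_adjoint T) y"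
proof -
  have "\<exists>z. \<forall>x. blinfun_apply T x \<bullet> y = x \<bullet> z" for y
    by (rule ell2_riesz)
      (rule bounded_linear_compose[OF bounded_linear_inner_left blinfun.bounded_linear_right])
  then obtain g where g: "\<And>x y. blinfun_apply T x \<bullet> y = x \<bullet> g y" by metis
  have "bounded_linear g"
  proof (rule bounded_linear_intro)
    fix x y show "g (x + y) = g x + g y"
      by (rule inner_ext) (simp add: g[symmetric] inner_add_right)
  next
    fix r x show "g (r *\<^sub>R x) = r *\<^sub>R g x"
      by (rule inner_ext) (simp add: g[symmetric])
  next
    fix x
    have "(norm (g x))\<^sup>2 = blinfun_apply T (g x) \<bullet> x" by (simp only: g power2_norm_eq_inner)
    also have "\<dots> \<le> norm (blinfun_apply T (g x)) * norm x" by (rule norm_cauchy_schwarz)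
    also have "\<dots> \<le> norm T * norm (g x) * norm x" by (simp add: mult_right_mono norm_blinfun)
    finally show "norm (g x) \<le> norm x * norm T"
      by (cases "norm (g x) = 0") (auto simp: power2_eq_square ac_simps)
  qed
  then have ex: "\<forall>x y. blinfun_apply T x \<bullet> y = x \<bullet> blinfun_apply (Blinfun g) y"
    by (simp add: bounded_linear_Blinfun_apply g)
  have "\<exists>!S. \<forall>x y. blinfun_apply T x \<bullet> y = x \<bullet> blinfun_apply S y"
  proof (rule ex1I[of _ "Blinfun g"])
    fix S assume S: "\<forall>x y. blinfun_apply T x \<bullet> y = x \<bullet> blinfun_apply S y"
    show "S = Blinfun g"
      by (rule blinfun_eqI, rule inner_ext) (use ex S in metis)
  qed (rule ex)
  from theI'[OF this] show ?thesis unfolding blinfun_adjoint_def by blast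
qed

lemma blinfun_adjoint_eqI:
  assumes "\<And>x y. blinfun_apply T x \<bullet> y = x \<bullet> blinfun_apply S y"
  shows "blinfun_adjoint T = S"
  by (rule blinfun_eqI, rule inner_ext) (rule trans[OF blinfun_adjoint_works[symmetric] assms])

lemma norm_blinfun_adjoint_comp: "norm (blinfun_adjoint T o\<^sub>L T) = (norm T)\<^sup>2"
proof (rule antisym)
  have adj_le: "norm (blinfun_adjoint S) \<le> norm S" for S
  proof (rule norm_blinfun_bound)
    fix x
    let ?g = "blinfun_apply (blinfun_adjoint S)"
    have "(norm (?g x))\<^sup>2 = blinfun_apply S (?g x) \<bullet> x"
      by (simp only: blinfun_adjoint_works power2_norm_eq_inner)
    also have "\<dots> \<le> norm (blinfun_apply S (?g x)) * norm x" by (rule norm_cauchy_schwarz)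
    also have "\<dots> \<le> norm S * norm (?g x) * norm x" by (simp add: mult_right_mono norm_blinfun)
    finally show "norm (?g x) \<le> norm S * norm x"
      by (cases "norm (?g x) = 0") (auto simp: power2_eq_square ac_simps)
  qed simp
  have "norm (blinfun_adjoint T o\<^sub>L T) \<le> norm (blinfun_adjoint T) * norm T"
    by (rule norm_blinfun_compose)
  also have "\<dots> \<le> (norm T)\<^sup>2" by (simp add: adj_le mult_right_mono power2_eq_square)
  finally show "norm (blinfun_adjoint T o\<^sub>L T) \<le> (norm T)\<^sup>2" .
  have "norm T \<le> sqrt (norm (blinfun_adjoint T o\<^sub>L T))"
  proof (rule norm_blinfun_bound)
    fix x
    have "(norm (blinfun_apply T x))\<^sup>2 = x \<bullet> blinfun_apply (blinfun_adjoint T o\<^sub>L T) x"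
      by (simp only: power2_norm_eq_inner blinfun_adjoint_works blinfun_apply_blinfun_compose)
    also have "\<dots> \<le> norm x * norm (blinfun_apply (blinfun_adjoint T o\<^sub>L T) x)" by (rule norm_cauchy_schwarz)
    also have "\<dots> \<le> norm x * (norm (blinfun_adjoint T o\<^sub>L T) * norm x)"
      by (intro mult_left_mono norm_blinfun) simp
    also have "\<dots> = (sqrt (norm (blinfun_adjoint T o\<^sub>L T)) * norm x)\<^sup>2"
      by (simp add: power2_eq_square)
    finally show "norm (blinfun_apply T x) \<le> sqrt (norm (blinfun_adjoint T o\<^sub>L T)) * norm x"
      by (rule power2_le_imp_le) simp
  qed simp
  then show "(norm T)\<^sup>2 \<le> norm (blinfun_adjoint T o\<^sub>L T)"
    by (metis norm_ge_zero power_mono real_sqrt_pow2)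
qed


lemma compact_closureD:
  fixes S :: "'a::metric_space set"
  assumes "compact (closure S)" "0 < e"
  shows "\<exists>k. finite k \<and> S \<subseteq> (\<Union>x\<in>k. cball x e)"
proof -
  obtain k where "finite k" "closure S \<subseteq> (\<Union>x\<in>k. ball x e)"
    using assms unfolding compact_eq_totally_bounded by blast
  moreover have "S \<subseteq> closure S" by (rule closure_subset)
  moreover have "(\<Union>x\<in>k. ball x e) \<subseteq> (\<Union>x\<in>k. cball x e)" using ball_subset_cball by blast
  ultimately show ?thesis by blast
qed

lemma compact_closureI:
  fixes S :: "'a::complete_space set"
  assumes "\<And>e. 0 < e \<Longrightarrow> \<exists>k. finite k \<and> S \<subseteq> (\<Union>x\<in>k. cball x e)"
  shows "compact (closure S)"
  unfolding compact_eq_totally_bounded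
proof (intro conjI allI impI)
  show "complete (closure S)" by (simp add: complete_eq_closed)
  fix e :: real assume "0 < e"
  then obtain k where k: "finite k" "S \<subseteq> (\<Union>x\<in>k. cball x (e / 2))" using assms[of "e / 2"] by auto
  have "closed (\<Union>x\<in>k. cball x (e / 2))" using k(1) by (intro closed_UN) auto
  then have "closure S \<subseteq> (\<Union>x\<in>k. cball x (e / 2))" using k(2) by (rule closure_minimal[rotated])
  also have "\<dots> \<subseteq> (\<Union>x\<in>k. ball x e)" using \<open>0 < e\<close> by (intro UN_mono) auto
  finally show "\<exists>k. finite k \<and> closure S \<subseteq> (\<Union>x\<in>k. ball x e)" using k(1) by blast
qed

lemma compact_closure_subset:
  fixes S :: "'a::metric_space set"
  assumes "compact C" "S \<subseteq> C"
  shows "compact (closure S)"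
proof -
  have "closure S \<subseteq> C" using assms by (simp add: closure_minimal compact_imp_closed)
  then show ?thesis using compact_Int_closed[OF assms(1) closed_closure[of S]] by (simp add: Int_absorb1)
qed

text \<open>The type \<open>ell2 \<Rightarrow>\<^sub>L ell2\<close> consists of all bounded real-linear operators, hence the first condition.\<close>

typedef compact_op = "{T :: ell2 \<Rightarrow>\<^sub>L ell2.
    (\<forall>c x. blinfun_apply T (c *\<^sub>C x) = c *\<^sub>C blinfun_apply T x) \<and>
    compact (closure (blinfun_apply T ` cball 0 1))}"
  morphisms op_blinfun Abs_compact_op
proof (rule exI[of _ 0], simp, intro conjI)
  show "\<forall>c. c *\<^sub>C (0::ell2) = 0" by (simp add: scaleC_zero_right)
  show "compact (closure ((\<lambda>x. 0) ` cball (0::ell2) 1 :: ell2 set))"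
    by (rule compact_closure_subset[of "{0}"]) auto
qed

setup_lifting type_definition_compact_op

lemma op_scaleC: "blinfun_apply (op_blinfun T) (c *\<^sub>C x) = c *\<^sub>C blinfun_apply (op_blinfun T) x"
  using op_blinfun[of T] by simp

lemma op_compact: "compact (closure (blinfun_apply (op_blinfun T) ` cball 0 1))"
  using op_blinfun[of T] by simp

lemma compact_image_compose_left:
  assumes "compact (closure (blinfun_apply T ` cball 0 1))"
  shows "compact (closure (blinfun_apply (S o\<^sub>L T) ` cball 0 1))"
proof (rule compact_closure_subset)
  show "compact (blinfun_apply S ` closure (blinfun_apply T ` cball 0 1))"
    by (intro compact_continuous_image assms linear_continuous_on blinfun.bounded_linear_right)
  show "blinfun_apply (S o\<^sub>L T) ` cball 0 1 \<subseteq> blinfun_apply S ` closure (blinfun_apply T ` cball 0 1)"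
    using closure_subset[of "blinfun_apply T ` cball 0 1"] by (auto simp: image_image[symmetric])
qed

lemma compact_image_compose_right:
  assumes "compact (closure (blinfun_apply T ` cball 0 1))"
  shows "compact (closure (blinfun_apply (T o\<^sub>L S) ` cball 0 1))"
proof (rule compact_closure_subset)
  define r where "r = norm S + 1"
  have r: "0 < r" by (simp add: r_def add_nonneg_pos)
  show "compact ((\<lambda>x. r *\<^sub>R x) ` closure (blinfun_apply T ` cball 0 1))"
    by (intro compact_scaling assms)
  show "blinfun_apply (T o\<^sub>L S) ` cball 0 1 \<subseteq> (\<lambda>x. r *\<^sub>R x) ` closure (blinfun_apply T ` cball 0 1)"
  proof
    fix y assume "y \<in> blinfun_apply (T o\<^sub>L S) ` cball 0 1"
    then obtain x where x: "norm x \<le> 1" "y = blinfun_apply T (blinfun_apply S x)" by auto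
    have "norm (blinfun_apply S x) \<le> norm S * norm x" by (rule norm_blinfun)
    also have "\<dots> \<le> norm S * 1" by (intro mult_left_mono x) simp
    also have "\<dots> \<le> r" by (simp add: r_def)
    finally have "(1 / r) *\<^sub>R blinfun_apply S x \<in> cball 0 1" using r by (simp add: divide_le_eq)
    then have "blinfun_apply T ((1 / r) *\<^sub>R blinfun_apply S x) \<in> closure (blinfun_apply T ` cball 0 1)"
      using closure_subset[of "blinfun_apply T ` cball 0 1"] by auto
    moreover have "y = r *\<^sub>R blinfun_apply T ((1 / r) *\<^sub>R blinfun_apply S x)"
      using r by (simp add: x blinfun.scaleR_right)
    ultimately show "y \<in> (\<lambda>x. r *\<^sub>R x) ` closure (blinfun_apply T ` cball 0 1)" by blast
  qed
qed

lemma compact_image_adjoint: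
  assumes "compact (closure (blinfun_apply T ` cball 0 1))"
  shows "compact (closure (blinfun_apply (blinfun_adjoint T) ` cball 0 1))"
proof (rule compact_closureI)
  fix e :: real assume e: "0 < e"
  let ?A = "blinfun_apply (blinfun_adjoint T)"
  define d where "d = e\<^sup>2 / 4"
  have "0 < d" using e by (simp add: d_def)
  with compact_closureD[OF compact_image_compose_right[OF assms, of "blinfun_adjoint T"]]
  obtain k where k: "finite k" "blinfun_apply (T o\<^sub>L blinfun_adjoint T) ` cball 0 1 \<subseteq> (\<Union>x\<in>k. cball x d)"
    by blast
  define f where "f z = (SOME y. y \<in> cball 0 1 \<and> blinfun_apply T (?A y) \<in> cball z d)" for z
  have "?A y \<in> (\<Union>x\<in>(\<lambda>z. ?A (f z)) ` k. cball x e)" if y: "y \<in> cball 0 1" for y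
  proof -
    have "blinfun_apply T (?A y) \<in> blinfun_apply (T o\<^sub>L blinfun_adjoint T) ` cball 0 1" using y by auto
    with k(2) have "blinfun_apply T (?A y) \<in> (\<Union>x\<in>k. cball x d)" by (rule subsetD)
    then obtain z where z: "z \<in> k" "blinfun_apply T (?A y) \<in> cball z d" by blast
    have "f z \<in> cball 0 1 \<and> blinfun_apply T (?A (f z)) \<in> cball z d"
      unfolding f_def by (rule someI[of _ y], rule conjI[OF y z(2)])
    then have fz: "norm (f z) \<le> 1" "dist z (blinfun_apply T (?A (f z))) \<le> d" by auto
    define u where "u = f z - y"
    have nu: "norm u \<le> 2" using norm_triangle_ineq4[of "f z" y] fz(1) y by (simp add: u_def)
    have "norm (blinfun_apply T (?A u)) = dist (blinfun_apply T (?A (f z))) (blinfun_apply T (?A y))"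
      by (simp add: u_def dist_norm blinfun.diff_right)
    also have "\<dots> \<le> dist z (blinfun_apply T (?A (f z))) + dist z (blinfun_apply T (?A y))"
      by (rule dist_triangle3)
    also have "\<dots> \<le> 2 * d" using fz(2) z(2) by simp
    finally have nt: "norm (blinfun_apply T (?A u)) \<le> 2 * d" .
    have "(norm (?A u))\<^sup>2 = blinfun_apply T (?A u) \<bullet> u"
      by (simp only: blinfun_adjoint_works power2_norm_eq_inner)
    also have "\<dots> \<le> norm (blinfun_apply T (?A u)) * norm u" by (rule norm_cauchy_schwarz)
    also have "\<dots> \<le> (2 * d) * 2" using nt nu \<open>0 < d\<close> by (intro mult_mono) auto
    also have "\<dots> = e\<^sup>2" by (simp add: d_def)
    finally have "norm (?A u) \<le> e" by (rule power2_le_imp_le) (use e in simp)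
    then have "?A y \<in> cball (?A (f z)) e" by (simp add: u_def dist_norm blinfun.diff_right)
    with z(1) show ?thesis by blast
  qed
  then have "?A ` cball 0 1 \<subseteq> (\<Union>x\<in>(\<lambda>z. ?A (f z)) ` k. cball x e)" by blast
  with k(1) show "\<exists>k. finite k \<and> ?A ` cball 0 1 \<subseteq> (\<Union>x\<in>k. cball x e)" by blast
qed

lemma compact_image_add:
  fixes T S :: "ell2 \<Rightarrow>\<^sub>L ell2"
  assumes "compact (closure (blinfun_apply T ` cball 0 1))" "compact (closure (blinfun_apply S ` cball 0 1))"
  shows "compact (closure (blinfun_apply (T + S) ` cball 0 1))"
proof (rule compact_closure_subset)
  show "compact {x + y | x y. x \<in> closure (blinfun_apply T ` cball 0 1) \<and> y \<in> closure (blinfun_apply S ` cball 0 1)}"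
    by (intro compact_sums assms)
  have "blinfun_apply T x \<in> closure (blinfun_apply T ` cball 0 1)" if "x \<in> cball 0 1" for T :: "ell2 \<Rightarrow>\<^sub>L ell2" and x
    using that closure_subset[of "blinfun_apply T ` cball 0 1"] by auto
  then show "blinfun_apply (T + S) ` cball 0 1 \<subseteq> {x + y | x y. x \<in> closure (blinfun_apply T ` cball 0 1) \<and> y \<in> closure (blinfun_apply S ` cball 0 1)}"
    by (fastforce simp: blinfun.add_left)
qed

definition scaleC_blinfun :: "complex \<Rightarrow> ell2 \<Rightarrow>\<^sub>L ell2"
  where "scaleC_blinfun c = Blinfun (\<lambda>x. c *\<^sub>C x)"

lemma scaleC_blinfun_apply [simp]: "blinfun_apply (scaleC_blinfun c) x = c *\<^sub>C x"
proof -
  have "bounded_linear (\<lambda>x::ell2. c *\<^sub>C x)"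
  proof (rule bounded_linear_intro)
    fix r and x :: ell2
    show "c *\<^sub>C (r *\<^sub>R x) = r *\<^sub>R (c *\<^sub>C x)"
      by (simp add: scaleC_of_real[symmetric] scaleC_scaleC mult.commute)
    show "norm (c *\<^sub>C x) \<le> norm x * cmod c" by (simp add: norm_scaleC_ell2 mult.commute)
  qed (simp add: scaleC_add_right)
  then show ?thesis by (simp add: scaleC_blinfun_def bounded_linear_Blinfun_apply)
qed

lemma compact_image_scaleR:
  assumes "compact (closure (blinfun_apply T ` cball 0 1))"
  shows "compact (closure (blinfun_apply (r *\<^sub>R T) ` cball 0 1))"
proof -
  have "r *\<^sub>R T = (r *\<^sub>R id_blinfun) o\<^sub>L T" by (rule blinfun_eqI) (simp add: blinfun.scaleR_left)
  then show ?thesis using compact_image_compose_left[OF assms] by simp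
qed

lemma scaleC_scaleR_commute: "c *\<^sub>C (r *\<^sub>R x) = r *\<^sub>R (c *\<^sub>C (x :: 'a::complex_vector))"
  by (simp add: scaleC_of_real[symmetric] scaleC_scaleC mult.commute)

instantiation compact_op :: star_algebra
begin

lift_definition zero_compact_op :: compact_op is 0
  using op_blinfun compact_closure_subset[of "{0::ell2}" "(\<lambda>x. 0) ` cball (0::ell2) 1"]
  by (auto simp: scaleC_zero_right)
lift_definition plus_compact_op :: "compact_op \<Rightarrow> compact_op \<Rightarrow> compact_op" is "(+)"
  by (intro conjI allI compact_image_add) (auto simp: blinfun.add_left scaleC_add_right)
lift_definition scaleR_compact_op :: "real \<Rightarrow> compact_op \<Rightarrow> compact_op" is "(*\<^sub>R)"
  by (intro conjI allI compact_image_scaleR) (auto simp: blinfun.scaleR_left scaleC_scaleR_commute)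
lift_definition uminus_compact_op :: "compact_op \<Rightarrow> compact_op" is uminus
proof -
  fix T :: "ell2 \<Rightarrow>\<^sub>L ell2"
  assume T: "(\<forall>c x. blinfun_apply T (c *\<^sub>C x) = c *\<^sub>C blinfun_apply T x) \<and> compact (closure (blinfun_apply T ` cball 0 1))"
  have "compact (closure (blinfun_apply ((-1) *\<^sub>R T) ` cball 0 1))"
    using T by (intro compact_image_scaleR) auto
  moreover have "(-1) *\<^sub>R T = - T" by simp
  ultimately have "compact (closure (blinfun_apply (- T) ` cball 0 1))" by (simp only:)
  then show "(\<forall>c x. blinfun_apply (- T) (c *\<^sub>C x) = c *\<^sub>C blinfun_apply (- T) x) \<and> compact (closure (blinfun_apply (- T) ` cball 0 1))"
    using T by (intro conjI allI) (auto simp: blinfun.minus_left scaleC_minus_right)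
qed
lift_definition minus_compact_op :: "compact_op \<Rightarrow> compact_op \<Rightarrow> compact_op" is "(-)"
proof -
  fix T S :: "ell2 \<Rightarrow>\<^sub>L ell2"
  assume T: "(\<forall>c x. blinfun_apply T (c *\<^sub>C x) = c *\<^sub>C blinfun_apply T x) \<and> compact (closure (blinfun_apply T ` cball 0 1))"
    and S: "(\<forall>c x. blinfun_apply S (c *\<^sub>C x) = c *\<^sub>C blinfun_apply S x) \<and> compact (closure (blinfun_apply S ` cball 0 1))"
  have "compact (closure (blinfun_apply (T + (-1) *\<^sub>R S) ` cball 0 1))"
    using T S by (intro compact_image_add compact_image_scaleR) auto
  moreover have "T + (-1) *\<^sub>R S = T - S" by simp
  ultimately have "compact (closure (blinfun_apply (T - S) ` cball 0 1))" by (simp only:)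
  with T S show "(\<forall>c x. blinfun_apply (T - S) (c *\<^sub>C x) = c *\<^sub>C blinfun_apply (T - S) x) \<and> compact (closure (blinfun_apply (T - S) ` cball 0 1))"
    by (intro conjI allI) (auto simp: blinfun.diff_left scaleC_diff_right)
qed
lift_definition scaleC_compact_op :: "complex \<Rightarrow> compact_op \<Rightarrow> compact_op" is "\<lambda>c T. scaleC_blinfun c o\<^sub>L T"
  by (intro conjI allI compact_image_compose_left) (auto simp: scaleC_scaleC mult.commute)
lift_definition times_compact_op :: "compact_op \<Rightarrow> compact_op \<Rightarrow> compact_op" is "(o\<^sub>L)"
  by (intro conjI allI compact_image_compose_left) auto
lift_definition star_compact_op :: "compact_op \<Rightarrow> compact_op" is blinfun_adjoint
proof -
  fix T :: "ell2 \<Rightarrow>\<^sub>L ell2"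
  assume T: "(\<forall>c x. blinfun_apply T (c *\<^sub>C x) = c *\<^sub>C blinfun_apply T x) \<and> compact (closure (blinfun_apply T ` cball 0 1))"
  have "blinfun_apply (blinfun_adjoint T) (c *\<^sub>C y) = c *\<^sub>C blinfun_apply (blinfun_adjoint T) y" for c y
  proof (rule inner_ext)
    fix x
    have "x \<bullet> blinfun_apply (blinfun_adjoint T) (c *\<^sub>C y) = (cnj c *\<^sub>C blinfun_apply T x) \<bullet> y"
      by (simp only: blinfun_adjoint_works[symmetric] inner_scaleC_ell2 complex_cnj_cnj)
    also have "\<dots> = blinfun_apply T (cnj c *\<^sub>C x) \<bullet> y" using T by simp
    also have "\<dots> = x \<bullet> c *\<^sub>C blinfun_apply (blinfun_adjoint T) y"
      by (simp only: blinfun_adjoint_works inner_scaleC_ell2 complex_cnj_cnj)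
    finally show "x \<bullet> blinfun_apply (blinfun_adjoint T) (c *\<^sub>C y) = x \<bullet> c *\<^sub>C blinfun_apply (blinfun_adjoint T) y" .
  qed
  with T show "(\<forall>c x. blinfun_apply (blinfun_adjoint T) (c *\<^sub>C x) = c *\<^sub>C blinfun_apply (blinfun_adjoint T) x) \<and>
    compact (closure (blinfun_apply (blinfun_adjoint T) ` cball 0 1))"
    by (simp add: compact_image_adjoint)
qed

instance
proof
  fix x y z :: compact_op and c d :: complex and r s :: real
  note bl = blinfun.add_left blinfun.add_right blinfun.scaleR_left blinfun.scaleR_right
  show "x + y + z = x + (y + z)" by transfer simp
  show "x + y = y + x" by transfer simp
  show "0 + x = x" by transfer simp
  show "- x + x = 0" by transfer simp
  show "x - y = x + - y" by transfer simp
  show "r *\<^sub>R (x + y) = r *\<^sub>R x + r *\<^sub>R y" by transfer (rule scaleR_add_right)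
  show "(r + s) *\<^sub>R x = r *\<^sub>R x + s *\<^sub>R x" by transfer (rule scaleR_add_left)
  show "r *\<^sub>R s *\<^sub>R x = (r * s) *\<^sub>R x" by transfer simp
  show "1 *\<^sub>R x = x" by transfer simp
  show "c *\<^sub>C (x + y) = c *\<^sub>C x + c *\<^sub>C y"
    by transfer (rule blinfun_eqI, simp add: bl scaleC_add_right)
  show "(c + d) *\<^sub>C x = c *\<^sub>C x + d *\<^sub>C x"
    by transfer (rule blinfun_eqI, simp add: bl scaleC_add_left)
  show "c *\<^sub>C d *\<^sub>C x = (c * d) *\<^sub>C x"
    by transfer (rule blinfun_eqI, simp add: scaleC_scaleC)
  show "complex_of_real r *\<^sub>C x = r *\<^sub>R x"
    by transfer (rule blinfun_eqI, simp add: bl scaleC_of_real)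
  show "x * y * z = x * (y * z)" by transfer (rule blinfun_eqI, simp)
  show "(x + y) * z = x * z + y * z" by transfer (rule blinfun_eqI, simp add: bl)
  show "x * (y + z) = x * y + x * z" by transfer (rule blinfun_eqI, simp add: bl)
  show "r *\<^sub>R x * y = r *\<^sub>R (x * y)" by transfer (rule blinfun_eqI, simp add: bl)
  show "x * r *\<^sub>R y = r *\<^sub>R (x * y)" by transfer (rule blinfun_eqI, simp add: bl)
  show "c *\<^sub>C x * y = c *\<^sub>C (x * y)" by transfer (rule blinfun_eqI, simp)
  show "x * c *\<^sub>C y = c *\<^sub>C (x * y)" by transfer (rule blinfun_eqI, simp)
  show "star (star x) = x"
    by transfer (rule blinfun_adjoint_eqI, simp only: inner_commute[of "blinfun_apply (blinfun_adjoint _) _"] blinfun_adjoint_works[symmetric] inner_commute)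
  show "star (x + y) = star x + star y"
    by transfer (rule blinfun_adjoint_eqI, simp only: bl inner_add_left inner_add_right blinfun_adjoint_works)
  show "star (c *\<^sub>C x) = cnj c *\<^sub>C star x"
    by transfer (rule blinfun_adjoint_eqI,
      simp only: blinfun_apply_blinfun_compose scaleC_blinfun_apply inner_scaleC_ell2 blinfun_adjoint_works, metis blinfun_adjoint_works inner_scaleC_ell2)
  show "star (x * y) = star y * star x"
    by transfer (rule blinfun_adjoint_eqI, simp only: blinfun_apply_blinfun_compose blinfun_adjoint_works)
qed

end

instantiation compact_op :: real_normed_algebra
begin

lift_definition norm_compact_op :: "compact_op \<Rightarrow> real" is norm .
definition dist_compact_op :: "compact_op \<Rightarrow> compact_op \<Rightarrow> real"
  where "dist (x::compact_op) y = norm (x - y)"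
definition sgn_compact_op :: "compact_op \<Rightarrow> compact_op"
  where "sgn (x::compact_op) = x /\<^sub>R norm x"
definition uniformity_compact_op :: "(compact_op \<times> compact_op) filter"
  where "uniformity = (INF e\<in>{0<..}. principal {(x::compact_op, y). dist x y < e})"
definition open_compact_op :: "compact_op set \<Rightarrow> bool"
  where "open (U::compact_op set) = (\<forall>x\<in>U. \<forall>\<^sub>F (x', y) in uniformity. x' = x \<longrightarrow> y \<in> U)"

instance
proof
  fix x y :: compact_op and r :: real
  show "(norm x = 0) = (x = 0)" by transfer simp
  show "norm (x + y) \<le> norm x + norm y" by transfer (rule norm_triangle_ineq)
  show "norm (r *\<^sub>R x) = \<bar>r\<bar> * norm x" by transfer simp
  show "norm (x * y) \<le> norm x * norm y" by transfer (rule norm_blinfun_compose)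
qed (simp_all add: dist_compact_op_def sgn_compact_op_def uniformity_compact_op_def open_compact_op_def)

end

instance compact_op :: cstar_algebra
proof
  fix X :: "nat \<Rightarrow> compact_op" assume X: "Cauchy X"
  have d: "dist (op_blinfun x) (op_blinfun y) = dist x y" for x y
    by (simp add: dist_norm norm_compact_op.rep_eq minus_compact_op.rep_eq)
  have "Cauchy (\<lambda>n. op_blinfun (X n))" using X by (simp add: Cauchy_def d)
  then obtain T where T: "(\<lambda>n. op_blinfun (X n)) \<longlonglongrightarrow> T"
    using Cauchy_convergent convergent_def by blast
  have appl: "(\<lambda>n. blinfun_apply (op_blinfun (X n)) x) \<longlonglongrightarrow> blinfun_apply T x" for x
    by (intro tendsto_intros T)
  have lin: "blinfun_apply T (c *\<^sub>C x) = c *\<^sub>C blinfun_apply T x" for c x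
  proof -
    have "(\<lambda>n. blinfun_apply (scaleC_blinfun c) (blinfun_apply (op_blinfun (X n)) x)) \<longlonglongrightarrow> blinfun_apply (scaleC_blinfun c) (blinfun_apply T x)"
      by (intro tendsto_intros appl)
    then have "(\<lambda>n. blinfun_apply (op_blinfun (X n)) (c *\<^sub>C x)) \<longlonglongrightarrow> c *\<^sub>C blinfun_apply T x"
      by (simp add: op_scaleC)
    then show ?thesis using appl[of "c *\<^sub>C x"] LIMSEQ_unique by blast
  qed
  have "compact (closure (blinfun_apply T ` cball 0 1))"
  proof (rule compact_closureI)
    fix e :: real assume e: "0 < e"
    then have e2: "0 < e / 2" by simp
    from metric_LIMSEQ_D[OF T e2] obtain n where n: "dist (op_blinfun (X n)) T < e / 2" by blast
    from compact_closureD[OF op_compact[of "X n"] e2] obtain k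
      where k: "finite k" "blinfun_apply (op_blinfun (X n)) ` cball 0 1 \<subseteq> (\<Union>x\<in>k. cball x (e / 2))" by blast
    have "blinfun_apply T x \<in> (\<Union>x\<in>k. cball x e)" if x: "x \<in> cball 0 1" for x
    proof -
      obtain z where z: "z \<in> k" "dist z (blinfun_apply (op_blinfun (X n)) x) \<le> e / 2"
        using k(2) x by fastforce
      have "dist (blinfun_apply (op_blinfun (X n)) x) (blinfun_apply T x) = norm (blinfun_apply (op_blinfun (X n) - T) x)"
        by (simp add: dist_norm blinfun.diff_left)
      also have "\<dots> \<le> norm (op_blinfun (X n) - T) * norm x" by (rule norm_blinfun)
      also have "\<dots> \<le> (e / 2) * 1"
        using n x e by (intro mult_mono) (auto simp: dist_norm)
      finally have "dist z (blinfun_apply T x) \<le> e"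
        using z(2) dist_triangle[of z "blinfun_apply T x" "blinfun_apply (op_blinfun (X n)) x"] by simp
      with z(1) show ?thesis by auto
    qed
    then have "blinfun_apply T ` cball 0 1 \<subseteq> (\<Union>x\<in>k. cball x e)" by blast
    with k(1) show "\<exists>k. finite k \<and> blinfun_apply T ` cball 0 1 \<subseteq> (\<Union>x\<in>k. cball x e)" by blast
  qed
  with lin have TT: "op_blinfun (Abs_compact_op T) = T" by (simp add: Abs_compact_op_inverse)
  have "X \<longlonglongrightarrow> Abs_compact_op T"
    unfolding lim_sequentially d[symmetric] TT using T by (simp add: lim_sequentially)
  then show "convergent X" by (auto simp: convergent_def)
next
  fix x :: compact_op and c :: complex
  show "norm (star x * x) = (norm x)\<^sup>2" by transfer (rule norm_blinfun_adjoint_comp)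
  show "norm (c *\<^sub>C x) = cmod c * norm x"
  proof (rule antisym)
    have le: "norm (c *\<^sub>C x) \<le> cmod c * norm x" for c and x :: compact_op
    proof (transfer, rule norm_blinfun_bound)
      fix c y and T :: "ell2 \<Rightarrow>\<^sub>L ell2"
      have "norm (blinfun_apply (scaleC_blinfun c o\<^sub>L T) y) = cmod c * norm (blinfun_apply T y)"
        by (simp add: norm_scaleC_ell2)
      also have "\<dots> \<le> cmod c * (norm T * norm y)" by (intro mult_left_mono norm_blinfun) simp
      finally show "norm (blinfun_apply (scaleC_blinfun c o\<^sub>L T) y) \<le> cmod c * norm T * norm y"
        by (simp add: ac_simps)
    qed simp
    show "norm (c *\<^sub>C x) \<le> cmod c * norm x" by (rule le)
    show "cmod c * norm x \<le> norm (c *\<^sub>C x)"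
    proof (cases "c = 0")
      case False
      have "norm x = norm (inverse c *\<^sub>C c *\<^sub>C x)" using False by (simp add: scaleC_scaleC scaleC_one)
      also have "\<dots> \<le> inverse (cmod c) * norm (c *\<^sub>C x)" using le[of "inverse c"] by (simp add: norm_inverse)
      finally show ?thesis using False by (simp add: field_simps)
    qed simp
  qed
qed


section \<open>Tensor products of C*-algebras\<close>

text \<open>The algebraic tensor product over the complex numbers is realised inside the dual of the space of complex
  bilinear forms: the tensor \<open>\<Sum> a\<^sub>i \<otimes> b\<^sub>i\<close> is the functional \<open>\<phi> \<mapsto> \<Sum> \<phi> a\<^sub>i b\<^sub>i\<close>. Bilinear forms on complex vector
  spaces separate tensors. Values at maps \<open>\<phi>\<close> that are not bilinear are irrelevant and set to 0.\<close>

definition cbilinear :: "('a::complex_vector \<Rightarrow> 'b::complex_vector \<Rightarrow> complex) \<Rightarrow> bool"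
  where "cbilinear \<phi> \<longleftrightarrow>
    (\<forall>a a' b. \<phi> (a + a') b = \<phi> a b + \<phi> a' b) \<and> (\<forall>a b b'. \<phi> a (b + b') = \<phi> a b + \<phi> a b') \<and>
    (\<forall>c a b. \<phi> (c *\<^sub>C a) b = c * \<phi> a b) \<and> (\<forall>c a b. \<phi> a (c *\<^sub>C b) = c * \<phi> a b)"

definition tensor_functional ::
    "('a::complex_vector \<times> 'b::complex_vector) list \<Rightarrow> ('a \<Rightarrow> 'b \<Rightarrow> complex) \<Rightarrow> complex"
  where "tensor_functional xs \<phi> = (if cbilinear \<phi> then \<Sum>(a, b)\<leftarrow>xs. \<phi> a b else 0)"

typedef (overloaded) ('a::complex_vector, 'b::complex_vector) alg_tensor =
    "range (tensor_functional :: ('a \<times> 'b) list \<Rightarrow> _)"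
  morphisms tensor_eval Abs_alg_tensor
  by blast

setup_lifting type_definition_alg_tensor

lift_definition elem_tensor :: "'a::complex_vector \<Rightarrow> 'b::complex_vector \<Rightarrow> ('a, 'b) alg_tensor"
    (infixl \<open>\<otimes>\<^sub>a\<^sub>l\<^sub>g\<close> 70)
  is "\<lambda>a b. tensor_functional [(a, b)]"
  by blast

lemma tensor_eval_list:
  obtains xs where "\<And>\<phi>. tensor_eval x \<phi> = (if cbilinear \<phi> then \<Sum>(a, b)\<leftarrow>xs. \<phi> a b else 0)"
proof -
  obtain xs where "tensor_eval x = tensor_functional xs" using tensor_eval[of x] by blast
  then show thesis using that by (simp add: tensor_functional_def)
qed

lemma tensor_eval_not [simp]: "\<not> cbilinear \<phi> \<Longrightarrow> tensor_eval x \<phi> = 0"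
  by (rule tensor_eval_list[of x]) simp

lemma tensor_eval_elem [simp]: "cbilinear \<phi> \<Longrightarrow> tensor_eval (a \<otimes>\<^sub>a\<^sub>l\<^sub>g b) \<phi> = \<phi> a b"
  by (simp add: elem_tensor.rep_eq tensor_functional_def)

lemma alg_tensor_eqI:
  assumes "\<And>\<phi>. cbilinear \<phi> \<Longrightarrow> tensor_eval x \<phi> = tensor_eval y \<phi>"
  shows "x = y"
proof -
  have "tensor_eval x \<phi> = tensor_eval y \<phi>" for \<phi>
    by (cases "cbilinear \<phi>") (simp_all add: assms)
  then have "tensor_eval x = tensor_eval y" by blast
  then show ?thesis by (simp only: tensor_eval_inject)
qed

lemma cbilinear_mult_left:
  assumes "cbilinear (\<phi> :: 'a::star_algebra \<Rightarrow> 'b::star_algebra \<Rightarrow> complex)"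
  shows "cbilinear (\<lambda>c d. \<phi> (a * c) (b * d))"
  using assms unfolding cbilinear_def by (simp add: distrib_left mult_scaleC_right)

lemma cbilinear_mult_right:
  assumes "cbilinear (\<phi> :: 'a::star_algebra \<Rightarrow> 'b::star_algebra \<Rightarrow> complex)"
  shows "cbilinear (\<lambda>a b. \<phi> (a * c) (b * d))"
  using assms unfolding cbilinear_def by (simp add: distrib_right mult_scaleC_left)

lemma cbilinear_star:
  assumes "cbilinear (\<phi> :: 'a::star_algebra \<Rightarrow> 'b::star_algebra \<Rightarrow> complex)"
  shows "cbilinear (\<lambda>a b. cnj (\<phi> (star a) (star b)))"
  using assms unfolding cbilinear_def by (simp add: star_add star_scaleC)

lemma cbilinear_zero: "cbilinear (\<lambda>a b. 0)"
  by (simp add: cbilinear_def)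

lemma cbilinear_add: "cbilinear \<phi> \<Longrightarrow> cbilinear \<psi> \<Longrightarrow> cbilinear (\<lambda>a b. \<phi> a b + \<psi> a b)"
  unfolding cbilinear_def by (simp add: algebra_simps)

lemma cbilinear_scale: "cbilinear \<phi> \<Longrightarrow> cbilinear (\<lambda>a b. c * \<phi> a b)"
  unfolding cbilinear_def by (simp add: algebra_simps)

lemma cbilinear_sum_list:
  assumes "\<And>c d. cbilinear (\<lambda>a b. \<Psi> a b c d)"
  shows "cbilinear (\<lambda>a b. \<Sum>(c, d)\<leftarrow>ys. \<Psi> a b c d)"
proof (induction ys)
  case Nil
  then show ?case by (simp add: cbilinear_zero)
next
  case (Cons y ys)
  obtain c d where "y = (c, d)" by (cases y)
  with cbilinear_add[OF assms[of c d] Cons.IH] show ?case by simp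
qed

lemma cbilinear_eval:
  assumes "\<And>c d. cbilinear (\<lambda>a b. \<Psi> a b c d)" "\<And>a b. cbilinear (\<lambda>c d. \<Psi> a b c d)"
  shows "cbilinear (\<lambda>a b. tensor_eval y (\<lambda>c d. \<Psi> a b c d))"
  by (rule tensor_eval_list[of y]) (simp add: assms(2) cbilinear_sum_list[OF assms(1)])

lemma tensor_eval_add:
  assumes "cbilinear \<phi>" "cbilinear \<psi>"
  shows "tensor_eval x (\<lambda>a b. \<phi> a b + \<psi> a b) = tensor_eval x \<phi> + tensor_eval x \<psi>"
proof (rule tensor_eval_list[of x])
  fix xs assume "\<And>\<phi>. tensor_eval x \<phi> = (if cbilinear \<phi> then \<Sum>(a, b)\<leftarrow>xs. \<phi> a b else 0)"
  then show ?thesis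
    using assms cbilinear_add[OF assms] by (simp add: sum_list_addf[symmetric] case_prod_unfold)
qed

lemma tensor_eval_scale:
  assumes "cbilinear \<phi>"
  shows "tensor_eval x (\<lambda>a b. c * \<phi> a b) = c * tensor_eval x \<phi>"
proof (rule tensor_eval_list[of x])
  fix xs assume "\<And>\<phi>. tensor_eval x \<phi> = (if cbilinear \<phi> then \<Sum>(a, b)\<leftarrow>xs. \<phi> a b else 0)"
  then show ?thesis
    using assms cbilinear_scale[OF assms] by (simp add: sum_list_const_mult case_prod_unfold)
qed

lemma tensor_eval_swap:
  assumes "\<And>c d. cbilinear (\<lambda>a b. \<Psi> a b c d)" "\<And>a b. cbilinear (\<lambda>c d. \<Psi> a b c d)"
  shows "tensor_eval x (\<lambda>a b. tensor_eval y (\<lambda>c d. \<Psi> a b c d)) =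
    tensor_eval y (\<lambda>c d. tensor_eval x (\<lambda>a b. \<Psi> a b c d))"
proof -
  obtain xs where x: "\<And>\<phi>. tensor_eval x \<phi> = (if cbilinear \<phi> then \<Sum>(a, b)\<leftarrow>xs. \<phi> a b else 0)"
    using tensor_eval_list[of x] by blast
  have "tensor_eval x (\<lambda>a b. tensor_eval y (\<lambda>c d. \<Psi> a b c d)) = (\<Sum>(a, b)\<leftarrow>xs. tensor_eval y (\<lambda>c d. \<Psi> a b c d))"
    unfolding x using cbilinear_eval[OF assms] by simp
  also have "\<dots> = tensor_eval y (\<lambda>c d. \<Sum>(a, b)\<leftarrow>xs. \<Psi> a b c d)"
  proof (induction xs)
    case Nil
    then show ?case using tensor_eval_scale[OF cbilinear_zero, of y 0] by simp
  next
    case (Cons p xs)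
    obtain a b where "p = (a, b)" by (cases p)
    then show ?case
      using Cons.IH tensor_eval_add[OF assms(2)[of a b] cbilinear_sum_list[of "\<lambda>c d a b. \<Psi> a b c d", OF assms(2)], of y xs]
      by simp
  qed
  also have "\<dots> = tensor_eval y (\<lambda>c d. tensor_eval x (\<lambda>a b. \<Psi> a b c d))"
    by (simp add: x assms(1))
  finally show ?thesis .
qed

instantiation alg_tensor :: (complex_vector, complex_vector) complex_vector
begin

lift_definition zero_alg_tensor :: "('a, 'b) alg_tensor" is "\<lambda>\<phi>. 0"
  by (rule image_eqI[of _ _ "[]"]) (auto simp: tensor_functional_def)
lift_definition plus_alg_tensor :: "('a, 'b) alg_tensor \<Rightarrow> ('a, 'b) alg_tensor \<Rightarrow> ('a, 'b) alg_tensor"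
  is "\<lambda>F G \<phi>. F \<phi> + G \<phi>"
proof -
  fix F G :: "('a \<Rightarrow> 'b \<Rightarrow> complex) \<Rightarrow> complex"
  assume "F \<in> range tensor_functional" "G \<in> range tensor_functional"
  then obtain xs ys where "F = tensor_functional xs" "G = tensor_functional ys" by blast
  then have "(\<lambda>\<phi>. F \<phi> + G \<phi>) = tensor_functional (xs @ ys)" by (auto simp: tensor_functional_def)
  then show "(\<lambda>\<phi>. F \<phi> + G \<phi>) \<in> range tensor_functional" by blast
qed
lift_definition scaleC_alg_tensor :: "complex \<Rightarrow> ('a, 'b) alg_tensor \<Rightarrow> ('a, 'b) alg_tensor"
  is "\<lambda>c F \<phi>. c * F \<phi>"
proof -
  fix c and F :: "('a \<Rightarrow> 'b \<Rightarrow> complex) \<Rightarrow> complex"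
  assume "F \<in> range tensor_functional"
  then obtain xs where F: "F = tensor_functional xs" by blast
  have "c * (\<Sum>(a, b)\<leftarrow>xs. \<phi> a b) = (\<Sum>(a, b)\<leftarrow>map (\<lambda>(a, b). (c *\<^sub>C a, b)) xs. \<phi> a b)" if "cbilinear \<phi>" for \<phi>
    using that by (induction xs) (auto simp: cbilinear_def distrib_left)
  then have "(\<lambda>\<phi>. c * F \<phi>) = tensor_functional (map (\<lambda>(a, b). (c *\<^sub>C a, b)) xs)"
    unfolding F tensor_functional_def by (intro ext) simp
  then show "(\<lambda>\<phi>. c * F \<phi>) \<in> range tensor_functional" by blast
qed
definition uminus_alg_tensor :: "('a, 'b) alg_tensor \<Rightarrow> ('a, 'b) alg_tensor"
  where "uminus_alg_tensor x = (-1) *\<^sub>C x"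
definition minus_alg_tensor :: "('a, 'b) alg_tensor \<Rightarrow> ('a, 'b) alg_tensor \<Rightarrow> ('a, 'b) alg_tensor"
  where "minus_alg_tensor x y = x + - y"
definition scaleR_alg_tensor :: "real \<Rightarrow> ('a, 'b) alg_tensor \<Rightarrow> ('a, 'b) alg_tensor"
  where "scaleR_alg_tensor r x = complex_of_real r *\<^sub>C x"

instance
  by standard
    (auto intro!: alg_tensor_eqI simp: zero_alg_tensor.rep_eq plus_alg_tensor.rep_eq scaleC_alg_tensor.rep_eq
      uminus_alg_tensor_def minus_alg_tensor_def scaleR_alg_tensor_def algebra_simps)

end

instantiation alg_tensor :: (star_algebra, star_algebra) star_algebra
begin

lift_definition times_alg_tensor :: "('a, 'b) alg_tensor \<Rightarrow> ('a, 'b) alg_tensor \<Rightarrow> ('a, 'b) alg_tensor"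
  is "\<lambda>F G \<phi>. if cbilinear \<phi> then F (\<lambda>a b. G (\<lambda>c d. \<phi> (a * c) (b * d))) else 0"
proof -
  fix F G :: "('a \<Rightarrow> 'b \<Rightarrow> complex) \<Rightarrow> complex"
  assume "F \<in> range tensor_functional" "G \<in> range tensor_functional"
  then obtain xs ys where F: "F = tensor_functional xs" and G: "G = tensor_functional ys" by blast
  define zs where "zs = concat (map (\<lambda>(a, b). map (\<lambda>(c, d). (a * c, b * d)) ys) xs)"
  have "F (\<lambda>a b. G (\<lambda>c d. \<phi> (a * c) (b * d))) = (\<Sum>(a, b)\<leftarrow>zs. \<phi> a b)" if \<phi>: "cbilinear \<phi>" for \<phi>
  proof -
    have "F (\<lambda>a b. G (\<lambda>c d. \<phi> (a * c) (b * d))) = (\<Sum>(a, b)\<leftarrow>xs. \<Sum>(c, d)\<leftarrow>ys. \<phi> (a * c) (b * d))"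
      using cbilinear_sum_list[of "\<lambda>a b c d. \<phi> (a * c) (b * d)" ys, OF cbilinear_mult_right[OF \<phi>]]
      by (simp add: F G tensor_functional_def cbilinear_mult_left[OF \<phi>])
    also have "\<dots> = (\<Sum>(a, b)\<leftarrow>zs. \<phi> a b)"
      unfolding zs_def by (induction xs) (auto simp: comp_def case_prod_unfold)
    finally show ?thesis .
  qed
  then have "(\<lambda>\<phi>. if cbilinear \<phi> then F (\<lambda>a b. G (\<lambda>c d. \<phi> (a * c) (b * d))) else 0) = tensor_functional zs"
    unfolding tensor_functional_def by (intro ext) simp
  then show "(\<lambda>\<phi>. if cbilinear \<phi> then F (\<lambda>a b. G (\<lambda>c d. \<phi> (a * c) (b * d))) else 0) \<in> range tensor_functional"
    by blast
qed

lift_definition star_alg_tensor :: "('a, 'b) alg_tensor \<Rightarrow> ('a, 'b) alg_tensor"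
  is "\<lambda>F \<phi>. if cbilinear \<phi> then cnj (F (\<lambda>a b. cnj (\<phi> (star a) (star b)))) else 0"
proof -
  fix F :: "('a \<Rightarrow> 'b \<Rightarrow> complex) \<Rightarrow> complex"
  assume "F \<in> range tensor_functional"
  then obtain xs where F: "F = tensor_functional xs" by blast
  have "cnj (\<Sum>(a, b)\<leftarrow>xs. cnj (\<phi> (star a) (star b))) = (\<Sum>(a, b)\<leftarrow>map (\<lambda>(a, b). (star a, star b)) xs. \<phi> a b)" for \<phi>
    by (induction xs) auto
  then have "(\<lambda>\<phi>. if cbilinear \<phi> then cnj (F (\<lambda>a b. cnj (\<phi> (star a) (star b)))) else 0) =
      tensor_functional (map (\<lambda>(a, b). (star a, star b)) xs)"
    unfolding F tensor_functional_def by (intro ext) (simp add: cbilinear_star)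
  then show "(\<lambda>\<phi>. if cbilinear \<phi> then cnj (F (\<lambda>a b. cnj (\<phi> (star a) (star b)))) else 0) \<in> range tensor_functional"
    by blast
qed

instance
proof
  fix x y z :: "('a, 'b) alg_tensor" and c :: complex and r :: real
  note ev = plus_alg_tensor.rep_eq scaleC_alg_tensor.rep_eq times_alg_tensor.rep_eq star_alg_tensor.rep_eq
  note bil = cbilinear_mult_left cbilinear_mult_right cbilinear_star cbilinear_eval cbilinear_add cbilinear_scale
  have bil2: "cbilinear (\<lambda>a b. tensor_eval y (\<lambda>c d. \<phi> (a * c) (b * d)))" if "cbilinear \<phi>" for \<phi> and y :: "('a, 'b) alg_tensor"
    using that by (intro cbilinear_eval cbilinear_mult_left cbilinear_mult_right)
  show "x * y * z = x * (y * z)"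
  proof (rule alg_tensor_eqI)
    fix \<phi> :: "'a \<Rightarrow> 'b \<Rightarrow> complex" assume "cbilinear \<phi>"
    then show "tensor_eval (x * y * z) \<phi> = tensor_eval (x * (y * z)) \<phi>"
      by (simp add: ev bil2 cbilinear_mult_left mult.assoc)
  qed
  show "(x + y) * z = x * z + y * z"
    by (rule alg_tensor_eqI) (simp add: ev)
  show "x * (y + z) = x * y + x * z"
    by (rule alg_tensor_eqI) (simp add: ev tensor_eval_add bil2)
  show mC: "c *\<^sub>C x * y = c *\<^sub>C (x * y)" for c :: complex and x y :: "('a, 'b) alg_tensor"
    by (rule alg_tensor_eqI) (simp add: ev)
  show Cm: "x * c *\<^sub>C y = c *\<^sub>C (x * y)" for c :: complex and x y :: "('a, 'b) alg_tensor"
    by (rule alg_tensor_eqI) (simp add: ev tensor_eval_scale bil2)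
  show "r *\<^sub>R x * y = r *\<^sub>R (x * y)" unfolding scaleR_alg_tensor_def by (rule mC)
  show "x * r *\<^sub>R y = r *\<^sub>R (x * y)" unfolding scaleR_alg_tensor_def by (rule Cm)
  show "star (star x) = x"
    by (rule alg_tensor_eqI) (simp add: ev bil star_star)
  show "star (x + y) = star x + star y"
    by (rule alg_tensor_eqI) (simp add: ev)
  show "star (c *\<^sub>C x) = cnj c *\<^sub>C star x"
    by (rule alg_tensor_eqI) (simp add: ev)
  show "star (x * y) = star y * star x"
  proof (rule alg_tensor_eqI)
    fix \<phi> :: "'a \<Rightarrow> 'b \<Rightarrow> complex" assume \<phi>: "cbilinear \<phi>"
    let ?\<Psi> = "\<lambda>a b c d. cnj (\<phi> (star c * star a) (star d * star b))"
    have 1: "cbilinear (\<lambda>a b. ?\<Psi> a b c d)" for c d by (rule cbilinear_star[OF cbilinear_mult_left[OF \<phi>]])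
    have 2: "cbilinear (\<lambda>c d. ?\<Psi> a b c d)" for a b by (rule cbilinear_star[OF cbilinear_mult_right[OF \<phi>]])
    have "tensor_eval (star (x * y)) \<phi> = cnj (tensor_eval x (\<lambda>a b. tensor_eval y (\<lambda>c d. ?\<Psi> a b c d)))"
      using \<phi> by (simp add: ev cbilinear_star star_mult)
    also have "\<dots> = cnj (tensor_eval y (\<lambda>c d. tensor_eval x (\<lambda>a b. ?\<Psi> a b c d)))"
      by (simp only: tensor_eval_swap[of ?\<Psi>, OF 1 2])
    also have "\<dots> = tensor_eval (star y * star x) \<phi>"
      using \<phi> bil2[OF \<phi>, of "star x"] by (simp add: ev cbilinear_mult_left)
    finally show "tensor_eval (star (x * y)) \<phi> = tensor_eval (star y * star x) \<phi>" .
  qed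
qed

end

lemma elem_tensor_mult: "(a \<otimes>\<^sub>a\<^sub>l\<^sub>g b) * (c \<otimes>\<^sub>a\<^sub>l\<^sub>g d) = (a * c) \<otimes>\<^sub>a\<^sub>l\<^sub>g (b * d)"
proof (rule alg_tensor_eqI)
  fix \<phi> :: "'a \<Rightarrow> 'b \<Rightarrow> complex" assume "cbilinear \<phi>"
  then show "tensor_eval ((a \<otimes>\<^sub>a\<^sub>l\<^sub>g b) * (c \<otimes>\<^sub>a\<^sub>l\<^sub>g d)) \<phi> = tensor_eval ((a * c) \<otimes>\<^sub>a\<^sub>l\<^sub>g (b * d)) \<phi>"
    by (simp add: times_alg_tensor.rep_eq cbilinear_mult_left cbilinear_mult_right)
qed

lemma elem_tensor_star: "star (a \<otimes>\<^sub>a\<^sub>l\<^sub>g b) = star a \<otimes>\<^sub>a\<^sub>l\<^sub>g star b"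
  by (rule alg_tensor_eqI) (simp add: star_alg_tensor.rep_eq cbilinear_star)

lemma alg_tensor_induct [case_names zero add]:
  assumes "P 0" "\<And>a b x. P x \<Longrightarrow> P (a \<otimes>\<^sub>a\<^sub>l\<^sub>g b + x)"
  shows "P x"
proof -
  define S where "S xs = foldr (\<lambda>(a, b) y. a \<otimes>\<^sub>a\<^sub>l\<^sub>g b + y) xs 0" for xs :: "('a \<times> 'b) list"
  have P: "P (S xs)" for xs
    by (induction xs) (auto simp: S_def assms)
  have ev: "tensor_eval (S xs) \<phi> = (\<Sum>(a, b)\<leftarrow>xs. \<phi> a b)" if "cbilinear \<phi>" for xs \<phi>
    using that by (induction xs) (auto simp: S_def zero_alg_tensor.rep_eq plus_alg_tensor.rep_eq)
  obtain xs where x: "\<And>\<phi>. tensor_eval x \<phi> = (if cbilinear \<phi> then \<Sum>(a, b)\<leftarrow>xs. \<phi> a b else 0)"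
    using tensor_eval_list[of x] by blast
  have "x = S xs" by (rule alg_tensor_eqI) (simp add: x ev)
  with P show ?thesis by simp
qed

definition cstar_seminorm :: "('c::star_algebra \<Rightarrow> real) \<Rightarrow> bool"
  where "cstar_seminorm p \<longleftrightarrow>
    (\<forall>x y. p (x + y) \<le> p x + p y) \<and> (\<forall>c x. p (c *\<^sub>C x) = cmod c * p x) \<and>
    (\<forall>x y. p (x * y) \<le> p x * p y) \<and> (\<forall>x. p (star x * x) = (p x)\<^sup>2)"

text \<open>The maximal C*-norm is the largest C*-seminorm on the algebraic tensor product. The bound on elementary
  tensors holds for every C*-seminorm and only makes boundedness of the supremum immediate. If one factor is
  nuclear, for instance the compact operators, this is the unique C*-norm on the algebraic tensor product.\<close>

definition subcross_cstar_seminorms :: "(('a::cstar_algebra, 'b::cstar_algebra) alg_tensor \<Rightarrow> real) set"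
  where "subcross_cstar_seminorms = {p. cstar_seminorm p \<and> (\<forall>a b. p (a \<otimes>\<^sub>a\<^sub>l\<^sub>g b) \<le> norm a * norm b)}"

definition max_norm :: "('a::cstar_algebra, 'b::cstar_algebra) alg_tensor \<Rightarrow> real"
  where "max_norm x = (SUP p\<in>subcross_cstar_seminorms. p x)"

lemma cstar_seminormD:
  assumes "cstar_seminorm p"
  shows "p (x + y) \<le> p x + p y" "p (c *\<^sub>C x) = cmod c * p x" "p (x * y) \<le> p x * p y"
    "p (star x * x) = (p x)\<^sup>2"
  using assms by (auto simp: cstar_seminorm_def)

lemma cstar_seminorm_zero: "cstar_seminorm p \<Longrightarrow> p 0 = 0"
  using cstar_seminormD(2)[of p 0 0] by (simp add: scaleC_zero_left)

lemma cstar_seminorm_minus: "cstar_seminorm p \<Longrightarrow> p (- x) = p x"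
  using cstar_seminormD(2)[of p "-1" x] by (simp add: scaleC_minus_one)

lemma cstar_seminorm_nonneg: "cstar_seminorm p \<Longrightarrow> 0 \<le> p x"
  using cstar_seminormD(1)[of p x "- x"] by (simp add: cstar_seminorm_minus cstar_seminorm_zero)

lemma cstar_seminorm_star: 
  assumes p: "cstar_seminorm p"
  shows "p (star x) = p x"
proof -
  have le: "p x \<le> p (star x)" for x
  proof (cases "p x = 0")
    case False
    then have "0 < p x" using cstar_seminorm_nonneg[OF p, of x] by simp
    moreover have "p x * p x \<le> p (star x) * p x"
      using cstar_seminormD(3,4)[OF p] by (metis power2_eq_square)
    ultimately show ?thesis by simp
  qed (simp add: cstar_seminorm_nonneg[OF p])
  show ?thesis using le[of x] le[of "star x"] by (simp add: star_star)
qed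

lemma cstar_seminorm_sup:
  assumes P: "P \<noteq> {}" "\<And>p. p \<in> P \<Longrightarrow> cstar_seminorm p" and bdd: "\<And>x. bdd_above ((\<lambda>p. p x) ` P)"
  shows "cstar_seminorm (\<lambda>x. SUP p\<in>P. p x)"
proof -
  define q where "q x = (SUP p\<in>P. p x)" for x
  have le: "p x \<le> q x" if "p \<in> P" for p x
    unfolding q_def using that by (intro cSUP_upper bdd)
  have least: "q x \<le> u" if "\<And>p. p \<in> P \<Longrightarrow> p x \<le> u" for x u
    unfolding q_def using that by (intro cSUP_least P(1))
  obtain p0 where p0: "p0 \<in> P" using P(1) by blast
  have nn: "0 \<le> q x" for x
    using le[OF p0, of x] cstar_seminorm_nonneg[OF P(2)[OF p0], of x] by simp
  have "q (x + y) \<le> q x + q y" for x y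
  proof (rule least)
    fix p assume p: "p \<in> P"
    show "p (x + y) \<le> q x + q y"
      using cstar_seminormD(1)[OF P(2)[OF p], of x y] le[OF p, of x] le[OF p, of y] by simp
  qed
  moreover have "q (x * y) \<le> q x * q y" for x y
  proof (rule least)
    fix p assume p: "p \<in> P"
    have "p x * p y \<le> q x * q y"
      by (intro mult_mono le p nn cstar_seminorm_nonneg[OF P(2)[OF p]])
    then show "p (x * y) \<le> q x * q y" using cstar_seminormD(3)[OF P(2)[OF p], of x y] by simp
  qed
  moreover have "q (c *\<^sub>C x) = cmod c * q x" for c x
  proof (rule antisym)
    have C: "q (c *\<^sub>C x) \<le> cmod c * q x" for c x
    proof (rule least)
      fix p assume p: "p \<in> P"
      show "p (c *\<^sub>C x) \<le> cmod c * q x"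
        using mult_left_mono[OF le[OF p, of x] norm_ge_zero[of c]] by (simp add: cstar_seminormD(2)[OF P(2)[OF p]])
    qed
    show "q (c *\<^sub>C x) \<le> cmod c * q x" by (rule C)
    show "cmod c * q x \<le> q (c *\<^sub>C x)"
    proof (cases "c = 0")
      case False
      then have "q x \<le> inverse (cmod c) * q (c *\<^sub>C x)"
        using C[of "inverse c" "c *\<^sub>C x"] by (simp add: scaleC_scaleC scaleC_one norm_inverse)
      with False show ?thesis by (simp add: field_simps)
    qed (simp add: nn)
  qed
  moreover have "q (star x * x) = (q x)\<^sup>2" for x
  proof (rule antisym)
    show "q (star x * x) \<le> (q x)\<^sup>2"
    proof (rule least)
      fix p assume p: "p \<in> P"
      show "p (star x * x) \<le> (q x)\<^sup>2"
        unfolding cstar_seminormD(4)[OF P(2)[OF p]]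
        by (intro power_mono le p cstar_seminorm_nonneg[OF P(2)[OF p]])
    qed
    have "q x \<le> sqrt (q (star x * x))"
    proof (rule least)
      fix p assume p: "p \<in> P"
      have "(p x)\<^sup>2 \<le> q (star x * x)"
        using le[OF p, of "star x * x"] by (simp add: cstar_seminormD(4)[OF P(2)[OF p]])
      then show "p x \<le> sqrt (q (star x * x))" by (rule real_le_rsqrt)
    qed
    then show "(q x)\<^sup>2 \<le> q (star x * x)"
      using power_mono[OF _ nn, of x "sqrt (q (star x * x))" 2] by (simp add: nn)
  qed
  ultimately have "cstar_seminorm q" by (simp add: cstar_seminorm_def)
  then show ?thesis by (simp add: q_def[abs_def])
qed

lemma subcross_nonempty: "(\<lambda>x. 0) \<in> subcross_cstar_seminorms"
  by (simp add: subcross_cstar_seminorms_def cstar_seminorm_def)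

lemma subcross_bdd_above: "bdd_above ((\<lambda>p. p x) ` subcross_cstar_seminorms)"
proof -
  have "\<exists>M. \<forall>p\<in>subcross_cstar_seminorms. p x \<le> M"
  proof (induction x rule: alg_tensor_induct)
    case zero
    then show ?case by (intro exI[of _ 0]) (auto simp: subcross_cstar_seminorms_def cstar_seminorm_zero)
  next
    case (add a b x)
    then obtain M where M: "\<And>p. p \<in> subcross_cstar_seminorms \<Longrightarrow> p x \<le> M" by blast
    have "p (a \<otimes>\<^sub>a\<^sub>l\<^sub>g b + x) \<le> norm a * norm b + M" if p: "p \<in> subcross_cstar_seminorms" for p
    proof -
      have "p (a \<otimes>\<^sub>a\<^sub>l\<^sub>g b + x) \<le> p (a \<otimes>\<^sub>a\<^sub>l\<^sub>g b) + p x" "p (a \<otimes>\<^sub>a\<^sub>l\<^sub>g b) \<le> norm a * norm b"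
        using p by (auto simp: subcross_cstar_seminorms_def cstar_seminorm_def)
      with M[OF p] show ?thesis by simp
    qed
    then show ?case by blast
  qed
  then show ?thesis by (auto simp: bdd_above_def)
qed

lemma cstar_seminorm_max_norm: "cstar_seminorm max_norm"
  unfolding max_norm_def[abs_def]
  by (rule cstar_seminorm_sup)
    (use subcross_nonempty in \<open>auto simp: subcross_cstar_seminorms_def intro: subcross_bdd_above[unfolded subcross_cstar_seminorms_def]\<close>)

lemma max_norm_elem: "max_norm (a \<otimes>\<^sub>a\<^sub>l\<^sub>g b) \<le> norm a * norm b"
  unfolding max_norm_def using subcross_nonempty
  by (intro cSUP_least) (auto simp: subcross_cstar_seminorms_def)


lemmas max_norm_triangle = cstar_seminormD(1)[OF cstar_seminorm_max_norm]
lemmas max_norm_scaleC = cstar_seminormD(2)[OF cstar_seminorm_max_norm]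
lemmas max_norm_mult = cstar_seminormD(3)[OF cstar_seminorm_max_norm]
lemmas max_norm_cstar = cstar_seminormD(4)[OF cstar_seminorm_max_norm]
lemmas max_norm_zero = cstar_seminorm_zero[OF cstar_seminorm_max_norm]
lemmas max_norm_minus = cstar_seminorm_minus[OF cstar_seminorm_max_norm]
lemmas max_norm_nonneg = cstar_seminorm_nonneg[OF cstar_seminorm_max_norm]
lemmas max_norm_star = cstar_seminorm_star[OF cstar_seminorm_max_norm]

lemma max_norm_minus_commute: "max_norm (x - y) = max_norm (y - x)"
  using max_norm_minus[of "x - y"] by simp

lemma max_norm_diff_triangle: "max_norm (x - z) \<le> max_norm (x - y) + max_norm (y - z)"
  using max_norm_triangle[of "x - y" "y - z"] by simp

lemma max_norm_abs_diff: "\<bar>max_norm x - max_norm y\<bar> \<le> max_norm (x - y)"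
  using max_norm_triangle[of "x - y" y] max_norm_triangle[of "y - x" x] max_norm_minus_commute[of x y]
  by simp

text \<open>The C*-tensor product is the completion of the algebraic one, as Cauchy sequences modulo null sequences.\<close>

definition max_Cauchy :: "(nat \<Rightarrow> ('a::cstar_algebra, 'b::cstar_algebra) alg_tensor) \<Rightarrow> bool"
  where "max_Cauchy X \<longleftrightarrow> (\<forall>e>0. \<exists>N. \<forall>m\<ge>N. \<forall>n\<ge>N. max_norm (X m - X n) < e)"

definition max_rel ::
    "(nat \<Rightarrow> ('a::cstar_algebra, 'b::cstar_algebra) alg_tensor) \<Rightarrow> (nat \<Rightarrow> ('a, 'b) alg_tensor) \<Rightarrow> bool"
  where "max_rel X Y \<longleftrightarrow> max_Cauchy X \<and> max_Cauchy Y \<and> (\<lambda>n. max_norm (X n - Y n)) \<longlonglongrightarrow> 0"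

lemma max_rel_refl: "max_rel X X \<longleftrightarrow> max_Cauchy X"
  by (simp add: max_rel_def max_norm_zero)

lemma max_null_le:
  assumes "\<And>n. max_norm (X n) \<le> f n" "f \<longlonglongrightarrow> 0"
  shows "(\<lambda>n. max_norm (X n)) \<longlonglongrightarrow> 0"
  by (rule tendsto_sandwich[of "\<lambda>_. 0", OF _ _ tendsto_const assms(2)])
    (auto simp: max_norm_nonneg assms(1))

quotient_type (overloaded) ('a, 'b) cstar_tensor =
    "nat \<Rightarrow> ('a::cstar_algebra, 'b::cstar_algebra) alg_tensor" / partial: max_rel
proof (rule part_equivpI)
  show "\<exists>X :: nat \<Rightarrow> ('a, 'b) alg_tensor. max_rel X X"
    by (rule exI[of _ "\<lambda>_. 0"]) (auto simp: max_rel_refl max_Cauchy_def max_norm_zero)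
  show "symp (max_rel :: (nat \<Rightarrow> ('a, 'b) alg_tensor) \<Rightarrow> _)"
  proof (rule sympI)
    fix X Y :: "nat \<Rightarrow> ('a, 'b) alg_tensor" assume "max_rel X Y"
    then show "max_rel Y X" unfolding max_rel_def by (subst max_norm_minus_commute) simp
  qed
  show "transp (max_rel :: (nat \<Rightarrow> ('a, 'b) alg_tensor) \<Rightarrow> _)"
  proof (rule transpI)
    fix X Y Z :: "nat \<Rightarrow> ('a, 'b) alg_tensor" assume XY: "max_rel X Y" and YZ: "max_rel Y Z"
    have "(\<lambda>n. max_norm (X n - Y n) + max_norm (Y n - Z n)) \<longlonglongrightarrow> 0"
      using XY YZ tendsto_add[of "\<lambda>n. max_norm (X n - Y n)" 0 sequentially "\<lambda>n. max_norm (Y n - Z n)" 0]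
      by (simp add: max_rel_def)
    then have "(\<lambda>n. max_norm (X n - Z n)) \<longlonglongrightarrow> 0"
      by (rule max_null_le[OF max_norm_diff_triangle])
    with XY YZ show "max_rel X Z" by (simp add: max_rel_def)
  qed
qed

lemma max_Cauchy_imp_Cauchy_norm:
  assumes "max_Cauchy X"
  shows "Cauchy (\<lambda>n. max_norm (X n))"
proof (rule metric_CauchyI)
  fix e :: real assume "0 < e"
  with assms obtain N where "\<And>m n. m \<ge> N \<Longrightarrow> n \<ge> N \<Longrightarrow> max_norm (X m - X n) < e"
    unfolding max_Cauchy_def by blast
  then show "\<exists>M. \<forall>m\<ge>M. \<forall>n\<ge>M. dist (max_norm (X m)) (max_norm (X n)) < e"
    unfolding dist_real_def by (meson max_norm_abs_diff order_le_less_trans)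
qed

lemma max_Cauchy_norm_tendsto:
  assumes "max_Cauchy X"
  shows "(\<lambda>n. max_norm (X n)) \<longlonglongrightarrow> lim (\<lambda>n. max_norm (X n))"
  using max_Cauchy_imp_Cauchy_norm[OF assms] by (simp add: Cauchy_convergent_iff convergent_LIMSEQ_iff)

lemma max_Cauchy_bounded:
  assumes "max_Cauchy X"
  obtains B where "0 < B" "\<And>n. max_norm (X n) \<le> B"
proof -
  obtain B where "0 < B" "\<And>n. norm (max_norm (X n)) \<le> B"
    using Cauchy_Bseq[OF max_Cauchy_imp_Cauchy_norm[OF assms]] by (rule BseqE) blast
  then show thesis using that[of B] by (auto simp: max_norm_nonneg)
qed

lemma max_Cauchy_add:
  assumes "max_Cauchy X" "max_Cauchy Y"
  shows "max_Cauchy (\<lambda>n. X n + Y n)"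
  unfolding max_Cauchy_def
proof (intro allI impI)
  fix e :: real assume "0 < e"
  then have e2: "0 < e / 2" by simp
  obtain M N where M: "\<And>m n. m \<ge> M \<Longrightarrow> n \<ge> M \<Longrightarrow> max_norm (X m - X n) < e / 2"
    and N: "\<And>m n. m \<ge> N \<Longrightarrow> n \<ge> N \<Longrightarrow> max_norm (Y m - Y n) < e / 2"
    using assms e2 unfolding max_Cauchy_def by meson
  have "max_norm (X m + Y m - (X n + Y n)) < e" if "m \<ge> max M N" "n \<ge> max M N" for m n
  proof -
    have "max_norm ((X m - X n) + (Y m - Y n)) < e"
      using max_norm_triangle[of "X m - X n" "Y m - Y n"] M[of m n] N[of m n] that by simp
    then show ?thesis by (simp add: algebra_simps)
  qed
  then show "\<exists>N. \<forall>m\<ge>N. \<forall>n\<ge>N. max_norm (X m + Y m - (X n + Y n)) < e" by blast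
qed

lemma max_Cauchy_Lipschitz:
  assumes "max_Cauchy X" and f: "\<And>x y. max_norm (f x - f y) \<le> K * max_norm (x - y)"
  shows "max_Cauchy (\<lambda>n. f (X n))"
  unfolding max_Cauchy_def
proof (intro allI impI)
  fix e :: real assume e: "0 < e"
  define L where "L = \<bar>K\<bar> + 1"
  have L: "0 < L" by (simp add: L_def)
  have "K \<le> L" by (simp add: L_def)
  then have fL: "max_norm (f x - f y) \<le> L * max_norm (x - y)" for x y
    by (rule order_trans[OF f mult_right_mono[OF _ max_norm_nonneg]])
  have "0 < e / L" using e L by simp
  then obtain N where N: "\<And>m n. m \<ge> N \<Longrightarrow> n \<ge> N \<Longrightarrow> max_norm (X m - X n) < e / L"
    using assms(1) unfolding max_Cauchy_def by meson
  have "max_norm (f (X m) - f (X n)) < e" if "m \<ge> N" "n \<ge> N" for m n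
    using N[OF that] fL[of "X m" "X n"] L by (simp add: less_divide_eq mult.commute)
  then show "\<exists>N. \<forall>m\<ge>N. \<forall>n\<ge>N. max_norm (f (X m) - f (X n)) < e" by blast
qed

lemma max_rel_Lipschitz:
  assumes "max_rel X Y" and f: "\<And>x y. max_norm (f x - f y) \<le> K * max_norm (x - y)"
  shows "max_rel (\<lambda>n. f (X n)) (\<lambda>n. f (Y n))"
  unfolding max_rel_def
proof (intro conjI)
  show "max_Cauchy (\<lambda>n. f (X n))" "max_Cauchy (\<lambda>n. f (Y n))"
    using assms by (auto simp: max_rel_def intro: max_Cauchy_Lipschitz)
  have "(\<lambda>n. K * max_norm (X n - Y n)) \<longlonglongrightarrow> 0"
    using assms(1) tendsto_mult_left[of "\<lambda>n. max_norm (X n - Y n)" 0 sequentially K] by (simp add: max_rel_def)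
  then show "(\<lambda>n. max_norm (f (X n) - f (Y n))) \<longlonglongrightarrow> 0" by (rule max_null_le[OF f])
qed

lemma max_rel_add:
  assumes "max_rel X Y" "max_rel X' Y'"
  shows "max_rel (\<lambda>n. X n + X' n) (\<lambda>n. Y n + Y' n)"
  unfolding max_rel_def
proof (intro conjI)
  show "max_Cauchy (\<lambda>n. X n + X' n)" "max_Cauchy (\<lambda>n. Y n + Y' n)"
    using assms by (auto simp: max_rel_def intro: max_Cauchy_add)
  have "(\<lambda>n. max_norm (X n - Y n) + max_norm (X' n - Y' n)) \<longlonglongrightarrow> 0"
    using assms tendsto_add[of "\<lambda>n. max_norm (X n - Y n)" 0 sequentially "\<lambda>n. max_norm (X' n - Y' n)" 0]
    by (simp add: max_rel_def)
  then show "(\<lambda>n. max_norm (X n + X' n - (Y n + Y' n))) \<longlonglongrightarrow> 0"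
    by (rule max_null_le[rotated]) (metis add_diff_add max_norm_triangle)
qed

lemma max_norm_mult_diff:
  "max_norm (x * y - x' * y') \<le> max_norm x * max_norm (y - y') + max_norm (x - x') * max_norm y'"
proof -
  have "x * y - x' * y' = x * (y - y') + (x - x') * y'" by (simp add: algebra_simps)
  then have "max_norm (x * y - x' * y') \<le> max_norm (x * (y - y')) + max_norm ((x - x') * y')"
    using max_norm_triangle[of "x * (y - y')" "(x - x') * y'"] by simp
  also have "\<dots> \<le> max_norm x * max_norm (y - y') + max_norm (x - x') * max_norm y'"
    by (intro add_mono max_norm_mult)
  finally show ?thesis .
qed

lemma max_Cauchy_mult:
  assumes "max_Cauchy X" "max_Cauchy Y"
  shows "max_Cauchy (\<lambda>n. X n * Y n)"
  unfolding max_Cauchy_def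
proof (intro allI impI)
  fix e :: real assume e: "0 < e"
  obtain B where B: "0 < B" "\<And>n. max_norm (X n) \<le> B" using max_Cauchy_bounded[OF assms(1)] by blast
  obtain C where C: "0 < C" "\<And>n. max_norm (Y n) \<le> C" using max_Cauchy_bounded[OF assms(2)] by blast
  define d where "d = e / (B + C)"
  have d: "0 < d" using e B(1) C(1) by (simp add: d_def)
  obtain M N where M: "\<And>m n. m \<ge> M \<Longrightarrow> n \<ge> M \<Longrightarrow> max_norm (X m - X n) < d"
    and N: "\<And>m n. m \<ge> N \<Longrightarrow> n \<ge> N \<Longrightarrow> max_norm (Y m - Y n) < d"
    using assms d unfolding max_Cauchy_def by meson
  have "max_norm (X m * Y m - X n * Y n) < e" if mn: "m \<ge> max M N" "n \<ge> max M N" for m n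
  proof -
    have "max_norm (X m * Y m - X n * Y n) \<le> max_norm (X m) * max_norm (Y m - Y n) + max_norm (X m - X n) * max_norm (Y n)"
      by (rule max_norm_mult_diff)
    also have "\<dots> \<le> B * max_norm (Y m - Y n) + max_norm (X m - X n) * C"
      by (intro add_mono mult_left_mono mult_right_mono B C max_norm_nonneg)
    also have "\<dots> < B * d + d * C"
      using M[of m n] N[of m n] mn B(1) C(1) by (intro add_strict_mono mult_strict_left_mono mult_strict_right_mono) auto
    also have "\<dots> = e"
    proof -
      have "B * d + d * C = (B + C) * d" by (simp add: algebra_simps)
      then show ?thesis using B(1) C(1) by (simp add: d_def)
    qed
    finally show ?thesis .
  qed
  then show "\<exists>N. \<forall>m\<ge>N. \<forall>n\<ge>N. max_norm (X m * Y m - X n * Y n) < e" by blast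
qed

lemma max_rel_mult:
  assumes "max_rel X Y" "max_rel X' Y'"
  shows "max_rel (\<lambda>n. X n * X' n) (\<lambda>n. Y n * Y' n)"
  unfolding max_rel_def
proof (intro conjI)
  have c: "max_Cauchy X" "max_Cauchy Y" "max_Cauchy X'" "max_Cauchy Y'"
    and l: "(\<lambda>n. max_norm (X n - Y n)) \<longlonglongrightarrow> 0" "(\<lambda>n. max_norm (X' n - Y' n)) \<longlonglongrightarrow> 0"
    using assms by (auto simp: max_rel_def)
  show "max_Cauchy (\<lambda>n. X n * X' n)" "max_Cauchy (\<lambda>n. Y n * Y' n)"
    using c by (auto intro: max_Cauchy_mult)
  have "(\<lambda>n. max_norm (X n) * max_norm (X' n - Y' n) + max_norm (X n - Y n) * max_norm (Y' n)) \<longlonglongrightarrow>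
      lim (\<lambda>n. max_norm (X n)) * 0 + 0 * lim (\<lambda>n. max_norm (Y' n))"
    by (intro tendsto_intros l max_Cauchy_norm_tendsto c)
  then have "(\<lambda>n. max_norm (X n) * max_norm (X' n - Y' n) + max_norm (X n - Y n) * max_norm (Y' n)) \<longlonglongrightarrow> 0" by simp
  then show "(\<lambda>n. max_norm (X n * X' n - Y n * Y' n)) \<longlonglongrightarrow> 0"
    by (rule max_null_le[OF max_norm_mult_diff])
qed

lemma max_rel_scaleC: "max_rel X Y \<Longrightarrow> max_rel (\<lambda>n. c *\<^sub>C X n) (\<lambda>n. c *\<^sub>C Y n)"
  by (erule max_rel_Lipschitz[where K="cmod c"]) (simp add: scaleC_diff_right[symmetric] max_norm_scaleC)

lemma max_rel_star: "max_rel X Y \<Longrightarrow> max_rel (\<lambda>n. star (X n)) (\<lambda>n. star (Y n))"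
  by (erule max_rel_Lipschitz[where K=1]) (simp add: star_diff[symmetric] max_norm_star)

lemma max_rel_uminus: "max_rel X Y \<Longrightarrow> max_rel (\<lambda>n. - X n) (\<lambda>n. - Y n)"
  using max_rel_scaleC[of X Y "-1"] by (simp add: scaleC_minus_one)

lemma max_rel_minus: "max_rel X Y \<Longrightarrow> max_rel X' Y' \<Longrightarrow> max_rel (\<lambda>n. X n - X' n) (\<lambda>n. Y n - Y' n)"
  using max_rel_add[OF _ max_rel_uminus, of X Y X' Y'] by simp

lemma max_rel_scaleR: "max_rel X Y \<Longrightarrow> max_rel (\<lambda>n. r *\<^sub>R X n) (\<lambda>n. r *\<^sub>R Y n)"
  using max_rel_scaleC[of X Y "complex_of_real r"] by (simp add: scaleC_of_real)

lemma max_rel_const: "max_rel (\<lambda>_. x) (\<lambda>_. x)"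
  by (auto simp: max_rel_refl max_Cauchy_def max_norm_zero)

lemma max_rel_lim:
  assumes "max_rel X Y"
  shows "lim (\<lambda>n. max_norm (X n)) = lim (\<lambda>n. max_norm (Y n))"
proof -
  have c: "max_Cauchy X" "max_Cauchy Y" and l: "(\<lambda>n. max_norm (X n - Y n)) \<longlonglongrightarrow> 0"
    using assms by (auto simp: max_rel_def)
  have "(\<lambda>n. \<bar>max_norm (X n) - max_norm (Y n)\<bar>) \<longlonglongrightarrow> 0"
    by (rule tendsto_sandwich[of "\<lambda>_. 0", OF _ _ tendsto_const l]) (auto simp: max_norm_abs_diff)
  then have "(\<lambda>n. max_norm (X n) - max_norm (Y n)) \<longlonglongrightarrow> 0" by (rule tendsto_rabs_zero_cancel)
  from tendsto_diff[OF max_Cauchy_norm_tendsto[OF c(1)] this]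
  have "(\<lambda>n. max_norm (Y n)) \<longlonglongrightarrow> lim (\<lambda>n. max_norm (X n))" by simp
  then show ?thesis by (simp add: limI)
qed

lemma cstar_tensor_cases:
  obtains X where "max_rel X X" "x = abs_cstar_tensor X"
  using Quotient_rep_reflp[OF Quotient_cstar_tensor] Quotient_abs_rep[OF Quotient_cstar_tensor] by metis

instantiation cstar_tensor :: (cstar_algebra, cstar_algebra) star_algebra
begin

lift_definition zero_cstar_tensor :: "('a, 'b) cstar_tensor" is "\<lambda>_. 0" by (rule max_rel_const)
lift_definition plus_cstar_tensor :: "('a, 'b) cstar_tensor \<Rightarrow> ('a, 'b) cstar_tensor \<Rightarrow> ('a, 'b) cstar_tensor"
  is "\<lambda>X Y n. X n + Y n" by (rule max_rel_add)
lift_definition uminus_cstar_tensor :: "('a, 'b) cstar_tensor \<Rightarrow> ('a, 'b) cstar_tensor"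
  is "\<lambda>X n. - X n" by (rule max_rel_uminus)
lift_definition minus_cstar_tensor :: "('a, 'b) cstar_tensor \<Rightarrow> ('a, 'b) cstar_tensor \<Rightarrow> ('a, 'b) cstar_tensor"
  is "\<lambda>X Y n. X n - Y n" by (rule max_rel_minus)
lift_definition scaleR_cstar_tensor :: "real \<Rightarrow> ('a, 'b) cstar_tensor \<Rightarrow> ('a, 'b) cstar_tensor"
  is "\<lambda>r X n. r *\<^sub>R X n" by (rule max_rel_scaleR)
lift_definition scaleC_cstar_tensor :: "complex \<Rightarrow> ('a, 'b) cstar_tensor \<Rightarrow> ('a, 'b) cstar_tensor"
  is "\<lambda>c X n. c *\<^sub>C X n" by (rule max_rel_scaleC)
lift_definition times_cstar_tensor :: "('a, 'b) cstar_tensor \<Rightarrow> ('a, 'b) cstar_tensor \<Rightarrow> ('a, 'b) cstar_tensor"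
  is "\<lambda>X Y n. X n * Y n" by (rule max_rel_mult)
lift_definition star_cstar_tensor :: "('a, 'b) cstar_tensor \<Rightarrow> ('a, 'b) cstar_tensor"
  is "\<lambda>X n. star (X n)" by (rule max_rel_star)

lemmas cstar_tensor_abs_eq = zero_cstar_tensor.abs_eq plus_cstar_tensor.abs_eq uminus_cstar_tensor.abs_eq
  minus_cstar_tensor.abs_eq scaleR_cstar_tensor.abs_eq scaleC_cstar_tensor.abs_eq times_cstar_tensor.abs_eq
  star_cstar_tensor.abs_eq
lemmas cstar_tensor_rel = max_rel_add max_rel_uminus max_rel_minus max_rel_scaleR max_rel_scaleC
  max_rel_mult max_rel_star max_rel_const

instance
proof
  fix x y z :: "('a, 'b) cstar_tensor" and c d :: complex and r s :: real
  obtain X where X: "max_rel X X" "x = abs_cstar_tensor X" by (rule cstar_tensor_cases)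
  obtain Y where Y: "max_rel Y Y" "y = abs_cstar_tensor Y" by (rule cstar_tensor_cases)
  obtain Z where Z: "max_rel Z Z" "z = abs_cstar_tensor Z" by (rule cstar_tensor_cases)
  note simps = X Y Z cstar_tensor_abs_eq cstar_tensor_rel
  show "x + y + z = x + (y + z)" by (simp add: simps add.assoc)
  show "x + y = y + x" by (simp add: simps add.commute)
  show "0 + x = x" by (simp add: simps)
  show "- x + x = 0" by (simp add: simps)
  show "x - y = x + - y" by (simp add: simps)
  show "r *\<^sub>R (x + y) = r *\<^sub>R x + r *\<^sub>R y" by (simp add: simps scaleR_add_right)
  show "(r + s) *\<^sub>R x = r *\<^sub>R x + s *\<^sub>R x" by (simp add: simps scaleR_add_left)
  show "r *\<^sub>R s *\<^sub>R x = (r * s) *\<^sub>R x" by (simp add: simps)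
  show "1 *\<^sub>R x = x" by (simp add: simps)
  show "c *\<^sub>C (x + y) = c *\<^sub>C x + c *\<^sub>C y" by (simp add: simps scaleC_add_right)
  show "(c + d) *\<^sub>C x = c *\<^sub>C x + d *\<^sub>C x" by (simp add: simps scaleC_add_left)
  show "c *\<^sub>C d *\<^sub>C x = (c * d) *\<^sub>C x" by (simp add: simps scaleC_scaleC)
  show "complex_of_real r *\<^sub>C x = r *\<^sub>R x" by (simp add: simps scaleC_of_real)
  show "x * y * z = x * (y * z)" by (simp add: simps mult.assoc)
  show "(x + y) * z = x * z + y * z" by (simp add: simps distrib_right)
  show "x * (y + z) = x * y + x * z" by (simp add: simps distrib_left)
  show "r *\<^sub>R x * y = r *\<^sub>R (x * y)" by (simp add: simps)
  show "x * r *\<^sub>R y = r *\<^sub>R (x * y)" by (simp add: simps)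
  show "c *\<^sub>C x * y = c *\<^sub>C (x * y)" by (simp add: simps mult_scaleC_left)
  show "x * c *\<^sub>C y = c *\<^sub>C (x * y)" by (simp add: simps mult_scaleC_right)
  show "star (star x) = x" by (simp add: simps star_star)
  show "star (x + y) = star x + star y" by (simp add: simps star_add)
  show "star (c *\<^sub>C x) = cnj c *\<^sub>C star x" by (simp add: simps star_scaleC)
  show "star (x * y) = star y * star x" by (simp add: simps star_mult)
qed

end

instantiation cstar_tensor :: (cstar_algebra, cstar_algebra) real_normed_algebra
begin

lift_definition norm_cstar_tensor :: "('a, 'b) cstar_tensor \<Rightarrow> real"
  is "\<lambda>X. lim (\<lambda>n. max_norm (X n))" by (rule max_rel_lim)
definition dist_cstar_tensor :: "('a, 'b) cstar_tensor \<Rightarrow> ('a, 'b) cstar_tensor \<Rightarrow> real"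
  where "dist (x::('a, 'b) cstar_tensor) y = norm (x - y)"
definition sgn_cstar_tensor :: "('a, 'b) cstar_tensor \<Rightarrow> ('a, 'b) cstar_tensor"
  where "sgn (x::('a, 'b) cstar_tensor) = x /\<^sub>R norm x"
definition uniformity_cstar_tensor :: "(('a, 'b) cstar_tensor \<times> ('a, 'b) cstar_tensor) filter"
  where "uniformity = (INF e\<in>{0<..}. principal {(x::('a, 'b) cstar_tensor, y). dist x y < e})"
definition open_cstar_tensor :: "('a, 'b) cstar_tensor set \<Rightarrow> bool"
  where "open (U::('a, 'b) cstar_tensor set) = (\<forall>x\<in>U. \<forall>\<^sub>F (x', y) in uniformity. x' = x \<longrightarrow> y \<in> U)"

lemma norm_abs_tendsto:
  "max_rel X X \<Longrightarrow> (\<lambda>n. max_norm (X n)) \<longlonglongrightarrow> norm (abs_cstar_tensor X)"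
  by (simp add: norm_cstar_tensor.abs_eq max_rel_refl max_Cauchy_norm_tendsto)

instance
proof
  fix x y :: "('a, 'b) cstar_tensor" and r :: real
  obtain X where X: "max_rel X X" "x = abs_cstar_tensor X" by (rule cstar_tensor_cases)
  obtain Y where Y: "max_rel Y Y" "y = abs_cstar_tensor Y" by (rule cstar_tensor_cases)
  note nx = norm_abs_tendsto[OF X(1)] and ny = norm_abs_tendsto[OF Y(1)]
  note simps = X Y cstar_tensor_abs_eq cstar_tensor_rel
  show "(norm x = 0) = (x = 0)"
  proof
    assume "norm x = 0"
    with nx X have "max_rel X (\<lambda>_. 0)"
      using max_rel_const[of 0] by (auto simp: max_rel_def)
    then have "x = abs_cstar_tensor (\<lambda>_. 0)"
      using X Quotient_rel_abs[OF Quotient_cstar_tensor] by blast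
    then show "x = 0" by (simp add: zero_cstar_tensor.abs_eq)
  next
    assume "x = 0"
    then show "norm x = 0"
      by (simp add: zero_cstar_tensor.abs_eq norm_cstar_tensor.abs_eq max_rel_const max_norm_zero)
  qed
  have "norm (abs_cstar_tensor (\<lambda>n. X n + Y n)) \<le> norm (abs_cstar_tensor X) + norm (abs_cstar_tensor Y)"
    by (rule LIMSEQ_le[OF norm_abs_tendsto tendsto_add[OF nx ny]])
      (auto simp: cstar_tensor_rel X Y max_norm_triangle)
  then show "norm (x + y) \<le> norm x + norm y" by (simp add: simps)
  have "norm (abs_cstar_tensor (\<lambda>n. X n * Y n)) \<le> norm (abs_cstar_tensor X) * norm (abs_cstar_tensor Y)"
    by (rule LIMSEQ_le[OF norm_abs_tendsto tendsto_mult[OF nx ny]])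
      (auto simp: cstar_tensor_rel X Y max_norm_mult)
  then show "norm (x * y) \<le> norm x * norm y" by (simp add: simps)
  have "(\<lambda>n. max_norm (r *\<^sub>R X n)) \<longlonglongrightarrow> \<bar>r\<bar> * norm (abs_cstar_tensor X)"
    using tendsto_mult_left[OF nx, of "\<bar>r\<bar>"] by (simp add: scaleC_of_real[symmetric] max_norm_scaleC)
  with norm_abs_tendsto[OF max_rel_scaleR[OF X(1)]]
  have "norm (abs_cstar_tensor (\<lambda>n. r *\<^sub>R X n)) = \<bar>r\<bar> * norm (abs_cstar_tensor X)"
    by (rule LIMSEQ_unique)
  then show "norm (r *\<^sub>R x) = \<bar>r\<bar> * norm x" by (simp add: simps)
qed (simp_all add: dist_cstar_tensor_def sgn_cstar_tensor_def uniformity_cstar_tensor_def open_cstar_tensor_def)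

end

lemma cstar_tensor_approx:
  assumes "max_rel X X" "0 < e"
  shows "\<exists>n. norm (abs_cstar_tensor X - abs_cstar_tensor (\<lambda>_. X n)) < e"
proof -
  have "0 < e / 2" using assms(2) by simp
  then obtain N where N: "\<And>m n. m \<ge> N \<Longrightarrow> n \<ge> N \<Longrightarrow> max_norm (X m - X n) < e / 2"
    using assms(1) unfolding max_rel_refl max_Cauchy_def by meson
  have r: "max_rel (\<lambda>m. X m - X N) (\<lambda>m. X m - X N)" by (intro max_rel_minus assms(1) max_rel_const)
  have "norm (abs_cstar_tensor (\<lambda>m. X m - X N)) \<le> e / 2"
    by (rule LIMSEQ_le_const2[OF norm_abs_tendsto[OF r]]) (use N in \<open>auto intro!: exI[of _ N] less_imp_le\<close>)
  then have "norm (abs_cstar_tensor X - abs_cstar_tensor (\<lambda>_. X N)) < e"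
    using assms by (simp add: minus_cstar_tensor.abs_eq max_rel_const)
  then show ?thesis by blast
qed

lemma norm_abs_const: "norm (abs_cstar_tensor (\<lambda>_. x)) = max_norm x"
  using norm_abs_tendsto[OF max_rel_const[of x]] LIMSEQ_unique[OF tendsto_const] by force

instance cstar_tensor :: (cstar_algebra, cstar_algebra) cstar_algebra
proof
  fix F :: "nat \<Rightarrow> ('a, 'b) cstar_tensor" assume F: "Cauchy F"
  define i :: "('a, 'b) alg_tensor \<Rightarrow> ('a, 'b) cstar_tensor" where "i x = abs_cstar_tensor (\<lambda>_. x)" for x
  have i_diff: "norm (i x - i y) = max_norm (x - y)" for x y
    by (simp add: i_def minus_cstar_tensor.abs_eq max_rel_const norm_abs_const)
  have "\<exists>y. norm (F k - i y) < inverse (real (Suc k))" for k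
  proof -
    obtain X where "max_rel X X" "F k = abs_cstar_tensor X" by (rule cstar_tensor_cases)
    with cstar_tensor_approx[of X "inverse (real (Suc k))"] show ?thesis by (auto simp: i_def)
  qed
  then obtain Y where Y: "\<And>k. norm (F k - i (Y k)) < inverse (real (Suc k))" by metis
  have FY: "(\<lambda>k. F k - i (Y k)) \<longlonglongrightarrow> 0"
  proof (rule Lim_null_comparison[OF _ LIMSEQ_inverse_real_of_nat])
    show "\<forall>\<^sub>F k in sequentially. norm (F k - i (Y k)) \<le> inverse (real (Suc k))"
      using Y by (intro always_eventually allI less_imp_le)
  qed
  have mY: "max_Cauchy Y"
    unfolding max_Cauchy_def
  proof (intro allI impI)
    fix e :: real assume "0 < e"
    then have e3: "0 < e / 3" by simp
    obtain M where M: "\<And>m n. m \<ge> M \<Longrightarrow> n \<ge> M \<Longrightarrow> norm (F m - F n) < e / 3"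
      using F e3 unfolding Cauchy_def dist_norm by meson
    obtain N where N: "\<And>n. n \<ge> N \<Longrightarrow> norm (F n - i (Y n)) < e / 3"
      using LIMSEQ_D[OF FY e3] by auto
    have "max_norm (Y m - Y n) < e" if "m \<ge> max M N" "n \<ge> max M N" for m n
    proof -
      have "i (Y m) - i (Y n) = (F m - F n) - ((F m - i (Y m)) - (F n - i (Y n)))" by simp
      from arg_cong[OF this, of norm] have "norm (i (Y m) - i (Y n)) \<le> norm (F m - F n) + (norm (F m - i (Y m)) + norm (F n - i (Y n)))"
        using norm_triangle_ineq4[of "F m - F n" "(F m - i (Y m)) - (F n - i (Y n))"]
          norm_triangle_ineq4[of "F m - i (Y m)" "F n - i (Y n)"] by linarith
      also have "\<dots> < e / 3 + (e / 3 + e / 3)" using that by (intro add_strict_mono M N) auto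
      finally show ?thesis by (simp add: i_diff)
    qed
    then show "\<exists>N. \<forall>m\<ge>N. \<forall>n\<ge>N. max_norm (Y m - Y n) < e" by blast
  qed
  then have rY: "max_rel Y Y" by (simp add: max_rel_refl)
  have "(\<lambda>k. i (Y k)) \<longlonglongrightarrow> abs_cstar_tensor Y"
  proof (rule metric_LIMSEQ_I)
    fix e :: real assume "0 < e"
    then have "0 < e / 2" by simp
    then obtain N where N: "\<And>m n. m \<ge> N \<Longrightarrow> n \<ge> N \<Longrightarrow> max_norm (Y m - Y n) < e / 2"
      using mY unfolding max_Cauchy_def by meson
    have "dist (i (Y k)) (abs_cstar_tensor Y) < e" if k: "k \<ge> N" for k
    proof -
      have r: "max_rel (\<lambda>m. Y k - Y m) (\<lambda>m. Y k - Y m)" by (intro max_rel_minus rY max_rel_const)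
      have "norm (abs_cstar_tensor (\<lambda>m. Y k - Y m)) \<le> e / 2"
        by (rule LIMSEQ_le_const2[OF norm_abs_tendsto[OF r]]) (use N k in \<open>auto intro!: exI[of _ N] less_imp_le\<close>)
      then show ?thesis
        using \<open>0 < e\<close> by (simp add: dist_norm i_def minus_cstar_tensor.abs_eq max_rel_const rY)
    qed
    then show "\<exists>N. \<forall>k\<ge>N. dist (i (Y k)) (abs_cstar_tensor Y) < e" by blast
  qed
  from tendsto_add[OF FY this] have "F \<longlonglongrightarrow> abs_cstar_tensor Y" by simp
  then show "convergent F" by (auto simp: convergent_def)
next
  fix x :: "('a, 'b) cstar_tensor" and c :: complex
  obtain X where X: "max_rel X X" "x = abs_cstar_tensor X" by (rule cstar_tensor_cases)
  note nx = norm_abs_tendsto[OF X(1)]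
  have "(\<lambda>n. max_norm (c *\<^sub>C X n)) \<longlonglongrightarrow> cmod c * norm (abs_cstar_tensor X)"
    using tendsto_mult_left[OF nx, of "cmod c"] by (simp add: max_norm_scaleC)
  with norm_abs_tendsto[OF max_rel_scaleC[OF X(1)]]
  have "norm (abs_cstar_tensor (\<lambda>n. c *\<^sub>C X n)) = cmod c * norm (abs_cstar_tensor X)"
    by (rule LIMSEQ_unique)
  then show "norm (c *\<^sub>C x) = cmod c * norm x" by (simp add: X scaleC_cstar_tensor.abs_eq)
  have "(\<lambda>n. max_norm (star (X n) * X n)) \<longlonglongrightarrow> (norm (abs_cstar_tensor X))\<^sup>2"
    using tendsto_power[OF nx, of 2] by (simp add: max_norm_cstar)
  with norm_abs_tendsto[OF max_rel_mult[OF max_rel_star[OF X(1)] X(1)]]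
  have "norm (abs_cstar_tensor (\<lambda>n. star (X n) * X n)) = (norm (abs_cstar_tensor X))\<^sup>2"
    by (rule LIMSEQ_unique)
  then show "norm (star x * x) = (norm x)\<^sup>2"
    by (simp add: X times_cstar_tensor.abs_eq star_cstar_tensor.abs_eq max_rel_star)
qed


section \<open>Cuntz comparison\<close>

definition positive :: "'a::cstar_algebra \<Rightarrow> bool"
  where "positive a \<longleftrightarrow> (\<exists>x. a = star x * x)"

definition cuntz_le :: "'a::cstar_algebra \<Rightarrow> 'a \<Rightarrow> bool"
  where "cuntz_le a b \<longleftrightarrow> (\<exists>x :: nat \<Rightarrow> 'a. (\<lambda>n. star (x n) * b * x n) \<longlonglongrightarrow> a)"

definition cuntz_rel :: "('a::cstar_algebra \<times> 'a) set"
  where "cuntz_rel = {(a, b). positive a \<and> positive b \<and> cuntz_le a b \<and> cuntz_le b a}"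

definition cuntz_class :: "'a::cstar_algebra \<Rightarrow> 'a set"
  where "cuntz_class a = cuntz_rel `` {a}"


section \<open>Ordered semigroups\<close>

record 's ordered_semigroup =
  carrier :: "'s set"
  osum :: "'s \<Rightarrow> 's \<Rightarrow> 's"
  ozero :: 's
  ole :: "'s \<Rightarrow> 's \<Rightarrow> bool"

definition is_ordered_semigroup :: "'s ordered_semigroup \<Rightarrow> bool"
  where "is_ordered_semigroup S \<longleftrightarrow>
    ozero S \<in> carrier S \<and>
    (\<forall>x\<in>carrier S. \<forall>y\<in>carrier S. osum S x y \<in> carrier S) \<and>
    (\<forall>x\<in>carrier S. \<forall>y\<in>carrier S. \<forall>z\<in>carrier S. osum S (osum S x y) z = osum S x (osum S y z)) \<and>
    (\<forall>x\<in>carrier S. \<forall>y\<in>carrier S. osum S x y = osum S y x) \<and>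
    (\<forall>x\<in>carrier S. osum S (ozero S) x = x) \<and>
    (\<forall>x\<in>carrier S. ole S x x) \<and>
    (\<forall>x\<in>carrier S. \<forall>y\<in>carrier S. \<forall>z\<in>carrier S. ole S x y \<longrightarrow> ole S y z \<longrightarrow> ole S x z) \<and>
    (\<forall>x\<in>carrier S. \<forall>y\<in>carrier S. ole S x y \<longrightarrow> ole S y x \<longrightarrow> x = y) \<and>
    (\<forall>x\<in>carrier S. \<forall>y\<in>carrier S. \<forall>z\<in>carrier S. ole S x y \<longrightarrow> ole S (osum S x z) (osum S y z)) \<and>
    (\<forall>x\<in>carrier S. ole S (ozero S) x)"

definition increasing :: "'s ordered_semigroup \<Rightarrow> (nat \<Rightarrow> 's) \<Rightarrow> bool"
  where "increasing S f \<longleftrightarrow> (\<forall>n. f n \<in> carrier S) \<and> (\<forall>n. ole S (f n) (f (Suc n)))"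

definition is_supremum :: "'s ordered_semigroup \<Rightarrow> (nat \<Rightarrow> 's) \<Rightarrow> 's \<Rightarrow> bool"
  where "is_supremum S f s \<longleftrightarrow> s \<in> carrier S \<and> (\<forall>n. ole S (f n) s) \<and>
    (\<forall>u\<in>carrier S. (\<forall>n. ole S (f n) u) \<longrightarrow> ole S s u)"

definition way_below :: "'s ordered_semigroup \<Rightarrow> 's \<Rightarrow> 's \<Rightarrow> bool"
  where "way_below S s t \<longleftrightarrow> s \<in> carrier S \<and> t \<in> carrier S \<and>
    (\<forall>f u. increasing S f \<longrightarrow> is_supremum S f u \<longrightarrow> ole S t u \<longrightarrow> (\<exists>n. ole S s (f n)))"

definition axiom_O1 :: "'s ordered_semigroup \<Rightarrow> bool"
  where "axiom_O1 S \<longleftrightarrow> (\<forall>f. increasing S f \<longrightarrow> (\<exists>s. is_supremum S f s))"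

definition axiom_O2 :: "'s ordered_semigroup \<Rightarrow> bool"
  where "axiom_O2 S \<longleftrightarrow>
    (\<forall>s\<in>carrier S. \<exists>f. (\<forall>n. f n \<in> carrier S \<and> way_below S (f n) (f (Suc n))) \<and> is_supremum S f s)"

definition axiom_O3 :: "'s ordered_semigroup \<Rightarrow> bool"
  where "axiom_O3 S \<longleftrightarrow>
    (\<forall>s1 t1 s2 t2. way_below S s1 t1 \<longrightarrow> way_below S s2 t2 \<longrightarrow> way_below S (osum S s1 s2) (osum S t1 t2))"

definition axiom_O4 :: "'s ordered_semigroup \<Rightarrow> bool"
  where "axiom_O4 S \<longleftrightarrow>
    (\<forall>f g s t. increasing S f \<longrightarrow> increasing S g \<longrightarrow> is_supremum S f s \<longrightarrow> is_supremum S g t \<longrightarrow>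
      is_supremum S (\<lambda>n. osum S (f n) (g n)) (osum S s t))"

definition axiom_O5 :: "'s ordered_semigroup \<Rightarrow> bool"
  where "axiom_O5 S \<longleftrightarrow>
    (\<forall>s'\<in>carrier S. \<forall>s\<in>carrier S. \<forall>t\<in>carrier S. way_below S s' s \<longrightarrow> ole S s t \<longrightarrow>
      (\<exists>r\<in>carrier S. ole S (osum S s' r) t \<and> ole S t (osum S s r)))"

definition axiom_O6 :: "'s ordered_semigroup \<Rightarrow> bool"
  where "axiom_O6 S \<longleftrightarrow>
    (\<forall>s\<in>carrier S. \<forall>r\<in>carrier S. \<forall>t\<in>carrier S. ole S s (osum S r t) \<longrightarrow>
      (\<forall>s'\<in>carrier S. way_below S s' s \<longrightarrow>
        (\<exists>r'\<in>carrier S. \<exists>t'\<in>carrier S. ole S s' (osum S r' t') \<and>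
          ole S r' r \<and> ole S r' s \<and> ole S t' t \<and> ole S t' s)))"

definition is_dense :: "'s ordered_semigroup \<Rightarrow> 's set \<Rightarrow> bool"
  where "is_dense S D \<longleftrightarrow> D \<subseteq> carrier S \<and>
    (\<forall>s\<in>carrier S. \<exists>f. (\<forall>n. f n \<in> D \<and> way_below S (f n) (f (Suc n))) \<and> is_supremum S f s)"


section \<open>The Cuntz semigroup\<close>

type_synonym 'a stabilization = "('a, compact_op) cstar_tensor"

text \<open>The sum of two classes is the common class of all \<open>a + b\<close> with \<open>a\<close>, \<open>b\<close> orthogonal representatives;
  for positive elements, orthogonality \<open>a * b = 0\<close> also gives \<open>b * a = 0\<close>.\<close>

definition Cu :: "'a::cstar_algebra itself \<Rightarrow> 'a stabilization set ordered_semigroup"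
  where "Cu A =
    \<lparr> carrier = {a. positive a} // cuntz_rel,
      osum = (\<lambda>s t. THE u. \<exists>a\<in>s. \<exists>b\<in>t. a * b = 0 \<and> u = cuntz_class (a + b)),
      ozero = cuntz_class 0,
      ole = (\<lambda>s t. \<exists>a\<in>s. \<exists>b\<in>t. cuntz_le a b) \<rparr>"

end

theory Submission
  imports Defs
begin

text \<open>
  In the unitization of a C*-algebra the squares of self-adjoint elements form a closed cone, and the Bernstein
  expansion of a polynomial \<open>p\<close> bounds \<open>p(a)\<close> by the supremum of \<open>p\<close> for positive \<open>a\<close>; this gives a continuous
  functional calculus without any spectral theory. Cuntz comparison then rests on two facts: \<open>0 \<le> x \<le> y\<close>
  implies that \<open>x\<close> is Cuntz below \<open>y\<close>, and \<open>\<parallel>a - b\<parallel> < \<epsilon>\<close> implies that the cut-down \<open>(a - \<epsilon>)\<^sub>+\<close> is Cuntz below \<open>b\<close>.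

  Stability enters only through isometries \<open>V\<^sub>k\<close> of \<open>\<ell>\<^sup>2\<close> with orthogonal ranges. They yield orthogonal sums, and the
  supremum of an increasing sequence \<open>(a\<^sub>n)\<close> as a norm limit of elements \<open>w\<^sub>n\<^sup>* a\<^sub>n w\<^sub>n\<close>, where each step moves
  \<open>w\<^sub>n\<close> to the next level almost isometrically and puts a small copy of an earlier \<open>a\<^sub>m\<close> into a new corner.
  Because the supremum is such a limit, \<open>s \<lless> t\<close> holds exactly if \<open>s\<close> is below some \<open>(t - \<epsilon>)\<^sub>+\<close>, and the axioms
  become statements about cut-downs.
\<close>

text \<open>The obstacle is the missing unit: cuts, square roots and complements
  \<open>1 - G\<close> are all written with one. So comparisons are made in the unitization and
  brought back, since functions vanishing at \<open>0\<close> do not leave the algebra and a witness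
  multiplied by an approximate unit returns to it. The cone is built from squares of self-adjoint
  elements because for self-adjoint \<open>a\<close> with \<open>norm a \<le> r\<close> positivity
  then amounts to \<open>norm (r *\<^sub>R 1 - a) \<le> r\<close>, a condition that survives sums
  and limits.

  Cuntz subequivalence only approximates its smaller element. Cutting down absorbs the error: the
  distance of two elements is paid for by the gap between two levels of cutting. This is the origin
  of the factors \<open>2\<close>, \<open>3\<close>, \<open>1/2\<close> and \<open>1/8\<close> in
  front of the levels.

  The isometries supply fresh room: \<open>w\<^sub>n\<close> vanishes on all corners from index
  \<open>n\<close> on, so each step writes into a corner that no earlier step has used, and
  shrinking tolerances keep the earlier copies recoverable in the limit.\<close>

class unital_cstar_algebra = cstar_algebra + real_normed_algebra_1

section \<open>Star-algebra identities and real and imaginary parts\<close>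

lemma norm_star: "norm (star x) = norm (x :: 'a::cstar_algebra)"
proof -
  have le: "norm x \<le> norm (star x)" for x :: 'a
  proof (cases "norm x = 0")
    case False
    have "norm x * norm x \<le> norm (star x) * norm x"
      using cstar_identity[of x] norm_mult_ineq[of "star x" x] by (simp add: power2_eq_square)
    with False show ?thesis by (simp add: mult_le_cancel_right)
  qed simp
  show ?thesis using le[of x] le[of "star x"] by (simp add: star_star)
qed

lemma star_scaleR: "star (r *\<^sub>R x) = r *\<^sub>R star (x :: 'a::star_algebra)"
  using star_scaleC[of "complex_of_real r" x] by (simp add: scaleC_of_real)

lemma tendsto_if_norm_diff_le: "(\<And>n. norm (X n - l) \<le> g n) \<Longrightarrow> g \<longlonglongrightarrow> 0 \<Longrightarrow> X \<longlonglongrightarrow> l"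
  by (rule LIM_zero_cancel, rule Lim_null_comparison[OF always_eventually[OF allI]])

lemma norm_conj_le: "norm (star x * a * x) \<le> (norm (x :: 'a::cstar_algebra))\<^sup>2 * norm a"
proof -
  have "norm (star x * a * x) \<le> norm (star x) * norm a * norm x"
    by (rule order_trans[OF norm_mult_ineq mult_right_mono[OF norm_mult_ineq]]) simp
  then show ?thesis by (simp add: norm_star power2_eq_square mult.commute mult.left_commute)
qed

lemma bounded_linear_star: "bounded_linear (star :: 'a::cstar_algebra \<Rightarrow> 'a)"
  by (rule bounded_linear_intro[where K=1]) (auto simp: star_add star_scaleR norm_star)

lemmas tendsto_star [tendsto_intros] = bounded_linear.tendsto[OF bounded_linear_star]

lemma star_one: "star 1 = (1 :: 'a::unital_cstar_algebra)"
  by (metis star_mult star_star mult_1_right mult_1_left)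

lemma norm_square_self_adjoint: "star h = h \<Longrightarrow> norm (h * h) = (norm (h :: 'a::cstar_algebra))\<^sup>2"
  using cstar_identity[of h] by simp

lemma self_adjoint_square_eq_0: "star h = h \<Longrightarrow> h * h = 0 \<Longrightarrow> h = (0 :: 'a::cstar_algebra)"
  using norm_square_self_adjoint[of h] by simp

lemma self_adjoint_decomposition:
  fixes x :: "'a::star_algebra"
  obtains h k where "star h = h" "star k = k" "x = h + \<i> *\<^sub>C k"
proof
  let ?h = "(1/2) *\<^sub>C (x + star x)" and ?k = "(- \<i> / 2) *\<^sub>C (x - star x)"
  show "star ?h = ?h" by (simp add: star_scaleC star_add star_star add.commute)
  have "star ?k = (\<i> / 2) *\<^sub>C (star x - x)" by (simp add: star_scaleC star_diff star_star)
  also have "\<dots> = ?k" by (metis minus_diff_eq scaleC_minus_one scaleC_scaleC minus_divide_left mult_minus1_right)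
  finally show "star ?k = ?k" .
  have "\<i> *\<^sub>C ?k = (1/2) *\<^sub>C (x - star x)" by (simp add: scaleC_scaleC)
  then have "?h + \<i> *\<^sub>C ?k = (1/2) *\<^sub>C x + (1/2) *\<^sub>C x"
    by (simp add: scaleC_add_right scaleC_diff_right)
  also have "\<dots> = x" by (simp add: scaleC_add_left[symmetric] scaleC_one)
  finally show "x = ?h + \<i> *\<^sub>C ?k" by simp
qed

text \<open>The two products differ only in the sign of the commutator. Hence their sum is a sum of
  squares, and if \<open>h\<close> and \<open>k\<close> commute with
  \<open>h * h + k * k = 1\<close>, then \<open>star x * x = 1\<close>.\<close>

lemma star_mult_decomposition:
  fixes h k :: "'a::star_algebra"
  assumes "star h = h" "star k = k"
  defines "x \<equiv> h + \<i> *\<^sub>C k"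
  shows "star x * x = (h * h + k * k) + \<i> *\<^sub>C (h * k - k * h)"
    "x * star x = (h * h + k * k) - \<i> *\<^sub>C (h * k - k * h)"
proof -
  have i: "- \<i> *\<^sub>C z = - (\<i> *\<^sub>C z)" for z :: 'a
    by (metis minus_equation_iff scaleC_minus_one scaleC_scaleC mult_minus1)
  have ii: "\<i> *\<^sub>C \<i> *\<^sub>C z = - z" for z :: 'a by (simp add: scaleC_scaleC scaleC_minus_one)
  show "star x * x = (h * h + k * k) + \<i> *\<^sub>C (h * k - k * h)" "x * star x = (h * h + k * k) - \<i> *\<^sub>C (h * k - k * h)"
    by (simp_all add: x_def assms(1,2) star_add star_scaleC i ii algebra_simps mult_scaleC_left mult_scaleC_right
        scaleC_diff_right scaleC_add_right)
qed

section \<open>Positive elements of unital C*-algebras\<close>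

text \<open>Squares of self-adjoint elements rather than all \<open>star x * x\<close>: the latter
  lie in this cone by \<open>psd_star_mult\<close>, whose proof uses the functional calculus that is
  built on this cone.\<close>

definition psd :: "'a::unital_cstar_algebra \<Rightarrow> bool"
  where "psd a \<longleftrightarrow> (\<exists>h. star h = h \<and> h * h = a)"

lemma psd_self_adjoint: "psd a \<Longrightarrow> star a = a"
  by (auto simp: psd_def star_mult)

text \<open>A fixed point \<open>l\<close> of \<open>z \<mapsto> (s + z * z) / 2\<close> satisfies
  \<open>(1 - l) * (1 - l) = 1 - s\<close>. The iteration from \<open>0\<close> is dominated by the
  scalar iteration with \<open>1\<close> in place of \<open>s\<close>, which increases and stays
  below \<open>1\<close>; so it converges even for \<open>norm s = 1\<close>.\<close>

lemma sqrt_one_minus_exists: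
  fixes s :: "'a::unital_cstar_algebra"
  assumes s: "star s = s" "norm s \<le> 1"
  obtains g where "star g = g" "g * g = 1 - s" "\<And>x. x * s = s * x \<Longrightarrow> x * g = g * x"
proof -
  define y :: "nat \<Rightarrow> 'a" where "y = rec_nat 0 (\<lambda>_ z. (1/2) *\<^sub>R (s + z * z))"
  define t :: "nat \<Rightarrow> real" where "t = rec_nat 0 (\<lambda>_ z. (1 + z\<^sup>2) / 2)"
  have y0: "y 0 = 0" and yS: "\<And>n. y (Suc n) = (1/2) *\<^sub>R (s + y n * y n)" by (auto simp: y_def)
  have t0: "t 0 = 0" and tS: "\<And>n. t (Suc n) = (1 + (t n)\<^sup>2) / 2" by (auto simp: t_def)
  have t01: "0 \<le> t n \<and> t n \<le> 1" for n
    by (induction n) (auto simp: t0 tS power_le_one)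
  have yt: "norm (y n) \<le> t n" for n
  proof (induction n)
    case (Suc n)
    have "norm (s + y n * y n) \<le> 1 + t n * t n"
      by (rule order_trans[OF norm_triangle_ineq add_mono[OF s(2) order_trans[OF norm_mult_ineq]]])
        (use Suc t01 in \<open>auto intro!: mult_mono\<close>)
    then show ?case by (simp add: yS tS power2_eq_square)
  qed (simp add: y0 t0)
  have tdiff: "0 \<le> t (Suc n) - t n" for n
  proof -
    have "t (Suc n) - t n = (1 - t n)\<^sup>2 / 2" by (simp add: tS power2_eq_square field_simps)
    then show ?thesis by (metis zero_le_power2 zero_le_divide_iff zero_le_numeral)
  qed
  \<comment> \<open>The steps of \<open>y\<close> are bounded by those of \<open>t\<close>, whose
    sum telescopes. The difference of squares is written \<open>p * (p - q) + (p - q) * q\<close>,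
    which is valid without commutativity.\<close>
  have diff: "norm (y (Suc n) - y n) \<le> t (Suc n) - t n" for n
  proof (induction n)
    case 0
    show ?case using s by (simp add: y0 t0 yS tS)
  next
    case (Suc n)
    let ?d = "y (Suc n) - y n" and ?e = "t (Suc n) - t n"
    have "(1/2) *\<^sub>R (s + p * p) - (1/2) *\<^sub>R (s + q * q) = (1/2) *\<^sub>R (p * (p - q) + (p - q) * q)" for p q
      by (simp add: algebra_simps)
    from this[of "y (Suc n)" "y n", folded yS]
    have "y (Suc (Suc n)) - y (Suc n) = (1/2) *\<^sub>R (y (Suc n) * ?d + ?d * y n)" .
    then have "norm (y (Suc (Suc n)) - y (Suc n)) = norm (y (Suc n) * ?d + ?d * y n) / 2" by simp
    also have "norm (y (Suc n) * ?d + ?d * y n) \<le> t (Suc n) * ?e + ?e * t n"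
      by (intro order_trans[OF norm_triangle_ineq] add_mono order_trans[OF norm_mult_ineq] mult_mono Suc yt
          norm_ge_zero tdiff conjunct1[OF t01])
    also have "t (Suc n) * ?e + ?e * t n = (t (Suc n))\<^sup>2 - (t n)\<^sup>2" by (simp add: power2_eq_square algebra_simps)
    also have "\<dots> / 2 = t (Suc (Suc n)) - t (Suc n)" by (simp add: tS[of "Suc n"] tS[of n] field_simps)
    finally show ?case by simp
  qed
  have "summable (\<lambda>n. t (Suc n) - t n)"
    using bounded_imp_summable[OF tdiff, where B=1] sum_lessThan_telescope[of t "Suc _"] t01
    by (auto simp: t0 lessThan_Suc_atMost)
  then have "summable (\<lambda>n. y (Suc n) - y n)"
    by (rule summable_comparison_test'[where N=0]) (use diff in auto)
  then have "(\<lambda>n. \<Sum>i<n. y (Suc i) - y i) \<longlonglongrightarrow> (\<Sum>n. y (Suc n) - y n)" by (rule summable_LIMSEQ)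
  then obtain l where l: "y \<longlonglongrightarrow> l" by (auto simp: sum_lessThan_telescope y0)
  have "(\<lambda>n. y (Suc n)) \<longlonglongrightarrow> (1/2) *\<^sub>R (s + l * l)" unfolding yS by (intro tendsto_intros l)
  with LIMSEQ_Suc[OF l] have eq: "l = (1/2) *\<^sub>R (s + l * l)" by (rule LIMSEQ_unique)
  have ys: "star (y n) = y n" for n
    by (induction n) (auto simp: y0 yS star_zero star_scaleR star_add star_mult s)
  have ls: "star l = l"
    by (rule LIMSEQ_unique[OF tendsto_star[OF l]]) (simp add: ys l)
  have "2 *\<^sub>R l = s + l * l" using arg_cong[OF eq, of "\<lambda>z. 2 *\<^sub>R z"] by simp
  then have sq: "(1 - l) * (1 - l) = 1 - s" by (simp add: algebra_simps scaleR_2)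
  have comm: "x * (1 - l) = (1 - l) * x" if x: "x * s = s * x" for x
  proof -
    have c: "x * y n = y n * x" for n
    proof (induction n)
      case (Suc n)
      then show ?case unfolding yS
        by (simp add: algebra_simps x) (metis mult.assoc)
    qed (simp add: y0)
    have "(\<lambda>n. x * y n) \<longlonglongrightarrow> x * l" "(\<lambda>n. y n * x) \<longlonglongrightarrow> l * x" by (intro tendsto_intros l)+
    then have "x * l = l * x" unfolding c by (rule LIMSEQ_unique)
    then show ?thesis by (simp add: algebra_simps)
  qed
  have "star (1 - l) = 1 - l" by (simp add: ls star_diff star_one)
  from that[OF this sq comm] show thesis .
qed

text \<open>The element \<open>u = h + i k\<close> satisfies \<open>star u * u = 1\<close>, so it
  has norm \<open>1\<close>, and \<open>h\<close> is its real part.\<close>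

lemma norm_le_one_if_unitary:
  fixes h k :: "'a::unital_cstar_algebra"
  assumes hk: "star h = h" "star k = k" "h * k = k * h" "h * h + k * k = 1"
  shows "norm h \<le> 1"
proof -
  define u where "u = h + \<i> *\<^sub>C k"
  have "star u * u = 1" using star_mult_decomposition(1)[OF hk(1,2)] hk by (simp add: u_def scaleC_zero_right)
  then have u: "norm u = 1" using cstar_identity[of u] norm_ge_zero[of u] by (simp add: power2_eq_1_iff)
  have "u + star u = 2 *\<^sub>R h"
    by (simp add: u_def star_add star_scaleC hk scaleR_2 algebra_simps flip: scaleC_add_left) (simp add: scaleC_zero_left)
  then have "2 * norm h = norm (u + star u)" by simp
  also have "\<dots> \<le> norm u + norm (star u)" by (rule norm_triangle_ineq)
  finally show ?thesis by (simp add: u norm_star)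
qed

lemma psd_sqrt_of_norm_le:
  fixes a :: "'a::unital_cstar_algebra"
  assumes a: "star a = a" and r: "0 < r" "norm (r *\<^sub>R 1 - a) \<le> r"
  obtains g where "star g = g" "g * g = a" "\<And>x. x * a = a * x \<Longrightarrow> x * g = g * x"
proof -
  define s where "s = 1 - (1/r) *\<^sub>R a"
  have "s = (1/r) *\<^sub>R (r *\<^sub>R 1 - a)" using r by (simp add: s_def algebra_simps)
  then have s1: "norm s \<le> 1" using r by simp
  have ss: "star s = s" by (simp add: s_def star_diff star_one star_scaleR[of "1/r" a] a del: scaleR_conv_of_real)
  obtain g where g: "star g = g" "g * g = 1 - s" "\<And>x. x * s = s * x \<Longrightarrow> x * g = g * x"
    by (rule sqrt_one_minus_exists[OF ss s1]) blast
  show thesis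
  proof (rule that[of "sqrt r *\<^sub>R g"])
    show "star (sqrt r *\<^sub>R g) = sqrt r *\<^sub>R g" by (simp add: star_scaleR g)
    show "sqrt r *\<^sub>R g * sqrt r *\<^sub>R g = a" using r by (simp add: g s_def)
    show "x * sqrt r *\<^sub>R g = sqrt r *\<^sub>R g * x" if "x * a = a * x" for x
      using g(3)[of x] that by (simp add: s_def algebra_simps)
  qed
qed

text \<open>With \<open>h * h = a / r\<close> and \<open>g\<close> the square root of
  \<open>1 - h * h\<close>, the commuting pair \<open>g\<close>, \<open>h\<close> gives
  \<open>norm g \<le> 1\<close>; and \<open>r *\<^sub>R 1 - a\<close> is
  \<open>r *\<^sub>R (g * g)\<close>.\<close>

lemma norm_le_of_psd:
  assumes "psd a" "norm a \<le> r" "0 < r"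
  shows "norm (r *\<^sub>R 1 - a) \<le> r"
proof -
  obtain h' where h': "star h' = h'" "h' * h' = a" using assms by (auto simp: psd_def)
  define h where "h = (1 / sqrt r) *\<^sub>R h'"
  have h: "star h = h" "h * h = (1/r) *\<^sub>R a" using assms h' by (simp_all add: h_def star_scaleR)
  have s1: "norm (h * h) \<le> 1" using assms by (simp add: h)
  have ss: "star (h * h) = h * h" by (simp only: star_mult h(1))
  obtain g where g: "star g = g" "g * g = 1 - h * h" "\<And>x. x * (h * h) = h * h * x \<Longrightarrow> x * g = g * x"
    by (rule sqrt_one_minus_exists[OF ss s1]) blast
  have "h * g = g * h" by (rule g(3)) (simp only: mult.assoc)
  then have "norm g \<le> 1" using norm_le_one_if_unitary[of g h] by (simp add: g(1,2) h(1))
  then have "norm (g * g) \<le> 1" unfolding norm_square_self_adjoint[OF g(1)] by (simp add: power_le_one)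
  moreover have "r *\<^sub>R 1 - a = r *\<^sub>R (g * g)" using assms by (simp add: g h algebra_simps)
  ultimately show ?thesis using assms by simp
qed

text \<open>This replaces the spectrum: positivity becomes a norm inequality, from which closure
  under sums follows by the triangle inequality and closure under limits by continuity.\<close>

lemma psd_iff_norm_le:
  assumes "norm a \<le> r" "0 < r"
  shows "psd a \<longleftrightarrow> star a = a \<and> norm (r *\<^sub>R 1 - a) \<le> r"
proof
  assume "star a = a \<and> norm (r *\<^sub>R 1 - a) \<le> r"
  then obtain g where "star g = g" "g * g = a" using psd_sqrt_of_norm_le[OF _ assms(2)] by metis
  then show "psd a" unfolding psd_def by blast
qed (use assms psd_self_adjoint norm_le_of_psd in blast)

lemma psd_sqrt_commuting:
  assumes "psd a"
  obtains g where "star g = g" "g * g = a" "\<And>x. x * a = a * x \<Longrightarrow> x * g = g * x"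
proof -
  have r: "0 < norm a + 1" "norm a \<le> norm a + 1" by (auto simp: add_nonneg_pos)
  show thesis
    by (rule psd_sqrt_of_norm_le[OF psd_self_adjoint[OF assms] r(1) norm_le_of_psd[OF assms r(2,1)]]) (rule that)
qed

lemma psd_square: "star h = h \<Longrightarrow> psd (h * h)" unfolding psd_def by blast

lemma psd_zero: "psd 0" using psd_square[of 0] by (simp add: star_zero)

lemma psd_one: "psd 1" using psd_square[of 1] by (simp add: star_one)

lemma psd_scaleR: "psd a \<Longrightarrow> 0 \<le> r \<Longrightarrow> psd (r *\<^sub>R a)"
proof -
  assume "psd a" "0 \<le> r"
  then obtain h where "star h = h" "h * h = a" by (auto simp: psd_def)
  then show ?thesis using psd_square[of "sqrt r *\<^sub>R h"] \<open>0 \<le> r\<close> by (simp add: star_scaleR)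
qed

lemma psd_add: 
  assumes "psd a" "psd b"
  shows "psd (a + b)"
proof -
  define r where "r = norm a + 1"
  define s where "s = norm b + 1"
  have rs: "0 < r" "0 < s" "norm a \<le> r" "norm b \<le> s" by (auto simp: r_def s_def add_nonneg_pos)
  have "norm ((r *\<^sub>R 1 - a) + (s *\<^sub>R 1 - b)) \<le> r + s"
    by (rule order_trans[OF norm_triangle_ineq]) (use norm_le_of_psd assms rs in \<open>auto intro!: add_mono\<close>)
  then have "norm ((r + s) *\<^sub>R 1 - (a + b)) \<le> r + s" by (simp add: algebra_simps)
  moreover have "norm (a + b) \<le> r + s" by (rule order_trans[OF norm_triangle_ineq]) (use rs in auto)
  ultimately show ?thesis using psd_iff_norm_le[of "a + b" "r + s"] rs by (simp add: star_add psd_self_adjoint[OF assms(1)] psd_self_adjoint[OF assms(2)])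
qed

lemma psd_sum: "(\<And>i. i \<in> I \<Longrightarrow> psd (f i)) \<Longrightarrow> psd (sum f I)"
  by (induction I rule: infinite_finite_induct) (auto simp: psd_zero psd_add)

lemma psd_diff_of_norm_le:
  fixes s :: "'a::unital_cstar_algebra"
  assumes "star s = s" "norm s \<le> r"
  shows "psd (r *\<^sub>R 1 - s)"
proof (cases "r = 0")
  case False
  with assms have r: "0 < r" using norm_ge_zero[of s] by linarith
  have "norm ((2 * r) *\<^sub>R 1 - (r *\<^sub>R 1 - s)) \<le> 2 * r"
  proof -
    have "(2 * r) *\<^sub>R (1::'a) = r *\<^sub>R 1 + r *\<^sub>R 1" by (metis mult_2 scaleR_add_left)
    then have e: "(2 * r) *\<^sub>R 1 - (r *\<^sub>R 1 - s) = r *\<^sub>R 1 + s" by (simp only: diff_diff_eq2 add_diff_cancel_left' add.assoc)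
    show ?thesis unfolding e using norm_triangle_ineq[of "r *\<^sub>R 1" s] assms r by simp
  qed
  moreover have "norm (r *\<^sub>R 1 - s) \<le> 2 * r"
    using norm_triangle_ineq4[of "r *\<^sub>R 1" s] assms r by simp
  ultimately show ?thesis
    using psd_iff_norm_le[of "r *\<^sub>R 1 - s" "2 * r"] r assms by (simp add: star_diff star_scaleR star_one)
qed (use assms psd_zero in simp)

lemma psd_limit:
  assumes "\<And>n. psd (X n)" "X \<longlonglongrightarrow> l"
  shows "psd l"
proof -
  have "Bseq X" using assms(2) convergent_def convergent_imp_Bseq by blast
  then obtain r where r: "0 < r" "\<And>n. norm (X n) \<le> r" by (auto simp: Bseq_def)
  have "norm l \<le> r" using LIMSEQ_le_const2[OF tendsto_norm[OF assms(2)]] r by blast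
  moreover have "norm (r *\<^sub>R 1 - l) \<le> r"
  proof (rule LIMSEQ_le_const2)
    show "(\<lambda>n. norm (r *\<^sub>R 1 - X n)) \<longlonglongrightarrow> norm (r *\<^sub>R 1 - l)" by (intro tendsto_intros assms)
  qed (use norm_le_of_psd assms(1) r in blast)
  moreover have "star l = l"
    by (rule LIMSEQ_unique[OF tendsto_star[OF assms(2)]]) (simp add: psd_self_adjoint assms)
  ultimately show ?thesis using psd_iff_norm_le r by blast
qed

lemma psd_mult_commuting:
  assumes "psd a" "psd b" "a * b = b * a"
  shows "psd (a * b)"
proof -
  obtain h where h: "star h = h" "h * h = a" "\<And>x. x * a = a * x \<Longrightarrow> x * h = h * x"
    by (rule psd_sqrt_commuting[OF assms(1)]) blast
  obtain k where k: "star k = k" "k * k = b" "\<And>x. x * b = b * x \<Longrightarrow> x * k = k * x"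
    by (rule psd_sqrt_commuting[OF assms(2)]) blast
  have hk: "h * k = k * h" using h(3)[of b] k(3)[of h] assms(3) by simp
  have "(h * k) * (h * k) = a * b" by (metis h(2) k(2) hk mult.assoc)
  moreover have "star (h * k) = h * k" by (simp add: star_mult h k hk)
  ultimately show ?thesis using psd_square by metis
qed

lemma psd_power: "psd a \<Longrightarrow> psd (a ^ n)"
  by (induction n) (auto simp: psd_one intro!: psd_mult_commuting power_commutes[symmetric])

text \<open>Commuting square roots of \<open>a\<close> and \<open>r *\<^sub>R 1 - a\<close>, divided
  by \<open>sqrt r\<close>, form the pair required by \<open>norm_le_one_if_unitary\<close>.\<close>

lemma norm_le_if_psd_diff:
  assumes "psd a" "psd (r *\<^sub>R 1 - a)" "0 \<le> r"
  shows "norm a \<le> r"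
proof -
  have pos: "norm a \<le> r" if ra: "psd (r *\<^sub>R 1 - a)" and r: "0 < r" for r
  proof -
    obtain h where h: "star h = h" "h * h = a" "\<And>x. x * a = a * x \<Longrightarrow> x * h = h * x"
      by (rule psd_sqrt_commuting[OF assms(1)]) blast
    obtain k where k: "star k = k" "k * k = r *\<^sub>R 1 - a" "\<And>x. x * (r *\<^sub>R 1 - a) = (r *\<^sub>R 1 - a) * x \<Longrightarrow> x * k = k * x"
      by (rule psd_sqrt_commuting[OF ra]) blast
    have "h * a = a * h" by (metis h(2) mult.assoc)
    then have hk: "h * k = k * h" using k(3)[of h] by (simp add: algebra_simps)
    define c where "c = 1 / sqrt r"
    have c: "c * c * r = 1" using r by (simp add: c_def)
    have "norm (c *\<^sub>R h) \<le> 1"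
    proof (rule norm_le_one_if_unitary[of _ "c *\<^sub>R k"])
      have "c *\<^sub>R h * c *\<^sub>R h + c *\<^sub>R k * c *\<^sub>R k = (c * c * r) *\<^sub>R 1"
        by (simp add: h k algebra_simps)
      then show "c *\<^sub>R h * c *\<^sub>R h + c *\<^sub>R k * c *\<^sub>R k = 1" by (simp add: c)
    qed (simp_all add: star_scaleR h k hk)
    then have "norm h \<le> sqrt r" using r by (simp add: c_def field_simps)
    then have "(norm h)\<^sup>2 \<le> r" using r power_mono[of "norm h" "sqrt r" 2] by simp
    then show ?thesis using norm_square_self_adjoint[OF h(1)] h(2) by simp
  qed
  \<comment> \<open>The division by \<open>sqrt r\<close> excludes \<open>r = 0\<close>, which is
    reached by enlarging \<open>r\<close> to \<open>r + e\<close>. That case is what makes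
    \<open>psd_antisym\<close> work.\<close>
  show ?thesis
  proof (rule field_le_epsilon)
    fix e :: real assume "0 < e"
    have "psd ((r *\<^sub>R 1 - a) + e *\<^sub>R 1)" using \<open>0 < e\<close> assms by (intro psd_add psd_scaleR psd_one) auto
    then show "norm a \<le> r + e" using \<open>0 < e\<close> assms by (intro pos) (auto simp: algebra_simps)
  qed
qed

lemma psd_antisym: "psd a \<Longrightarrow> psd (- a) \<Longrightarrow> a = 0"
  using norm_le_if_psd_diff[of a 0] by simp

text \<open>The commuting product of \<open>r - x\<close> and \<open>r + x\<close> is
  \<open>r\<^sup>2 - x * x\<close>, which reduces the self-adjoint case to the positive element
  \<open>x * x\<close>.\<close>

lemma norm_le_if_psd_diff_add:
  assumes "psd (r *\<^sub>R 1 - x)" "psd (r *\<^sub>R 1 + x)" "0 \<le> r"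
  shows "norm x \<le> r"
proof -
  have x: "star x = x" using psd_self_adjoint[OF assms(1)] by (simp add: star_diff star_scaleR star_one)
  have "psd ((r *\<^sub>R 1 - x) * (r *\<^sub>R 1 + x))"
    by (rule psd_mult_commuting[OF assms(1,2)]) (simp add: algebra_simps)
  then have "psd (r\<^sup>2 *\<^sub>R 1 - x * x)" by (simp add: algebra_simps power2_eq_square)
  then have "norm (x * x) \<le> r\<^sup>2" by (intro norm_le_if_psd_diff psd_square x) auto
  then have "(norm x)\<^sup>2 \<le> r\<^sup>2" by (simp only: norm_square_self_adjoint[OF x])
  then show ?thesis by (rule power2_le_imp_le[OF _ assms(3)])
qed

section \<open>Polynomial functional calculus\<close>

definition pev :: "real poly \<Rightarrow> 'a::real_normed_algebra_1 \<Rightarrow> 'a"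
  where "pev p a = fold_coeffs (\<lambda>c x. c *\<^sub>R 1 + a * x) p 0"

lemma pev_0 [simp]: "pev 0 a = 0"
  by (simp add: pev_def)

lemma pev_pCons [simp]: "pev (pCons c p) a = c *\<^sub>R 1 + a * pev p a"
  by (cases "p = 0 \<and> c = 0") (auto simp: pev_def)

lemma pev_1 [simp]: "pev 1 a = 1"
  by (simp add: one_pCons)

lemma pev_add: "pev (p + q) a = pev p a + pev q a"
  by (induction p q rule: poly_induct2) (simp_all add: algebra_simps)

lemma pev_smult: "pev (smult c p) a = c *\<^sub>R pev p a"
  by (induction p) (simp_all add: algebra_simps)

lemma pev_diff: "pev (p - q) a = pev p a - pev q a"
  using pev_add[of p "- q" a] pev_smult[of "-1" q a] by simp

lemma pev_mult: "pev (p * q) a = pev p a * pev q a"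
  by (induction p) (simp_all add: pev_add pev_smult algebra_simps)

lemma pev_power: "pev (p ^ n) a = pev p a ^ n"
  by (induction n) (simp_all add: pev_mult)

lemma pev_sum: "pev (sum f I) a = (\<Sum>i\<in>I. pev (f i) a)"
  by (induction I rule: infinite_finite_induct) (simp_all add: pev_add)

lemma pev_commute:
  assumes "x * a = a * x"
  shows "x * pev p a = pev p a * x"
proof (induction p)
  case (pCons c p)
  have "x * (a * pev p a) = a * (x * pev p a)" by (simp only: mult.assoc[symmetric] assms)
  also have "\<dots> = a * (pev p a * x)" by (simp only: pCons.IH)
  finally show ?case by (simp add: algebra_simps)
qed simp

lemma star_pev: 
  fixes a :: "'a::unital_cstar_algebra"
  assumes "star a = a"
  shows "star (pev p a) = pev p a"
proof (induction p)
  case (pCons c p)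
  then show ?case by (simp add: star_add star_scaleR star_one star_mult assms pev_commute[of a a])
qed (simp add: star_zero)

lemma pev_pcompose_scale: "pev (pcompose p [:0, r:]) a = pev p (r *\<^sub>R a)"
  by (induction p) (simp_all add: pcompose_pCons pev_add pev_smult)

lemma pev_compat_orthogonal: "a * b = 0 \<Longrightarrow> a * pev p b = poly p 0 *\<^sub>R a"
  by (cases p) (simp add: algebra_simps mult.assoc[symmetric])

text \<open>All mixed products vanish; the correction removes the constant coefficient, which both
  summands contribute.\<close>

lemma pev_add_orthogonal:
  assumes "a * b = 0" "b * a = 0"
  shows "pev p (a + b) = pev p a + pev p b - poly p 0 *\<^sub>R 1"
proof (induction p)
  case (pCons c p)
  have "(a + b) * pev p (a + b) = a * pev p a + b * pev p b"
    by (simp add: pCons.IH algebra_simps pev_compat_orthogonal assms)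
  then show ?case by (simp add: algebra_simps)
qed simp

section \<open>Bernstein polynomials and the norm bound for polynomials\<close>

lemma smult_sum_right: "smult c (sum f I) = (\<Sum>i\<in>I. smult c (f i))"
  by (induction I rule: infinite_finite_induct) (simp_all add: smult_add_right)

definition bernstein_poly :: "nat \<Rightarrow> nat \<Rightarrow> real poly"
  where "bernstein_poly n k = smult (real (n choose k)) ([:0, 1:] ^ k * [:1, - 1:] ^ (n - k))"

lemma sum_bernstein_poly: "(\<Sum>k\<le>n. bernstein_poly n k) = 1"
proof -
  have one: "[:0, 1:] + [:1, - 1 :: real:] = 1" by (simp add: one_pCons)
  have "(\<Sum>k\<le>n. bernstein_poly n k) = ([:0, 1:] + [:1, - 1 :: real:]) ^ n"
    unfolding binomial_ring bernstein_poly_def by (simp add: of_nat_poly algebra_simps)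
  then show ?thesis unfolding one by simp
qed

text \<open>Multiplication by the variable raises degree and index together. This is the recursion
  step for \<open>pCons c p = c + X p\<close> in \<open>bernstein_expansion\<close>.\<close>

lemma X_mult_bernstein_poly:
  "[:0, 1:] * bernstein_poly n k = smult ((real k + 1) / (real n + 1)) (bernstein_poly (Suc n) (Suc k))"
proof -
  have "(real n + 1) * real (n choose k) = (real k + 1) * real (Suc n choose Suc k)"
    using Suc_times_binomial_eq[of n k] by (metis mult.commute of_nat_Suc of_nat_mult add.commute)
  then have "real (n choose k) = (real k + 1) / (real n + 1) * real (Suc n choose Suc k)"
    by (simp add: field_simps)
  then show ?thesis by (simp add: bernstein_poly_def mult_smult_right mult.assoc del: mult_pCons_left binomial_Suc_Suc)
qed

text \<open>The Bernstein coefficients of a polynomial are close to its values at the nodes; unlike the convergence of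
  Bernstein operators this is an identity of polynomials, so that it can be evaluated in an algebra.\<close>

lemma bernstein_expansion:
  fixes p :: "real poly"
  assumes "0 < e"
  shows "\<forall>\<^sub>F n in sequentially. \<exists>b. p = (\<Sum>k\<le>n. smult (b k) (bernstein_poly n k)) \<and>
    (\<forall>k\<le>n. \<bar>b k - poly p (real k / real n)\<bar> \<le> e)"
  using assms
proof (induction p arbitrary: e)
  case 0
  then show ?case by (intro always_eventually allI exI[of _ "\<lambda>_. 0"]) auto
next
  case (pCons c p)
  have e2: "0 < e / 2" using pCons.prems by simp
  have "uniformly_continuous_on {0..1} (poly p)"
    by (intro compact_uniformly_continuous continuous_intros) auto
  then obtain d where d: "0 < d" "\<And>x y. x \<in> {0..1} \<Longrightarrow> y \<in> {0..1} \<Longrightarrow> dist x y < d \<Longrightarrow> dist (poly p x) (poly p y) < e / 2"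
    unfolding uniformly_continuous_on_def using e2 by metis
  have "\<forall>\<^sub>F n in sequentially. 1 / d < real n"
    using filterlim_real_sequentially by (simp add: filterlim_at_top_dense)
  from this pCons.IH[OF e2]
  have "\<forall>\<^sub>F n in sequentially. \<exists>b. pCons c p = (\<Sum>k\<le>Suc n. smult (b k) (bernstein_poly (Suc n) k)) \<and>
    (\<forall>k\<le>Suc n. \<bar>b k - poly (pCons c p) (real k / real (Suc n))\<bar> \<le> e)"
  proof eventually_elim
    case (elim n)
    then obtain b where b: "p = (\<Sum>k\<le>n. smult (b k) (bernstein_poly n k))"
      "\<And>k. k \<le> n \<Longrightarrow> \<bar>b k - poly p (real k / real n)\<bar> \<le> e / 2" by blast
    have n: "0 < real n" using elim(1) d(1) less_trans[of 0 "1 / d" "real n"] by simp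
    \<comment> \<open>The basis sums to \<open>1\<close>, so the constant adds \<open>c\<close> to
      every coefficient. Multiplication by the variable shifts the coefficients of \<open>p\<close>
      by one and scales them by the new node \<open>(j + 1) / (n + 1)\<close>.\<close>
    define b' where "b' k = (case k of 0 \<Rightarrow> c | Suc j \<Rightarrow> c + b j * ((real j + 1) / (real n + 1)))" for k
    have "[:c:] = smult c (\<Sum>k\<le>Suc n. bernstein_poly (Suc n) k)"
      unfolding sum_bernstein_poly by simp
    also have "\<dots> = smult c (bernstein_poly (Suc n) 0) + (\<Sum>k\<le>n. smult c (bernstein_poly (Suc n) (Suc k)))"
      by (simp only: sum.atMost_Suc_shift smult_add_right smult_sum_right)
    finally have c: "[:c:] = \<dots>" .
    have "[:0, 1:] * p = (\<Sum>k\<le>n. smult (b k) ([:0, 1:] * bernstein_poly n k))"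
      by (subst b(1)) (simp only: sum_distrib_left mult_smult_right)
    also have "\<dots> = (\<Sum>k\<le>n. smult (b k * ((real k + 1) / (real n + 1))) (bernstein_poly (Suc n) (Suc k)))"
      by (simp only: X_mult_bernstein_poly smult_smult)
    finally have "[:c:] + [:0, 1:] * p = smult (b' 0) (bernstein_poly (Suc n) 0) + (\<Sum>k\<le>n. smult (b' (Suc k)) (bernstein_poly (Suc n) (Suc k)))"
      by (simp add: c b'_def smult_add_left sum.distrib del: mult_pCons_left)
    then have "pCons c p = (\<Sum>k\<le>Suc n. smult (b' k) (bernstein_poly (Suc n) k))"
      by (simp add: sum.atMost_Suc_shift del: sum.atMost_Suc)
    moreover have "\<bar>b' k - poly (pCons c p) (real k / real (Suc n))\<bar> \<le> e" if k: "k \<le> Suc n" for k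
    proof (cases k)
      case (Suc j)
      define x where "x = (real j + 1) / (real n + 1)"
      have j: "j \<le> n" using k Suc by simp
      have x: "0 \<le> x" "x \<le> 1" using j by (auto simp: x_def)
      \<comment> \<open>The new node is at distance at most \<open>1 / n\<close> from the old one,
        so uniform continuity of \<open>p\<close> accounts for the other half of
        \<open>e\<close>.\<close>
      have "x - real j / real n = (real n - real j) / (real n * (real n + 1))"
        using n by (simp add: x_def field_simps)
      also have "\<bar>\<dots>\<bar> \<le> (real n + 1) / (real n * (real n + 1))"
        using j n by (subst abs_of_nonneg) (simp, intro divide_right_mono, simp_all)
      also have "\<dots> = 1 / real n" using n by (simp add: add_nonneg_pos less_imp_neq[symmetric])
      also have "\<dots> < d" using elim(1) d(1) n by (simp add: field_simps)
      finally have "dist x (real j / real n) < d" by (simp add: dist_real_def)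
      then have "dist (poly p x) (poly p (real j / real n)) < e / 2" using x j n by (intro d) auto
      with b(2)[OF j] have "\<bar>b j - poly p x\<bar> \<le> e" unfolding dist_real_def by linarith
      then have "\<bar>b j - poly p x\<bar> * x \<le> e * 1" using x by (intro mult_mono) auto
      moreover have "real k / real (Suc n) = x" by (simp add: x_def Suc add.commute)
      then have "b' k - poly (pCons c p) (real k / real (Suc n)) = (b j - poly p x) * x"
        by (simp add: b'_def Suc x_def[symmetric] algebra_simps)
      ultimately show ?thesis using x by (simp add: abs_mult)
    qed (use pCons.prems in \<open>simp add: b'_def\<close>)
    ultimately show ?case by blast
  qed
  then show ?case by (subst eventually_sequentially_Suc[symmetric])
qed

lemma psd_pev_bernstein_poly:
  assumes "psd a" "psd (1 - a)"
  shows "psd (pev (bernstein_poly n k) a)"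
proof -
  have "psd (a ^ k * (1 - a) ^ (n - k))"
  proof (intro psd_mult_commuting psd_power assms)
    have "pev ([:0, 1:] ^ k * [:1, - 1:] ^ (n - k)) a = pev ([:1, - 1:] ^ (n - k) * [:0, 1:] ^ k) a"
      by (simp only: mult.commute)
    then show "a ^ k * (1 - a) ^ (n - k) = (1 - a) ^ (n - k) * a ^ k" by (simp add: pev_mult pev_power)
  qed
  then show ?thesis by (simp add: bernstein_poly_def pev_smult pev_mult pev_power psd_scaleR)
qed

text \<open>The basis polynomials evaluate to positive elements with sum \<open>1\<close>, so
  coefficients of modulus at most \<open>M + e\<close> place both signs of \<open>pev p a\<close>
  below \<open>(M + e) *\<^sub>R 1\<close>.\<close>

lemma norm_pev_le_unit:
  assumes a: "psd a" "psd (1 - a)" and M: "\<And>t. 0 \<le> t \<Longrightarrow> t \<le> 1 \<Longrightarrow> \<bar>poly p t\<bar> \<le> M"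
  shows "norm (pev p a) \<le> M"
proof (rule field_le_epsilon)
  fix e :: real assume e: "0 < e"
  obtain n b where b: "p = (\<Sum>k\<le>n. smult (b k) (bernstein_poly n k))"
      "\<And>k. k \<le> n \<Longrightarrow> \<bar>b k - poly p (real k / real n)\<bar> \<le> e"
    using bernstein_expansion[OF e, of p] unfolding eventually_sequentially by blast
  have bM: "\<bar>b k\<bar> \<le> M + e" if "k \<le> n" for k
  proof -
    have "real k / real n \<le> 1" using that by (cases "n = 0") auto
    with M[of "real k / real n"] b(2)[OF that] show ?thesis by simp
  qed
  have p: "pev p a = (\<Sum>k\<le>n. b k *\<^sub>R pev (bernstein_poly n k) a)"
    by (subst b(1)) (simp add: pev_sum pev_smult)
  have one: "(M + e) *\<^sub>R 1 = (\<Sum>k\<le>n. (M + e) *\<^sub>R pev (bernstein_poly n k) a)"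
    unfolding scaleR_sum_right[symmetric] pev_sum[symmetric] sum_bernstein_poly by simp
  have "psd ((M + e) *\<^sub>R 1 - pev p a)"
    unfolding one p sum_subtractf[symmetric] scaleR_diff_left[symmetric]
    by (intro psd_sum psd_scaleR psd_pev_bernstein_poly a) (use bM in \<open>auto simp: abs_le_iff\<close>)
  moreover have "psd ((M + e) *\<^sub>R 1 + pev p a)"
    unfolding one p sum.distrib[symmetric] scaleR_add_left[symmetric]
    by (intro psd_sum psd_scaleR psd_pev_bernstein_poly a) (use bM in \<open>force simp: abs_le_iff\<close>)
  moreover have "0 \<le> M + e" using M[of 0] e by simp
  ultimately show "norm (pev p a) \<le> M + e" by (rule norm_le_if_psd_diff_add)
qed

lemma norm_pev_le:
  assumes a: "psd a" "norm a \<le> r" "0 < r" and M: "\<And>t. 0 \<le> t \<Longrightarrow> t \<le> r \<Longrightarrow> \<bar>poly p t\<bar> \<le> M"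
  shows "norm (pev p a) \<le> M"
proof -
  have "psd ((1/r) *\<^sub>R (r *\<^sub>R 1 - a))"
    using a psd_self_adjoint by (intro psd_scaleR psd_diff_of_norm_le) auto
  moreover have "(1/r) *\<^sub>R (r *\<^sub>R 1 - a) = 1 - (1/r) *\<^sub>R a" using a(3) by (simp add: algebra_simps)
  ultimately have "norm (pev (pcompose p [:0, r:]) ((1/r) *\<^sub>R a)) \<le> M"
    using a by (intro norm_pev_le_unit psd_scaleR) (auto simp: poly_pcompose intro!: M mult_left_le)
  then show ?thesis using a(3) by (simp add: pev_pcompose_scale)
qed

section \<open>Continuous functional calculus of positive elements\<close>

text \<open>The interval grows with \<open>n\<close>, so that one sequence converges uniformly on
  every \<open>{0..r}\<close> and \<open>cfc\<close> needs no bound on its argument. The choice sees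
  only the values of \<open>f\<close> on nonnegative reals, whence \<open>cfc_cong\<close>.\<close>

definition poly_approx :: "(real \<Rightarrow> real) \<Rightarrow> nat \<Rightarrow> real poly"
  where "poly_approx f n = (SOME p. \<forall>t\<in>{0..real n + 1}. \<bar>poly p t - f t\<bar> \<le> 1 / (real n + 1))"

lemma poly_approx:
  assumes "continuous_on {0..} f" "0 \<le> t" "t \<le> real n + 1"
  shows "\<bar>poly (poly_approx f n) t - f t\<bar> \<le> 1 / (real n + 1)"
proof -
  have "continuous_on {0..real n + 1} f" by (rule continuous_on_subset[OF assms(1)]) auto
  then obtain g where g: "real_polynomial_function g" "\<And>t. t \<in> {0..real n + 1} \<Longrightarrow> \<bar>f t - g t\<bar> < 1 / (real n + 1)"
    using Stone_Weierstrass_real_polynomial_function[of "{0..real n + 1}" f "1 / (real n + 1)"] by auto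
  obtain c m where c: "g = (\<lambda>x. \<Sum>i\<le>m. c i * x ^ i)"
    using g(1) unfolding real_polynomial_function_iff_sum by blast
  have "poly (\<Sum>i\<le>m. monom (c i) i) x = g x" for x by (simp add: c poly_sum poly_monom)
  then have "\<forall>t\<in>{0..real n + 1}. \<bar>poly (\<Sum>i\<le>m. monom (c i) i) t - f t\<bar> \<le> 1 / (real n + 1)"
    using g(2) by (simp add: abs_minus_commute less_imp_le)
  from someI[of "\<lambda>p. \<forall>t\<in>{0..real n + 1}. \<bar>poly p t - f t\<bar> \<le> 1 / (real n + 1)", OF this] assms(2,3)
  show ?thesis by (simp add: poly_approx_def)
qed

definition cfc :: "(real \<Rightarrow> real) \<Rightarrow> 'a::unital_cstar_algebra \<Rightarrow> 'a"
  where "cfc f a = lim (\<lambda>n. pev (poly_approx f n) a)"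

lemma cfc_tendsto:
  assumes a: "psd a" and f: "continuous_on {0..} f"
  shows "(\<lambda>n. pev (poly_approx f n) a) \<longlonglongrightarrow> cfc f a"
proof -
  have "Cauchy (\<lambda>n. pev (poly_approx f n) a)"
  proof (rule metric_CauchyI)
    fix e :: real assume e: "0 < e"
    obtain N :: nat where N: "norm a < real N" "2 / e < real N"
      using reals_Archimedean2[of "max (norm a) (2 / e)"] by auto
    have N0: "0 < real N" using N(1) norm_ge_zero[of a] by linarith
    have "dist (pev (poly_approx f m) a) (pev (poly_approx f n) a) < e" if mn: "N \<le> m" "N \<le> n" for m n
    proof -
      have "norm (pev (poly_approx f m - poly_approx f n) a) \<le> 2 / (real N + 1)"
      proof (rule norm_pev_le[OF a less_imp_le[OF N(1)] N0])
        fix t assume t: "0 \<le> t" "t \<le> real N"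
        have "\<bar>poly (poly_approx f i) t - f t\<bar> \<le> 1 / (real N + 1)" if "N \<le> i" for i
          by (rule order_trans[OF poly_approx[OF f]]) (use t that in \<open>auto intro!: divide_left_mono\<close>)
        from this[OF mn(1)] this[OF mn(2)]
        show "\<bar>poly (poly_approx f m - poly_approx f n) t\<bar> \<le> 2 / (real N + 1)" by (simp add: abs_le_iff)
      qed
      also have "\<dots> < e" using N(2) e N0 by (simp add: field_simps)
      finally show ?thesis by (simp add: dist_norm pev_diff)
    qed
    then show "\<exists>M. \<forall>m\<ge>M. \<forall>n\<ge>M. dist (pev (poly_approx f m) a) (pev (poly_approx f n) a) < e" by blast
  qed
  then show ?thesis unfolding cfc_def by (simp add: Cauchy_convergent_iff convergent_LIMSEQ_iff)
qed

lemma norm_pev_diff_cfc_le: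
  assumes a: "psd a" "norm a \<le> r" "0 < r" and f: "continuous_on {0..} f"
    and c: "\<And>t. 0 \<le> t \<Longrightarrow> t \<le> r \<Longrightarrow> \<bar>poly p t - f t\<bar> \<le> c"
  shows "norm (pev p a - cfc f a) \<le> c"
proof (rule LIMSEQ_le)
  show "(\<lambda>n. norm (pev p a - pev (poly_approx f n) a)) \<longlonglongrightarrow> norm (pev p a - cfc f a)"
    by (intro tendsto_intros cfc_tendsto a f)
  show "(\<lambda>n. c + inverse (real (Suc n))) \<longlonglongrightarrow> c"
    using tendsto_add[OF tendsto_const LIMSEQ_inverse_real_of_nat, of c] by simp
  obtain N :: nat where N: "r < real N" using reals_Archimedean2 by blast
  have "norm (pev p a - pev (poly_approx f n) a) \<le> c + inverse (real (Suc n))" if "N \<le> n" for n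
    unfolding pev_diff[symmetric]
  proof (rule norm_pev_le[OF a])
    fix t assume t: "0 \<le> t" "t \<le> r"
    have "\<bar>poly (poly_approx f n) t - f t\<bar> \<le> inverse (real (Suc n))"
      using poly_approx[OF f t(1), of n] t(2) that N by (simp add: inverse_eq_divide add.commute)
    with c[OF t] show "\<bar>poly (p - poly_approx f n) t\<bar> \<le> c + inverse (real (Suc n))"
      by (simp add: abs_le_iff)
  qed
  then show "\<exists>N. \<forall>n\<ge>N. norm (pev p a - pev (poly_approx f n) a) \<le> c + inverse (real (Suc n))" by blast
qed

lemma norm_cfc_le_local:
  assumes "psd a" "norm a \<le> r" "0 < r" "continuous_on {0..} f" "\<And>t. 0 \<le> t \<Longrightarrow> t \<le> r \<Longrightarrow> \<bar>f t\<bar> \<le> c"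
  shows "norm (cfc f a) \<le> c"
  using norm_pev_diff_cfc_le[OF assms(1-4), of 0 c] assms(5) by simp

lemma norm_cfc_le:
  assumes "psd a" "continuous_on {0..} f" "\<And>t. 0 \<le> t \<Longrightarrow> \<bar>f t\<bar> \<le> c"
  shows "norm (cfc f a) \<le> c"
  by (rule norm_cfc_le_local[of a "norm a + 1"]) (use assms in \<open>auto simp: add_nonneg_pos\<close>)

text \<open>The limit does not depend on the chosen polynomials. Sums and products of approximants
  are therefore admissible, and this carries algebraic identities from \<open>pev\<close> to
  \<open>cfc\<close>.\<close>

lemma tendsto_cfcI:
  assumes a: "psd a" and f: "continuous_on {0..} f"
    and q: "\<And>r. uniform_limit {0..r} (\<lambda>n. poly (q n)) f sequentially"
  shows "(\<lambda>n. pev (q n) a) \<longlonglongrightarrow> cfc f a"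
proof (rule tendstoI)
  fix e :: real assume e: "0 < e"
  define r where "r = norm a + 1"
  have r: "norm a \<le> r" "0 < r" by (auto simp: r_def add_nonneg_pos)
  have "\<forall>\<^sub>F n in sequentially. \<forall>t\<in>{0..r}. dist (poly (q n) t) (f t) < e / 2"
    by (rule uniform_limitD[OF q]) (use e in simp)
  then show "\<forall>\<^sub>F n in sequentially. dist (pev (q n) a) (cfc f a) < e"
  proof eventually_elim
    case (elim n)
    have "norm (pev (q n) a - cfc f a) \<le> e / 2"
      by (rule norm_pev_diff_cfc_le[OF a r f]) (use elim in \<open>auto simp: dist_real_def intro: less_imp_le\<close>)
    then show ?case using e by (simp add: dist_norm)
  qed
qed

lemma uniform_poly_approx:
  assumes "continuous_on {0..} f"
  shows "uniform_limit {0..r} (\<lambda>n. poly (poly_approx f n)) f sequentially"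
proof (rule uniform_limitI)
  fix e :: real assume e: "0 < e"
  obtain N :: nat where N: "max r (1 / e) < real N" using reals_Archimedean2 by blast
  show "\<forall>\<^sub>F n in sequentially. \<forall>t\<in>{0..r}. dist (poly (poly_approx f n) t) (f t) < e"
    using eventually_ge_at_top[of N]
  proof eventually_elim
    case (elim n)
    have "1 / e < real n + 1" using N elim by simp
    then have "1 / (real n + 1) < e" using e by (simp add: field_simps)
    then show ?case using poly_approx[OF assms, of _ n] N elim by (fastforce simp: dist_real_def)
  qed
qed

lemma poly_approx_0_tendsto:
  "continuous_on {0..} f \<Longrightarrow> (\<lambda>n. poly (poly_approx f n) 0) \<longlonglongrightarrow> f 0"
  using tendsto_uniform_limitI[OF uniform_poly_approx, of f 0 0] by simp

lemma cfc_poly: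
  assumes "psd a"
  shows "cfc (poly p) a = pev p a"
proof -
  have "(\<lambda>n. pev p a) \<longlonglongrightarrow> cfc (poly p) a"
    by (rule tendsto_cfcI[OF assms]) (auto intro!: continuous_intros uniform_limit_const)
  then show ?thesis using LIMSEQ_unique[OF tendsto_const] by force
qed

lemma cfc_cong: "(\<And>t. 0 \<le> t \<Longrightarrow> f t = g t) \<Longrightarrow> cfc f a = cfc g a"
  by (simp add: cfc_def poly_approx_def)

lemma cfc_const: "psd a \<Longrightarrow> cfc (\<lambda>t. c) a = c *\<^sub>R (1 :: 'a::unital_cstar_algebra)"
  using cfc_poly[of a "[:c:]"] cfc_cong[of "poly [:c:]" "\<lambda>t. c" a] by simp

lemma cfc_id: "psd a \<Longrightarrow> cfc (\<lambda>t. t) a = (a :: 'a::unital_cstar_algebra)"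
  using cfc_poly[of a "[:0, 1:]"] cfc_cong[of "poly [:0, 1:]" "\<lambda>t. t" a] by simp

lemma cfc_add:
  assumes a: "psd a" and f: "continuous_on {0..} f" and g: "continuous_on {0..} g"
  shows "cfc (\<lambda>t. f t + g t) a = cfc f a + cfc g a"
proof (rule LIMSEQ_unique)
  show "(\<lambda>n. pev (poly_approx f n + poly_approx g n) a) \<longlonglongrightarrow> cfc (\<lambda>t. f t + g t) a"
  proof (rule tendsto_cfcI[OF a])
    show "uniform_limit {0..r} (\<lambda>n. poly (poly_approx f n + poly_approx g n)) (\<lambda>t. f t + g t) sequentially" for r
      using uniform_limit_add[OF uniform_poly_approx[OF f] uniform_poly_approx[OF g], of r]
      by (simp add: fun_eq_iff[symmetric] poly_add[abs_def])
  qed (intro continuous_intros f g)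
  show "(\<lambda>n. pev (poly_approx f n + poly_approx g n) a) \<longlonglongrightarrow> cfc f a + cfc g a"
    unfolding pev_add by (intro tendsto_intros cfc_tendsto a f g)
qed

lemma bounded_continuous_image_Icc:
  fixes f :: "real \<Rightarrow> real"
  assumes "continuous_on {0..} f"
  shows "bounded (f ` {0..r})"
  by (intro compact_imp_bounded compact_continuous_image continuous_on_subset[OF assms]) auto

lemma cfc_mult:
  assumes a: "psd a" and f: "continuous_on {0..} f" and g: "continuous_on {0..} g"
  shows "cfc (\<lambda>t. f t * g t) a = cfc f a * cfc g a"
proof (rule LIMSEQ_unique)
  show "(\<lambda>n. pev (poly_approx f n * poly_approx g n) a) \<longlonglongrightarrow> cfc (\<lambda>t. f t * g t) a"
  proof (rule tendsto_cfcI[OF a])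
    show "uniform_limit {0..r} (\<lambda>n. poly (poly_approx f n * poly_approx g n)) (\<lambda>t. f t * g t) sequentially" for r
      using uniform_lim_mult[OF uniform_poly_approx[OF f] uniform_poly_approx[OF g], of r]
      by (simp add: bounded_continuous_image_Icc f g poly_mult[abs_def])
  qed (intro continuous_intros f g)
  show "(\<lambda>n. pev (poly_approx f n * poly_approx g n) a) \<longlonglongrightarrow> cfc f a * cfc g a"
    unfolding pev_mult by (intro tendsto_intros cfc_tendsto a f g)
qed

lemma cfc_scale:
  assumes "psd a" "continuous_on {0..} f"
  shows "cfc (\<lambda>t. c * f t) a = c *\<^sub>R cfc f a"
  using cfc_mult[OF assms(1) continuous_on_const assms(2), of c] by (simp add: cfc_const assms(1))

lemma cfc_diff:
  assumes "psd a" "continuous_on {0..} f" "continuous_on {0..} g"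
  shows "cfc (\<lambda>t. f t - g t) a = cfc f a - cfc g a"
  using cfc_add[OF assms(1,2), of "\<lambda>t. - 1 * g t"] cfc_scale[OF assms(1,3), of "-1"]
    continuous_on_mult[OF continuous_on_const assms(3), of "-1"] by simp

lemma norm_cfc_diff_le:
  assumes "psd a" "continuous_on {0..} f" "continuous_on {0..} g" "\<And>t. 0 \<le> t \<Longrightarrow> \<bar>f t - g t\<bar> \<le> c"
  shows "norm (cfc f a - cfc g a) \<le> c"
  unfolding cfc_diff[OF assms(1-3), symmetric]
  by (rule norm_cfc_le) (use assms in \<open>auto intro!: continuous_intros\<close>)

lemma star_cfc:
  assumes "psd a" "continuous_on {0..} f"
  shows "star (cfc f a) = cfc f a"
  using tendsto_star[OF cfc_tendsto[OF assms]] cfc_tendsto[OF assms]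
  unfolding star_pev[OF psd_self_adjoint[OF assms(1)]] by (rule LIMSEQ_unique)

lemma cfc_commute:
  assumes "psd a" "continuous_on {0..} f" "x * a = a * x"
  shows "x * cfc f a = cfc f a * x"
proof (rule LIMSEQ_unique)
  show "(\<lambda>n. x * pev (poly_approx f n) a) \<longlonglongrightarrow> x * cfc f a" by (intro tendsto_intros cfc_tendsto assms)
  show "(\<lambda>n. x * pev (poly_approx f n) a) \<longlonglongrightarrow> cfc f a * x"
    unfolding pev_commute[OF assms(3)] by (intro tendsto_intros cfc_tendsto assms)
qed

lemma psd_cfc:
  assumes "psd a" "continuous_on {0..} f" "\<And>t. 0 \<le> t \<Longrightarrow> 0 \<le> f t"
  shows "psd (cfc f a)"
proof -
  have s: "continuous_on {0..} (\<lambda>t. sqrt (f t))" by (intro continuous_intros assms)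
  have eq: "cfc f a = cfc (\<lambda>t. sqrt (f t) * sqrt (f t)) a" by (rule cfc_cong) (simp add: assms)
  show ?thesis unfolding eq cfc_mult[OF assms(1) s s] by (rule psd_square[OF star_cfc[OF assms(1) s]])
qed

lemma pev_cfc:
  assumes a: "psd a" and f: "continuous_on {0..} f"
  shows "pev p (cfc f a) = cfc (\<lambda>t. poly p (f t)) a"
proof (induction p)
  case 0
  show ?case using cfc_const[OF a, of 0] by simp
next
  case (pCons c p)
  have p: "continuous_on {0..} (\<lambda>t. poly p (f t))" by (intro continuous_intros f)
  then have fp: "continuous_on {0..} (\<lambda>t. f t * poly p (f t))" by (intro continuous_intros f)
  show ?case
    using cfc_add[OF a continuous_on_const fp, of c] cfc_mult[OF a f p] by (simp add: pCons.IH cfc_const a)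
qed

lemma cfc_compose:
  assumes a: "psd a" and f: "continuous_on {0..} f" "\<And>t. 0 \<le> t \<Longrightarrow> 0 \<le> f t" and g: "continuous_on {0..} g"
  shows "cfc g (cfc f a) = cfc (\<lambda>t. g (f t)) a"
proof (rule LIMSEQ_unique)
  show "(\<lambda>n. pev (poly_approx g n) (cfc f a)) \<longlonglongrightarrow> cfc g (cfc f a)"
    by (intro cfc_tendsto psd_cfc a f g)
  have gf: "continuous_on {0..} (\<lambda>t. g (f t))"
    by (rule continuous_on_compose2[OF g f(1)]) (use f(2) in auto)
  define r where "r = norm a + 1"
  have r: "norm a \<le> r" "0 < r" by (auto simp: r_def add_nonneg_pos)
  \<comment> \<open>On \<open>{0..r}\<close> the values of \<open>f\<close> lie in
    \<open>{0..F}\<close>, where the polynomials for \<open>g\<close> converge uniformly.\<close>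
  obtain F where F: "\<forall>x\<in>{0..r}. \<bar>f x\<bar> \<le> F"
    using bounded_continuous_image_Icc[OF f(1)] by (auto simp: bounded_iff)
  show "(\<lambda>n. pev (poly_approx g n) (cfc f a)) \<longlonglongrightarrow> cfc (\<lambda>t. g (f t)) a"
  proof (rule tendstoI)
    fix e :: real assume e: "0 < e"
    have "\<forall>\<^sub>F n in sequentially. \<forall>s\<in>{0..F}. dist (poly (poly_approx g n) s) (g s) < e / 2"
      by (rule uniform_limitD[OF uniform_poly_approx[OF g]]) (use e in simp)
    then show "\<forall>\<^sub>F n in sequentially. dist (pev (poly_approx g n) (cfc f a)) (cfc (\<lambda>t. g (f t)) a) < e"
    proof eventually_elim
      case (elim n)
      have p: "continuous_on {0..} (\<lambda>t. poly (poly_approx g n) (f t))" by (intro continuous_intros f)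
      have "norm (pev (poly_approx g n) (cfc f a) - cfc (\<lambda>t. g (f t)) a) \<le> e / 2"
        unfolding pev_cfc[OF a f(1)] cfc_diff[OF a p gf, symmetric]
      proof (rule norm_cfc_le_local[OF a r])
        fix t assume t: "0 \<le> t" "t \<le> r"
        then have "\<bar>f t\<bar> \<le> F" using F by simp
        then have "f t \<in> {0..F}" using f(2)[OF t(1)] by simp
        with elim show "\<bar>poly (poly_approx g n) (f t) - g (f t)\<bar> \<le> e / 2"
          by (auto simp: dist_real_def intro: less_imp_le)
      qed (intro continuous_intros p gf)
      then show ?case using e by (simp add: dist_norm)
    qed
  qed
qed

lemma cfc_add_orthogonal:
  assumes a: "psd a" and b: "psd b" and ab: "a * b = 0" and f: "continuous_on {0..} f" "f 0 = 0"
  shows "cfc f (a + b) = cfc f a + cfc f b"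
proof (rule LIMSEQ_unique)
  have ba: "b * a = 0"
    using arg_cong[OF ab, of star] by (simp add: star_mult star_zero psd_self_adjoint a b)
  show "(\<lambda>n. pev (poly_approx f n) (a + b)) \<longlonglongrightarrow> cfc f (a + b)"
    by (intro cfc_tendsto psd_add a b f)
  \<comment> \<open>The approximants need not vanish at \<open>0\<close>, but their values there
    tend to \<open>f 0 = 0\<close>, so the correction term of \<open>pev_add_orthogonal\<close>
    disappears.\<close>
  have "(\<lambda>n. poly (poly_approx f n) 0) \<longlonglongrightarrow> 0" using poly_approx_0_tendsto[OF f(1)] f(2) by simp
  then have "(\<lambda>n. pev (poly_approx f n) a + pev (poly_approx f n) b - poly (poly_approx f n) 0 *\<^sub>R 1)
      \<longlonglongrightarrow> cfc f a + cfc f b - 0 *\<^sub>R 1"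
    by (intro tendsto_intros cfc_tendsto a b f)
  then show "(\<lambda>n. pev (poly_approx f n) (a + b)) \<longlonglongrightarrow> cfc f a + cfc f b"
    by (simp add: pev_add_orthogonal[OF ab ba])
qed

lemma pev_hom:
  fixes \<pi> :: "'a::unital_cstar_algebra \<Rightarrow> 'b::unital_cstar_algebra"
  assumes "\<pi> 1 = 1" "\<And>x y. \<pi> (x * y) = \<pi> x * \<pi> y" "bounded_linear \<pi>"
  shows "\<pi> (pev p a) = pev p (\<pi> a)"
proof -
  interpret bounded_linear \<pi> by fact
  show ?thesis by (induction p) (simp_all add: zero add scale assms(1,2))
qed

lemma cfc_hom:
  fixes \<pi> :: "'a::unital_cstar_algebra \<Rightarrow> 'b::unital_cstar_algebra"
  assumes "\<pi> 1 = 1" "\<And>x y. \<pi> (x * y) = \<pi> x * \<pi> y" "bounded_linear \<pi>" "\<And>x. \<pi> (star x) = star (\<pi> x)"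
    and a: "psd a" and f: "continuous_on {0..} f"
  shows "\<pi> (cfc f a) = cfc f (\<pi> a)"
proof (rule LIMSEQ_unique)
  have "psd (\<pi> a)" using a unfolding psd_def by (metis assms(2,4))
  then show "(\<lambda>n. pev (poly_approx f n) (\<pi> a)) \<longlonglongrightarrow> cfc f (\<pi> a)" by (intro cfc_tendsto f)
  show "(\<lambda>n. pev (poly_approx f n) (\<pi> a)) \<longlonglongrightarrow> \<pi> (cfc f a)"
    unfolding pev_hom[OF assms(1-3), symmetric] by (intro bounded_linear.tendsto[OF assms(3)] cfc_tendsto a f)
qed

section \<open>Positivity of \<open>star x * x\<close>\<close>

lemma psd_star_mult_add: 
  fixes y :: "'a::unital_cstar_algebra"
  shows "psd (star y * y + y * star y)"
proof -
  obtain h k where hk: "star h = h" "star k = k" "y = h + \<i> *\<^sub>C k"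
    by (rule self_adjoint_decomposition)
  have "star y * y + y * star y = (h * h + k * k) + (h * h + k * k)"
    unfolding hk(3) star_mult_decomposition[OF hk(1,2)] by simp
  then show ?thesis by (simp only:) (intro psd_add psd_square hk)
qed

text \<open>The negative part \<open>m\<close> of \<open>c = x\<^sup>*x\<close> gives \<open>y = xm\<close> with \<open>y\<^sup>*y = -m\<^sup>3\<close>. Repeating the construction yields
  \<open>z\<close> for which both \<open>z\<^sup>*z\<close> and \<open>zz\<^sup>*\<close> are negative, which forces them to vanish.\<close>

lemma psd_star_mult:
  fixes x :: "'a::unital_cstar_algebra"
  shows "psd (star x * x)"
proof -
  define c where "c = star x * x"
  have cs: "star c = c" by (simp add: c_def star_mult star_star)
  define r where "r = norm c"
  \<comment> \<open>The calculus accepts only positive arguments, so \<open>c\<close> is shifted by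
    its norm; its negative part is then the function \<open>max (r - t) 0\<close> of
    \<open>a\<close>.\<close>
  define a where "a = r *\<^sub>R 1 + c"
  have a: "psd a" using psd_diff_of_norm_le[of "- c" r] by (simp add: a_def star_minus cs r_def)
  define m where "m = cfc (\<lambda>t. max (r - t) 0) a"
  define q where "q t = sqrt ((max (r - t) 0) ^ 3)" for t
  define Q where "Q = cfc q a"
  have qc: "continuous_on {0..} q" unfolding q_def[abs_def] by (intro continuous_intros)
  have mc: "continuous_on {0..} (\<lambda>t. max (r - t) 0)" by (intro continuous_intros)
  have tc: "continuous_on {0..} (\<lambda>t. t - r)" by (intro continuous_intros)
  have c: "c = cfc (\<lambda>t. t - r) a"
    using cfc_diff[OF a continuous_on_id continuous_on_const, of r] unfolding cfc_id[OF a] cfc_const[OF a]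
    by (simp add: a_def)
  have ms: "star m = m" and Qs: "star Q = Q" unfolding m_def Q_def by (intro star_cfc a mc qc)+
  have mcm: "m * c * m = - (Q * Q)"
  proof -
    have "m * c * m = cfc (\<lambda>t. max (r - t) 0 * (t - r) * max (r - t) 0) a"
      unfolding m_def c using a mc tc by (subst cfc_mult cfc_mult, auto intro!: continuous_intros)+
    also have "\<dots> = cfc (\<lambda>t. - 1 * (q t * q t)) a"
      by (rule cfc_cong) (auto simp: q_def max_def power3_eq_cube algebra_simps)
    also have "\<dots> = - (Q * Q)"
      unfolding Q_def using cfc_scale[OF a continuous_on_mult[OF qc qc], of "-1"] by (simp add: cfc_mult[OF a qc qc])
    finally show ?thesis .
  qed
  have QQ: "Q * Q = m * m * m"
  proof -
    have "Q * Q = cfc (\<lambda>t. q t * q t) a" unfolding Q_def by (rule cfc_mult[OF a qc qc, symmetric])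
    also have "\<dots> = cfc (\<lambda>t. max (r - t) 0 * max (r - t) 0 * max (r - t) 0) a"
      by (rule cfc_cong) (auto simp: q_def power3_eq_cube)
    also have "\<dots> = m * m * m"
      unfolding m_def using a mc by (subst cfc_mult cfc_mult, auto intro!: continuous_intros)+
    finally show ?thesis .
  qed
  define y where "y = x * m"
  have yy: "star y * y = - (Q * Q)"
    using mcm by (simp add: y_def star_mult ms c_def mult.assoc)
  define t where "t = y * star y"
  have ts: "star t = t" by (simp add: t_def star_mult star_star)
  define z where "z = Q * star y"
  have "star z * z = y * (Q * Q) * star y" by (simp add: z_def star_mult star_star Qs mult.assoc)
  also have "Q * Q = - (star y * y)" by (simp add: yy)
  finally have z1: "star z * z = - (t * t)" by (simp add: t_def mult.assoc)
  have "z * star z = Q * (star y * y) * Q" by (simp add: z_def star_mult star_star Qs mult.assoc)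
  then have z2: "z * star z = - ((Q * Q) * (Q * Q))" by (simp add: yy mult.assoc)
  have QQs: "star (Q * Q) = Q * Q" by (simp add: star_mult Qs)
  \<comment> \<open>By \<open>psd_star_mult_add\<close> the sum of the two negative elements
    \<open>star z * z\<close> and \<open>z * star z\<close> is positive, so it is \<open>0\<close>;
    then \<open>Q * Q\<close>, \<open>m * m\<close> and \<open>m\<close> vanish one after
    another.\<close>
  have "psd (- (t * t + (Q * Q) * (Q * Q)))" using psd_star_mult_add[of z] by (simp add: z1 z2)
  then have sum0: "t * t + (Q * Q) * (Q * Q) = 0"
    by (rule psd_antisym[OF psd_add[OF psd_square[OF ts] psd_square[OF QQs]]])
  then have "psd (- ((Q * Q) * (Q * Q)))"
    using psd_square[OF ts] by (metis eq_neg_iff_add_eq_0)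
  then have "(Q * Q) * (Q * Q) = 0" by (rule psd_antisym[OF psd_square[OF QQs]])
  then have "Q * Q = 0" by (rule self_adjoint_square_eq_0[OF QQs])
  then have "(m * m) * (m * m) = 0" by (metis QQ mult.assoc mult_zero_left)
  then have "m * m = 0" by (rule self_adjoint_square_eq_0[rotated]) (simp add: star_mult ms)
  then have "m = 0" by (rule self_adjoint_square_eq_0[OF ms])
  \<comment> \<open>Adding the vanishing negative part exhibits \<open>c\<close> as its own positive
    part, a nonnegative function of \<open>a\<close>.\<close>
  then have "c = c + m" by simp
  also have "\<dots> = cfc (\<lambda>t. (t - r) + max (r - t) 0) a" unfolding m_def c by (rule cfc_add[OF a tc mc, symmetric])
  also have "psd \<dots>" by (rule psd_cfc[OF a]) (auto intro!: continuous_intros)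
  finally show ?thesis by (simp add: c_def)
qed

lemma psd_conj: 
  fixes x :: "'a::unital_cstar_algebra"
  assumes "psd a" 
  shows "psd (star x * a * x)"
proof -
  obtain h where h: "star h = h" "h * h = a" using assms by (auto simp: psd_def)
  have "star x * a * x = star (h * x) * (h * x)" by (simp add: star_mult h(1) h(2)[symmetric] mult.assoc)
  then show ?thesis by (simp add: psd_star_mult)
qed

section \<open>Unitization\<close>

datatype 'a unitization = Unitization (ubase: 'a) (uscal: complex)

lemma unitization_eqI: "ubase x = ubase y \<Longrightarrow> uscal x = uscal y \<Longrightarrow> x = y"
  by (rule unitization.expand) simp

instantiation unitization :: (complex_vector) complex_vector
begin

definition "0 = Unitization 0 0"
definition "x + y = Unitization (ubase x + ubase y) (uscal x + uscal y)"
definition "- x = Unitization (- ubase x) (- uscal x)"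
definition "x - y = Unitization (ubase x - ubase y) (uscal x - uscal y)"
definition "r *\<^sub>R x = Unitization (r *\<^sub>R ubase x) (complex_of_real r * uscal x)"
definition "c *\<^sub>C x = Unitization (c *\<^sub>C ubase x) (c * uscal x)"

lemma unitization_sel [simp]:
  "ubase (0 :: 'a unitization) = 0" "uscal (0 :: 'a unitization) = 0"
  "ubase (x + y) = ubase x + ubase y" "uscal (x + y) = uscal x + uscal y"
  "ubase (- x) = - ubase x" "uscal (- x) = - uscal x"
  "ubase (x - y) = ubase x - ubase y" "uscal (x - y) = uscal x - uscal y"
  "ubase (r *\<^sub>R x) = r *\<^sub>R ubase x" "uscal (r *\<^sub>R x) = complex_of_real r * uscal x"
  "ubase (c *\<^sub>C x) = c *\<^sub>C ubase x" "uscal (c *\<^sub>C x) = c * uscal x" for x y :: "'a unitization"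
  by (simp_all add: zero_unitization_def plus_unitization_def uminus_unitization_def minus_unitization_def
      scaleR_unitization_def scaleC_unitization_def)

instance
  by standard (auto intro!: unitization_eqI simp: algebra_simps scaleC_add_left scaleC_add_right scaleC_scaleC scaleC_of_real)

end

definition uact :: "'a::star_algebra unitization \<Rightarrow> 'a \<Rightarrow> 'a"
  where "uact x v = ubase x * v + uscal x *\<^sub>C v"

instantiation unitization :: (star_algebra) star_algebra
begin

definition "x * y = Unitization (uact x (ubase y) + uscal y *\<^sub>C ubase x) (uscal x * uscal y)"
definition "star x = Unitization (star (ubase x)) (cnj (uscal x))"

lemma unitization_sel_mult [simp]:
  "ubase (x * y) = ubase x * ubase y + uscal x *\<^sub>C ubase y + uscal y *\<^sub>C ubase x" "uscal (x * y) = uscal x * uscal y"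
  "ubase (star x) = star (ubase x)" "uscal (star x) = cnj (uscal x)" for x y :: "'a unitization"
  by (simp_all add: times_unitization_def star_unitization_def uact_def)

instance
  by standard
    (auto intro!: unitization_eqI simp: algebra_simps scaleC_add_left scaleC_add_right scaleC_scaleC mult_scaleC_left
      mult_scaleC_right star_star star_add star_mult star_scaleC scaleC_scaleR_commute simp flip: scaleC_of_real)

end

section \<open>The operator norm of the left action of the unitization\<close>

lemma uact_mult: "uact (x * y) v = uact x (uact y v)"
  by (simp add: uact_def algebra_simps mult_scaleC_left mult_scaleC_right scaleC_add_right scaleC_scaleC)

lemma uact_star: "star (uact x v) * w = star v * uact (star x) w"
  by (simp add: uact_def star_add star_mult star_scaleC algebra_simps mult_scaleC_left mult_scaleC_right)

lemma bl_uact: "bounded_linear (uact (x :: 'a::cstar_algebra unitization))"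
proof (rule bounded_linear_intro)
  fix v w :: 'a and r :: real
  show "uact x (v + w) = uact x v + uact x w"
    by (simp add: uact_def algebra_simps scaleC_add_right)
  show "uact x (r *\<^sub>R v) = r *\<^sub>R uact x v"
    by (simp add: uact_def algebra_simps scaleC_scaleR_commute)
  have "norm (uact x v) \<le> norm (ubase x) * norm v + cmod (uscal x) * norm v"
    unfolding uact_def
    by (rule order_trans[OF norm_triangle_ineq add_mono[OF norm_mult_ineq]]) (simp add: norm_scaleC)
  then show "norm (uact x v) \<le> norm v * (norm (ubase x) + cmod (uscal x))" by (simp add: algebra_simps)
qed

lemma onorm_uact_le: "onorm (uact x) \<le> norm (ubase x) + cmod (uscal (x :: 'a::cstar_algebra unitization))"
proof (rule onorm_bound)
  fix v :: 'a
  have "norm (uact x v) \<le> norm (ubase x) * norm v + cmod (uscal x) * norm v"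
    unfolding uact_def
    by (rule order_trans[OF norm_triangle_ineq add_mono[OF norm_mult_ineq]]) (simp add: norm_scaleC)
  then show "norm (uact x v) \<le> (norm (ubase x) + cmod (uscal x)) * norm v" by (simp add: algebra_simps)
qed simp

text \<open>Acting on \<open>star (ubase x)\<close> recovers the square of
  \<open>norm (ubase x)\<close> up to the scalar part. With \<open>onorm_uact_le\<close> this makes
  the norm of the unitization equivalent to the sum of the norms of its two components, hence
  complete.\<close>

lemma norm_ubase_le: "norm (ubase x) \<le> onorm (uact x) + cmod (uscal (x :: 'a::cstar_algebra unitization))"
proof (cases "norm (ubase x) = 0")
  case False
  let ?b = "ubase x"
  have "norm ?b * norm ?b = norm (?b * star ?b)"
    using cstar_identity[of "star ?b"] by (simp add: star_star norm_star power2_eq_square)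
  also have "?b * star ?b = uact x (star ?b) - uscal x *\<^sub>C star ?b" by (simp add: uact_def)
  also have "norm \<dots> \<le> onorm (uact x) * norm (star ?b) + cmod (uscal x) * norm (star ?b)"
    by (rule order_trans[OF norm_triangle_ineq4 add_mono[OF onorm[OF bl_uact]]])
      (simp add: norm_scaleC)
  also have "\<dots> = (onorm (uact x) + cmod (uscal x)) * norm ?b" by (simp add: norm_star algebra_simps)
  finally show ?thesis using False by (simp add: mult_le_cancel_right)
qed (simp add: onorm_pos_le bl_uact)

text \<open>By the C*-identity of the original algebra, the squared norm of \<open>uact x v\<close>
  is the norm of \<open>star v * uact (star x * x) v\<close>.\<close>

lemma onorm_uact_star_mult:
  "onorm (uact (star x * x)) = (onorm (uact (x :: 'a::cstar_algebra unitization)))\<^sup>2"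
proof -
  let ?n = "\<lambda>x :: 'a unitization. onorm (uact x)"
  note bl = bl_uact
  have nn: "0 \<le> ?n x" for x by (rule onorm_pos_le[OF bl])
  have sq: "(?n x)\<^sup>2 \<le> ?n (star x * x)" for x
  proof -
    have "?n x \<le> sqrt (?n (star x * x))"
    proof (rule onorm_bound)
      fix v
      have "(norm (uact x v))\<^sup>2 = norm (star v * uact (star x * x) v)"
        by (simp only: cstar_identity[symmetric] uact_star uact_mult)
      also have "\<dots> \<le> norm v * (?n (star x * x) * norm v)"
        by (rule order_trans[OF norm_mult_ineq]) (simp add: norm_star mult_left_mono onorm[OF bl])
      also have "\<dots> = (sqrt (?n (star x * x)) * norm v)\<^sup>2"
        by (simp add: power_mult_distrib nn power2_eq_square)
      finally show "norm (uact x v) \<le> sqrt (?n (star x * x)) * norm v"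
        by (rule power2_le_imp_le) (simp add: nn)
    qed (simp add: nn)
    then show ?thesis using power_mono[OF _ nn, of x "sqrt (?n (star x * x))" 2] by (simp add: nn)
  qed
  have mult: "?n (x * y) \<le> ?n x * ?n y" for x y
    using onorm_compose[OF bl bl, of x y] by (simp add: o_def uact_mult[abs_def])
  have le: "?n x \<le> ?n (star x)" for x
  proof (cases "?n x = 0")
    case False
    have "?n x * ?n x \<le> ?n (star x) * ?n x" using sq[of x] mult[of "star x" x] by (simp add: power2_eq_square)
    with False nn[of x] show ?thesis by (simp add: mult_le_cancel_right)
  qed (simp add: nn)
  have "?n (star x * x) \<le> ?n (star x) * ?n x" by (rule mult)
  also have "\<dots> \<le> ?n x * ?n x" using le[of "star x"] nn by (intro mult_right_mono) (auto simp: star_star)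
  finally show ?thesis using sq[of x] by (simp add: power2_eq_square)
qed

instantiation unitization :: (cstar_algebra) real_normed_algebra_1
begin

text \<open>The operator norm of left multiplication alone would not be definite when the algebra already has a unit.\<close>

definition norm_unitization :: "'a unitization \<Rightarrow> real"
  where "norm (x :: 'a unitization) = max (cmod (uscal x)) (onorm (uact x))"
definition dist_unitization :: "'a unitization \<Rightarrow> 'a unitization \<Rightarrow> real"
  where "dist (x :: 'a unitization) y = norm (x - y)"
definition sgn_unitization :: "'a unitization \<Rightarrow> 'a unitization"
  where "sgn (x :: 'a unitization) = x /\<^sub>R norm x"
definition uniformity_unitization :: "('a unitization \<times> 'a unitization) filter"
  where "uniformity = (INF e\<in>{0<..}. principal {(x :: 'a unitization, y). dist x y < e})"
definition open_unitization :: "'a unitization set \<Rightarrow> bool"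
  where "open (U :: 'a unitization set) = (\<forall>x\<in>U. \<forall>\<^sub>F (x', y) in uniformity. x' = x \<longrightarrow> y \<in> U)"
definition one_unitization :: "'a unitization"
  where "1 = Unitization 0 1"

lemma unitization_one_sel [simp]: "ubase (1 :: 'a unitization) = 0" "uscal (1 :: 'a unitization) = 1"
  by (simp_all add: one_unitization_def)

instance
proof
  fix x y :: "'a unitization" and r :: real
  note bl = bl_uact
  show "1 * x = x" "x * 1 = x" by (auto intro!: unitization_eqI simp: scaleC_one scaleC_zero_right scaleC_zero_left)
  show "(0 :: 'a unitization) \<noteq> 1" by (metis unitization_sel(2) unitization_one_sel(2) zero_neq_one)
  show "(norm x = 0) = (x = 0)"
  proof
    assume "norm x = 0"
    moreover have "0 \<le> onorm (uact x)" by (rule onorm_pos_le[OF bl])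
    ultimately have "uscal x = 0" "onorm (uact x) = 0"
      unfolding norm_unitization_def by (metis max.cobounded1 norm_le_zero_iff, metis max.cobounded2 order_antisym)
    then show "x = 0" using norm_ubase_le[of x] by (intro unitization_eqI) auto
  next
    assume "x = 0"
    then show "norm x = 0"
      using onorm_uact_le[of x] onorm_pos_le[OF bl, of x] by (simp add: norm_unitization_def)
  qed
  have "onorm (uact (x + y)) \<le> onorm (uact x) + onorm (uact y)"
    using onorm_triangle[OF bl bl, of x y]
    by (simp add: uact_def[abs_def] scaleC_add_left algebra_simps)
  then show "norm (x + y) \<le> norm x + norm y"
    using norm_triangle_ineq[of "uscal x" "uscal y"] by (auto simp: norm_unitization_def)
  have "onorm (uact (r *\<^sub>R x)) = onorm (\<lambda>v. r *\<^sub>R uact x v)"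
    by (simp add: uact_def[abs_def] scaleR_add_right scaleC_scaleC[symmetric] scaleC_of_real)
  also have "\<dots> = \<bar>r\<bar> * onorm (uact x)" by (rule onorm_scaleR[OF bl])
  finally show "norm (r *\<^sub>R x) = \<bar>r\<bar> * norm x" by (simp add: norm_unitization_def norm_mult max_mult_distrib_left)
  have "onorm (uact (x * y)) \<le> onorm (uact x) * onorm (uact y)"
    using onorm_compose[OF bl bl, of x y] by (simp add: o_def uact_mult[abs_def])
  also have "\<dots> \<le> norm x * norm y"
    by (intro mult_mono) (auto simp: norm_unitization_def le_max_iff_disj onorm_pos_le[OF bl])
  finally have "onorm (uact (x * y)) \<le> norm x * norm y" .
  moreover have "cmod (uscal (x * y)) \<le> norm x * norm y"
    unfolding unitization_sel_mult norm_mult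
    by (intro mult_mono) (auto simp: norm_unitization_def le_max_iff_disj)
  ultimately show "norm (x * y) \<le> norm x * norm y" by (simp add: norm_unitization_def)
  show "norm (1 :: 'a unitization) = 1"
    using onorm_uact_le[of "1 :: 'a unitization"] by (simp add: norm_unitization_def)
qed (simp_all add: dist_unitization_def sgn_unitization_def uniformity_unitization_def open_unitization_def)

end

lemma norm_unitization_le: "norm x \<le> norm (ubase x) + cmod (uscal (x :: 'a::cstar_algebra unitization))"
  using onorm_uact_le[of x] by (simp add: norm_unitization_def)

lemma norm_ubase_le_norm: "norm (ubase x) \<le> 2 * norm (x :: 'a::cstar_algebra unitization)"
  using norm_ubase_le[of x] by (simp add: norm_unitization_def)

lemma norm_uscal_le_norm: "cmod (uscal x) \<le> norm (x :: 'a::cstar_algebra unitization)"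
  by (simp add: norm_unitization_def)

lemma bounded_linear_ubase: "bounded_linear (ubase :: 'a::cstar_algebra unitization \<Rightarrow> 'a)"
  by (rule bounded_linear_intro[where K=2]) (use norm_ubase_le_norm in \<open>auto simp: mult.commute\<close>)

lemma bounded_linear_uscal: "bounded_linear (uscal :: 'a::cstar_algebra unitization \<Rightarrow> complex)"
  by (rule bounded_linear_intro[where K=1]) (simp_all add: scaleR_conv_of_real[where 'a=complex] norm_uscal_le_norm)

instance unitization :: (cstar_algebra) unital_cstar_algebra
proof
  fix F :: "nat \<Rightarrow> 'a unitization" assume F: "Cauchy F"
  obtain b where b: "(\<lambda>n. ubase (F n)) \<longlonglongrightarrow> b"
    using bounded_linear.Cauchy[OF bounded_linear_ubase F] Cauchy_convergent convergent_def by blast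
  obtain l where l: "(\<lambda>n. uscal (F n)) \<longlonglongrightarrow> l"
    using bounded_linear.Cauchy[OF bounded_linear_uscal F] Cauchy_convergent convergent_def by blast
  have "(\<lambda>n. norm (ubase (F n) - b) + cmod (uscal (F n) - l)) \<longlonglongrightarrow> 0"
    using tendsto_add[OF tendsto_norm[OF tendsto_diff[OF b tendsto_const[of b]]] tendsto_norm[OF tendsto_diff[OF l tendsto_const[of l]]]]
    by simp
  then have "(\<lambda>n. F n - Unitization b l) \<longlonglongrightarrow> 0"
    by (rule Lim_null_comparison[rotated]) (use norm_unitization_le[of "F _ - Unitization b l"] in auto)
  then show "convergent F" by (auto simp: LIM_zero_iff convergent_def)
next
  fix x :: "'a unitization" and c :: complex
  show star_norm: "norm (star x * x) = (norm x)\<^sup>2" for x :: "'a unitization"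
  proof -
    have "max (u\<^sup>2) (v\<^sup>2) = (max u v)\<^sup>2" if "0 \<le> u" "0 \<le> v" for u v :: real
      using that power_mono[of u v 2] power_mono[of v u 2] by (cases "u \<le> v") (auto simp: max_def)
    then show ?thesis
      unfolding norm_unitization_def onorm_uact_star_mult
      by (simp add: norm_mult power2_eq_square[of "cmod _", symmetric] onorm_pos_le[OF bl_uact])
  qed
  have "star (c *\<^sub>C x) * (c *\<^sub>C x) = (cnj c * c) *\<^sub>C (star x * x)"
    by (simp only: star_scaleC mult_scaleC_left mult_scaleC_right scaleC_scaleC mult.commute)
  also have "cnj c * c = complex_of_real ((cmod c)\<^sup>2)" unfolding complex_norm_square by (rule mult.commute)
  finally have "star (c *\<^sub>C x) * (c *\<^sub>C x) = (cmod c)\<^sup>2 *\<^sub>R (star x * x)" by (simp only: scaleC_of_real)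
  then have "norm (star (c *\<^sub>C x) * (c *\<^sub>C x)) = (cmod c)\<^sup>2 * norm (star x * x)" by simp
  then have "(norm (c *\<^sub>C x))\<^sup>2 = (cmod c * norm x)\<^sup>2" by (simp add: star_norm power_mult_distrib)
  then show "norm (c *\<^sub>C x) = cmod c * norm x" by (simp add: power2_eq_iff_nonneg)
qed

definition uemb :: "'a::cstar_algebra \<Rightarrow> 'a unitization"
  where "uemb a = Unitization a 0"

lemma uemb_sel [simp]: "ubase (uemb a) = a" "uscal (uemb a) = 0"
  by (simp_all add: uemb_def)

lemma uemb_simps:
  "uemb 0 = 0" "uemb (a + b) = uemb a + uemb b" "uemb (a - b) = uemb a - uemb b" "uemb (- a) = - uemb a"
  "uemb (a * b) = uemb a * uemb b" "uemb (r *\<^sub>R a) = r *\<^sub>R uemb a" "uemb (star a) = star (uemb a)"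
  by (auto intro!: unitization_eqI simp: scaleC_zero_left)

lemma uemb_ubase: "uscal x = 0 \<Longrightarrow> uemb (ubase x) = x"
  by (auto intro!: unitization_eqI)

lemma uemb_eq_iff: "uemb a = uemb b \<longleftrightarrow> a = b"
  by (metis uemb_sel(1))

lemma norm_uemb: "norm (uemb a) = norm a"
proof (rule antisym)
  show "norm (uemb a) \<le> norm a" using norm_unitization_le[of "uemb a"] by simp
  show "norm a \<le> norm (uemb a)" using norm_ubase_le[of "uemb a"] by (simp add: norm_unitization_def)
qed

lemma bounded_linear_uemb: "bounded_linear uemb"
  by (rule bounded_linear_intro[where K=1]) (auto simp: uemb_simps norm_uemb)

lemma tendsto_uemb_iff: "((\<lambda>n. uemb (X n)) \<longlongrightarrow> uemb l) F \<longleftrightarrow> (X \<longlongrightarrow> l) F"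
proof
  assume "((\<lambda>n. uemb (X n)) \<longlongrightarrow> uemb l) F"
  from bounded_linear.tendsto[OF bounded_linear_ubase this] show "(X \<longlongrightarrow> l) F" by simp
qed (rule bounded_linear.tendsto[OF bounded_linear_uemb])

section \<open>Cuntz subequivalence\<close>

lemma cuntz_le_iff:
  "cuntz_le a b \<longleftrightarrow> (\<forall>e>0. \<exists>x. norm (star x * b * x - a) < e)"
proof
  assume "cuntz_le a b"
  then obtain x :: "nat \<Rightarrow> 'a" where x: "(\<lambda>n. star (x n) * b * x n) \<longlonglongrightarrow> a" by (auto simp: cuntz_le_def)
  show "\<forall>e>0. \<exists>x. norm (star x * b * x - a) < e"
    using LIMSEQ_D[OF x] by blast
next
  assume "\<forall>e>0. \<exists>x. norm (star x * b * x - a) < e"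
  then have "\<exists>x. norm (star x * b * x - a) < inverse (real (Suc n))" for n by simp
  then obtain x where x: "\<And>n. norm (star (x n) * b * x n - a) < inverse (real (Suc n))" by metis
  show "cuntz_le a b" unfolding cuntz_le_def
    by (rule exI, rule tendsto_if_norm_diff_le[OF less_imp_le[OF x] LIMSEQ_inverse_real_of_nat])
qed

lemma cuntz_le_approx: "cuntz_le a b \<Longrightarrow> 0 < e \<Longrightarrow> \<exists>x. norm (star x * b * x - a) < e"
  by (simp add: cuntz_le_iff)

lemma cuntz_le_conj: "cuntz_le (star x * b * x) b"
  by (auto simp: cuntz_le_iff intro!: exI[of _ x])

lemma cuntz_le_closed:
  assumes "\<And>e. 0 < e \<Longrightarrow> \<exists>c. norm (c - a) < e \<and> cuntz_le c b"
  shows "cuntz_le a b"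
  unfolding cuntz_le_iff
proof (intro allI impI)
  fix e :: real assume "0 < e"
  then obtain c where c: "norm (c - a) < e / 2" "cuntz_le c b" using assms[of "e / 2"] by auto
  obtain x where x: "norm (star x * b * x - c) < e / 2" using cuntz_le_approx[OF c(2)] \<open>0 < e\<close> by (meson half_gt_zero)
  have "norm ((star x * b * x - c) + (c - a)) < e"
    by (rule order_le_less_trans[OF norm_triangle_ineq]) (use x c(1) in linarith)
  then show "\<exists>x. norm (star x * b * x - a) < e" by (auto intro!: exI[of _ x])
qed

lemma cuntz_le_limit:
  assumes "X \<longlonglongrightarrow> a" "\<And>n. cuntz_le (X n) b"
  shows "cuntz_le a b"
proof (rule cuntz_le_closed)
  fix e :: real assume "0 < e"
  then obtain n where "norm (X n - a) < e" using LIMSEQ_D[OF assms(1)] by blast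
  then show "\<exists>c. norm (c - a) < e \<and> cuntz_le c b" using assms(2) by blast
qed

lemma cuntz_le_trans:
  assumes "cuntz_le a b" "cuntz_le b c"
  shows "cuntz_le a c"
proof (rule cuntz_le_closed)
  fix e :: real assume "0 < e"
  then obtain x where x: "norm (star x * b * x - a) < e" using cuntz_le_approx[OF assms(1)] by blast
  obtain y :: "nat \<Rightarrow> 'a" where y: "(\<lambda>n. star (y n) * c * y n) \<longlonglongrightarrow> b"
    using assms(2) by (auto simp: cuntz_le_def)
  have "(\<lambda>n. star x * (star (y n) * c * y n) * x) \<longlonglongrightarrow> star x * b * x" by (intro tendsto_intros y)
  moreover have "cuntz_le (star x * (star (y n) * c * y n) * x) c" for n
    using cuntz_le_conj[of "y n * x" c] by (simp add: star_mult mult.assoc)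
  ultimately have "cuntz_le (star x * b * x) c" by (rule cuntz_le_limit)
  with x show "\<exists>d. norm (d - a) < e \<and> cuntz_le d c" by blast
qed

lemma cuntz_le_scaleR:
  fixes a b :: "'a::cstar_algebra"
  assumes "cuntz_le a b" and r: "0 \<le> r"
  shows "cuntz_le (r *\<^sub>R a) b"
proof -
  obtain x :: "nat \<Rightarrow> 'a" where x: "(\<lambda>n. star (x n) * b * x n) \<longlonglongrightarrow> a" using assms(1) by (auto simp: cuntz_le_def)
  have "(\<lambda>n. r *\<^sub>R (star (x n) * b * x n)) \<longlonglongrightarrow> r *\<^sub>R a" by (intro tendsto_intros x)
  moreover have "r *\<^sub>R (star (x n) * b * x n) = star (sqrt r *\<^sub>R x n) * b * (sqrt r *\<^sub>R x n)" for n
    using r by (simp add: star_scaleR)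
  ultimately show ?thesis unfolding cuntz_le_def by (auto intro!: exI[of _ "\<lambda>n. sqrt r *\<^sub>R x n"])
qed

section \<open>Approximate units and cut-downs in the unital case\<close>

lemma cfc_conj:
  assumes a: "psd a" and k: "continuous_on {0..} k" and f: "continuous_on {0..} f"
  shows "cfc k a * cfc f a * cfc k a = cfc (\<lambda>t. k t * f t * k t) a"
  using cfc_mult[OF a continuous_on_mult[OF k f] k] cfc_mult[OF a k f] by simp

lemma cfc_conj_id:
  assumes a: "psd a" and k: "continuous_on {0..} k"
  shows "cfc k a * a * cfc k a = cfc (\<lambda>t. k t * t * k t) a"
  using cfc_conj[OF a k continuous_on_id] by (simp only: cfc_id[OF a])

lemma conj_diff_distrib: "u * (x - y) * v = u * x * v - u * y * (v :: 'a::ring)"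
  by (simp add: algebra_simps)

lemma psd_mono_norm:
  assumes "psd a" "psd (b - a)" "norm b \<le> c"
  shows "norm a \<le> c"
proof (rule norm_le_if_psd_diff[OF assms(1)])
  have "star b = b" using psd_self_adjoint[OF psd_add[OF assms(1,2)]] by simp
  then have "psd ((c *\<^sub>R 1 - b) + (b - a))" by (intro psd_add psd_diff_of_norm_le assms)
  then show "psd (c *\<^sub>R 1 - a)" by simp
  show "0 \<le> c" using assms(3) norm_ge_zero order_trans by blast
qed

text \<open>An approximate unit for the hereditary subalgebra generated by the argument. The
  function vanishes at \<open>0\<close>, which keeps it inside an algebra without unit, and equals
  \<open>1\<close> from \<open>1 / (n + 1)\<close> on.\<close>

definition approx_unit :: "nat \<Rightarrow> 'a::unital_cstar_algebra \<Rightarrow> 'a"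
  where "approx_unit n = cfc (\<lambda>t. t / max t (inverse (real (Suc n))))"

lemma cont_approx_unit: "continuous_on A (\<lambda>t. t / max t (inverse (real (Suc n))))"
proof (intro continuous_intros ballI)
  fix t :: real
  have "0 < inverse (real (Suc n))" by simp
  then show "max t (inverse (real (Suc n))) \<noteq> 0" by linarith
qed

lemma star_approx_unit: "psd a \<Longrightarrow> star (approx_unit n a) = approx_unit n a"
  unfolding approx_unit_def by (rule star_cfc[OF _ cont_approx_unit])

text \<open>With \<open>u = 1 - approx_unit n y\<close>, the squared norm of \<open>s * u\<close> is
  that of \<open>u * (star s * s) * u\<close>, which lies below \<open>u * y * u\<close>; and
  \<open>t\<close> times the square of the function of \<open>u\<close> is at most
  \<open>1 / (n + 1)\<close>.\<close>

lemma approx_unit_mult_tendsto: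
  assumes y: "psd y" and s: "psd (y - star s * s)"
  shows "(\<lambda>n. s * approx_unit n y) \<longlonglongrightarrow> s"
proof -
  have "norm (s * approx_unit n y - s) \<le> sqrt (inverse (real (Suc n)))" for n
  proof -
    define d where "d = inverse (real (Suc n))"
    have d: "0 < d" by (simp add: d_def)
    define f where "f = (\<lambda>t. 1 - t / max t d)"
    have fc: "continuous_on {0..} f"
      unfolding f_def d_def by (intro continuous_on_diff continuous_on_const cont_approx_unit)
    define u where "u = cfc f y"
    have us: "star u = u" unfolding u_def by (rule star_cfc[OF y fc])
    have u: "u = 1 - approx_unit n y"
      unfolding u_def f_def d_def approx_unit_def
      by (subst cfc_diff[OF y continuous_on_const cont_approx_unit]) (simp add: cfc_const y)
    have 1: "norm (u * y * u) \<le> d"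
      unfolding u_def cfc_conj_id[OF y fc]
    proof (rule norm_cfc_le[OF y])
      fix t :: real assume t: "0 \<le> t"
      have 0: "0 \<le> f t" "f t \<le> 1" using t d by (auto simp: f_def divide_le_eq_1 max_def)
      have "t * f t \<le> d"
      proof (cases "t \<le> d")
        case True
        with 0 t show ?thesis using mult_left_mono[OF 0(2) t] by simp
      qed (use d in \<open>simp add: f_def max_def\<close>)
      moreover have "f t * t * f t \<le> f t * t * 1" by (intro mult_left_mono) (use 0 t in auto)
      ultimately show "\<bar>f t * t * f t\<bar> \<le> d" using 0 t by (simp add: abs_of_nonneg mult.commute)
    qed (intro continuous_intros fc)
    have 2: "psd (u * y * u - u * (star s * s) * u)"
      using psd_conj[OF s, of u] unfolding us conj_diff_distrib .
    have 3: "psd (u * (star s * s) * u)" using psd_conj[OF psd_star_mult[of s], of u] by (simp only: us)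
    have "(norm (s * u))\<^sup>2 = norm (u * (star s * s) * u)"
      unfolding cstar_identity[symmetric] by (simp add: star_mult us mult.assoc)
    also have "\<dots> \<le> d" by (rule psd_mono_norm[OF 3 2 1])
    finally have "norm (s * u) \<le> sqrt d" by (rule real_le_rsqrt)
    then show ?thesis unfolding u d_def by (simp add: algebra_simps norm_minus_commute)
  qed
  moreover have "(\<lambda>n. sqrt (inverse (real (Suc n)))) \<longlonglongrightarrow> 0"
    using tendsto_real_sqrt[OF LIMSEQ_inverse_real_of_nat] by simp
  ultimately show ?thesis by (rule tendsto_if_norm_diff_le)
qed

text \<open>For \<open>k = sqrt t / max t d\<close> the function \<open>k * t * k\<close> is the
  square of that of \<open>approx_unit\<close>: a factor \<open>t\<close> is traded for two factors
  of the approximate unit.\<close>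

lemma approx_unit_conj_cfc:
  assumes a: "psd a" and f: "continuous_on {0..} f"
  obtains k where "star k = k" "k * cfc (\<lambda>t. t * f t) a * k = approx_unit n a * cfc f a * approx_unit n a"
proof
  define d where "d = inverse (real (Suc n))"
  have d: "0 < d" by (simp add: d_def)
  define k where "k = (\<lambda>t. sqrt t / max t d)"
  have kc: "continuous_on {0..} k" unfolding k_def using d by (auto intro!: continuous_intros)
  show "star (cfc k a) = cfc k a" by (rule star_cfc[OF a kc])
  have "cfc k a * cfc (\<lambda>t. t * f t) a * cfc k a = cfc (\<lambda>t. k t * (t * f t) * k t) a"
    by (intro cfc_conj a kc continuous_intros f)
  also have "\<dots> = cfc (\<lambda>t. (t / max t d) * f t * (t / max t d)) a" by (rule cfc_cong) (simp add: k_def)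
  also have "\<dots> = approx_unit n a * cfc f a * approx_unit n a"
    unfolding approx_unit_def d_def by (rule cfc_conj[OF a cont_approx_unit f, symmetric])
  finally show "cfc k a * cfc (\<lambda>t. t * f t) a * cfc k a = approx_unit n a * cfc f a * approx_unit n a" .
qed

text \<open>Conjugating \<open>w * star w\<close> by \<open>w\<close> gives \<open>b * b\<close> for
  \<open>b = star w * w\<close>, one factor too many. The approximate unit \<open>h\<close> of
  \<open>b\<close> removes it, since \<open>h * b * h = k * (b * b) * k\<close>.\<close>

lemma cuntz_le_star_mult_unital:
  fixes w :: "'a::unital_cstar_algebra"
  shows "cuntz_le (star w * w) (w * star w)"
proof -
  define b where "b = star w * w"
  have b: "psd b" by (simp add: b_def psd_star_mult)
  have "(\<lambda>n. w * approx_unit n b) \<longlonglongrightarrow> w"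
    by (rule approx_unit_mult_tendsto[OF b]) (simp add: b_def psd_zero)
  from tendsto_mult[OF tendsto_star[OF this] this]
  have "(\<lambda>n. star (w * approx_unit n b) * (w * approx_unit n b)) \<longlonglongrightarrow> b" by (simp only: b_def)
  moreover have "star (w * h) * (w * h) = h * b * h" if "star h = h" for h
    by (simp add: b_def star_mult that mult.assoc)
  ultimately have "(\<lambda>n. approx_unit n b * b * approx_unit n b) \<longlonglongrightarrow> b" by (simp only: star_approx_unit[OF b])
  moreover have "cuntz_le (approx_unit n b * b * approx_unit n b) (w * star w)" for n
  proof -
    obtain k where k: "star k = k" "k * cfc (\<lambda>t. t * t) b * k = approx_unit n b * cfc (\<lambda>t. t) b * approx_unit n b"
      by (rule approx_unit_conj_cfc[OF b continuous_on_id])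
    have "approx_unit n b * b * approx_unit n b = star k * (b * b) * k"
      using k(2) cfc_mult[OF b continuous_on_id continuous_on_id] by (simp only: k(1) cfc_id[OF b])
    also have "\<dots> = star (w * k) * (w * star w) * (w * k)" by (simp add: b_def star_mult mult.assoc)
    finally show ?thesis by (simp only: cuntz_le_conj)
  qed
  ultimately have "cuntz_le b (w * star w)" by (rule cuntz_le_limit)
  then show ?thesis by (simp only: b_def)
qed

text \<open>For \<open>s * s = x\<close> and an approximate unit \<open>h\<close> of
  \<open>y\<close>, the element \<open>x\<close> is the limit of
  \<open>star (s * h) * (s * h)\<close>. Exchanging the factors gives
  \<open>s * (h * h) * s\<close>, which is Cuntz below \<open>h * h\<close> and hence below
  \<open>y\<close>.\<close>

lemma cuntz_le_if_psd_diff: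
  assumes x: "psd x" and yx: "psd (y - x)"
  shows "cuntz_le x y"
proof -
  have y: "psd y" using psd_add[OF x yx] by simp
  obtain s where s: "star s = s" "s * s = x" using x by (auto simp: psd_def)
  define h where "h n = approx_unit n y" for n
  have hs: "star (h n) = h n" for n unfolding h_def by (rule star_approx_unit[OF y])
  have sh: "(\<lambda>n. s * h n) \<longlonglongrightarrow> s"
    unfolding h_def by (rule approx_unit_mult_tendsto[OF y]) (simp only: s yx)
  have "(\<lambda>n. star (s * h n) * (s * h n)) \<longlonglongrightarrow> x"
    using tendsto_mult[OF tendsto_star[OF sh] sh] by (simp only: s)
  moreover have "cuntz_le (star (s * h n) * (s * h n)) y" for n
  proof -
    have "cuntz_le (star (s * h n) * (s * h n)) ((s * h n) * star (s * h n))" by (rule cuntz_le_star_mult_unital)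
    also have "(s * h n) * star (s * h n) = star s * (h n * h n) * s" by (simp add: star_mult hs s mult.assoc)
    finally have 1: "cuntz_le (star (s * h n) * (s * h n)) \<dots>" .
    obtain k where k: "star k = k" "k * cfc (\<lambda>t. t * 1) y * k = h n * cfc (\<lambda>t. 1) y * h n"
      unfolding h_def by (rule approx_unit_conj_cfc[OF y continuous_on_const])
    then have "h n * h n = star k * y * k" by (simp add: cfc_id[OF y] cfc_const[OF y])
    then have 2: "cuntz_le (h n * h n) y" by (simp only: cuntz_le_conj)
    show ?thesis by (rule cuntz_le_trans[OF 1 cuntz_le_trans[OF cuntz_le_conj 2]])
  qed
  ultimately show ?thesis by (rule cuntz_le_limit)
qed

lemma continuous_cut: "continuous_on A (\<lambda>t::real. max (t - e) 0)"
  by (intro continuous_intros)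

text \<open>For \<open>d = norm (a - b)\<close> one has \<open>a - d \<le> b\<close> in the order of
  the cone. Conjugation by a function with square \<open>max (t - e) 0 / (t - d)\<close> for
  \<open>t \<ge> e\<close> turns the left side into the cut-down; strictness \<open>d < e\<close>
  makes this function continuous.\<close>

lemma cuntz_le_cfc_cut:
  assumes a: "psd a" and b: "psd b" and ab: "norm (a - b) < e"
  shows "cuntz_le (cfc (\<lambda>t. max (t - e) 0) a) b"
proof -
  define d where "d = norm (a - b)"
  have d: "0 \<le> d" "d < e" using ab by (auto simp: d_def)
  have "psd (d *\<^sub>R 1 - (a - b))"
    by (rule psd_diff_of_norm_le) (simp_all add: d_def star_diff psd_self_adjoint a b)
  then have dab: "psd (b - (a - d *\<^sub>R 1))" by (simp add: algebra_simps)
  define f where "f = (\<lambda>t. sqrt (max (t - e) 0 / max (t - d) (e - d)))"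
  have fc: "continuous_on {0..} f" unfolding f_def using d by (intro continuous_intros) auto
  define E where "E = cfc f a"
  have Es: "star E = E" unfolding E_def by (rule star_cfc[OF a fc])
  have tc: "continuous_on {0..} (\<lambda>t. t - d)" by (intro continuous_intros)
  have "a - d *\<^sub>R 1 = cfc (\<lambda>t. t - d) a"
    using cfc_diff[OF a continuous_on_id continuous_on_const, of d] by (simp only: cfc_id[OF a] cfc_const[OF a])
  then have "E * (a - d *\<^sub>R 1) * E = cfc (\<lambda>t. f t * (t - d) * f t) a"
    unfolding E_def by (simp only: cfc_conj[OF a fc tc])
  also have "\<dots> = cfc (\<lambda>t. max (t - e) 0) a"
  proof (rule cfc_cong)
    fix t :: real
    have "f t * (t - d) * f t = (f t * f t) * (t - d)" by simp
    also have "f t * f t = max (t - e) 0 / max (t - d) (e - d)" using d by (simp add: f_def)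
    also have "\<dots> * (t - d) = max (t - e) 0" using d by (auto simp: max_def)
    finally show "f t * (t - d) * f t = max (t - e) 0" .
  qed
  finally have cut: "E * (a - d *\<^sub>R 1) * E = cfc (\<lambda>t. max (t - e) 0) a" .
  have "psd (E * (b - (a - d *\<^sub>R 1)) * E)" using psd_conj[OF dab, of E] by (simp only: Es)
  then have "psd (E * b * E - cfc (\<lambda>t. max (t - e) 0) a)"
    unfolding cut[symmetric] conj_diff_distrib .
  moreover have "psd (cfc (\<lambda>t. max (t - e) 0) a)" by (intro psd_cfc a continuous_cut) simp
  ultimately have "cuntz_le (cfc (\<lambda>t. max (t - e) 0) a) (E * b * E)" by (intro cuntz_le_if_psd_diff)
  moreover have "cuntz_le (E * b * E) b" using cuntz_le_conj[of E b] by (simp only: Es)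
  ultimately show ?thesis by (rule cuntz_le_trans)
qed

subsection \<open>Transfer to algebras without unit\<close>

text \<open>The scalar part is multiplicative, so it sees only \<open>f 0\<close>. Functions
  vanishing at \<open>0\<close> therefore stay in the original algebra.\<close>

lemma uscal_cfc:
  fixes a :: "'a::cstar_algebra unitization"
  assumes a: "psd a" "uscal a = 0" and f: "continuous_on {0..} f"
  shows "uscal (cfc f a) = of_real (f 0)"
proof (rule LIMSEQ_unique)
  have "uscal (pev p a) = of_real (poly p 0)" for p by (cases p) (simp add: a(2))
  then show "(\<lambda>n. complex_of_real (poly (poly_approx f n) 0)) \<longlonglongrightarrow> uscal (cfc f a)"
    using bounded_linear.tendsto[OF bounded_linear_uscal cfc_tendsto[OF a(1) f]] by simp
  show "(\<lambda>n. complex_of_real (poly (poly_approx f n) 0)) \<longlonglongrightarrow> of_real (f 0)"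
    by (intro tendsto_of_real poly_approx_0_tendsto f)
qed

lemma psd_uemb_sqrt:
  assumes a: "psd (uemb a)"
  obtains s where "star s = s" "s * s = a"
proof -
  have sq: "continuous_on {0..} sqrt" by (intro continuous_intros)
  define h where "h = cfc sqrt (uemb a)"
  have "uscal h = 0" unfolding h_def using uscal_cfc[OF a _ sq] by simp
  then have h: "uemb (ubase h) = h" by (rule uemb_ubase)
  have "h * h = cfc (\<lambda>t. sqrt t * sqrt t) (uemb a)" unfolding h_def by (rule cfc_mult[OF a sq sq, symmetric])
  also have "\<dots> = cfc (\<lambda>t. t) (uemb a)" by (rule cfc_cong) simp
  also have "\<dots> = uemb a" by (rule cfc_id[OF a])
  finally have "uemb (ubase h * ubase h) = uemb a" by (simp add: uemb_simps h)
  moreover have "uemb (star (ubase h)) = uemb (ubase h)" using star_cfc[OF a sq] by (simp add: uemb_simps h) (simp add: h_def)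
  ultimately show thesis using that unfolding uemb_eq_iff by blast
qed

lemma psd_uemb: "psd (uemb a) \<longleftrightarrow> positive a"
proof
  assume "psd (uemb a)"
  then obtain s where "star s = s" "s * s = a" by (rule psd_uemb_sqrt)
  then show "positive a" unfolding positive_def by metis
next
  assume "positive a"
  then obtain x where "a = star x * x" by (auto simp: positive_def)
  then show "psd (uemb a)" by (simp add: uemb_simps psd_star_mult)
qed

lemma positive_psdD: "positive a \<Longrightarrow> psd (uemb a)" by (simp add: psd_uemb)

lemma positive_star_mult: "positive (star x * x)" by (auto simp: positive_def)

lemma positive_mult_star: "positive (x * star x)"
  using positive_star_mult[of "star x"] by (simp add: star_star)

lemma positive_star: "positive a \<Longrightarrow> star a = a"
  by (auto simp: positive_def star_mult star_star)

lemma positive_zero: "positive 0"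
  using positive_star_mult[of 0] by simp

lemma positive_add: "positive a \<Longrightarrow> positive b \<Longrightarrow> positive (a + b)"
  by (simp add: psd_uemb[symmetric] uemb_simps psd_add)

lemma positive_conj: "positive a \<Longrightarrow> positive (star x * a * x)"
  by (simp add: psd_uemb[symmetric] uemb_simps psd_conj)

lemma positive_limit: "(\<And>n. positive (X n)) \<Longrightarrow> X \<longlonglongrightarrow> l \<Longrightarrow> positive l"
  unfolding psd_uemb[symmetric] by (rule psd_limit[OF _ iffD2[OF tendsto_uemb_iff]])

lemma positive_sqrt:
  assumes "positive a"
  obtains s where "star s = s" "s * s = a"
  using psd_uemb_sqrt[OF positive_psdD[OF assms]] by blast

text \<open>The substitute for a unit: it provides the witnesses for reflexivity of
  \<open>cuntz_le\<close>, and it presents an arbitrary element as a limit of products.\<close>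

lemma approx_unit_right:
  fixes y :: "'a::cstar_algebra"
  obtains u where "(\<lambda>n. y * u n) \<longlonglongrightarrow> y"
proof -
  define A where "A = star (uemb y) * uemb y"
  have A: "psd A" by (simp add: A_def psd_star_mult)
  define u where "u n = ubase (approx_unit n A)" for n
  have "uscal (approx_unit n A) = 0" for n
    unfolding approx_unit_def using uscal_cfc[OF A _ cont_approx_unit] by (simp add: A_def)
  then have "uemb (y * u n) = uemb y * approx_unit n A" for n by (simp add: uemb_simps u_def uemb_ubase)
  moreover have "(\<lambda>n. uemb y * approx_unit n A) \<longlonglongrightarrow> uemb y"
    by (rule approx_unit_mult_tendsto[OF A]) (simp add: A_def psd_zero)
  ultimately have "(\<lambda>n. uemb (y * u n)) \<longlonglongrightarrow> uemb y" by simp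
  then have "(\<lambda>n. y * u n) \<longlonglongrightarrow> y" by (simp only: tendsto_uemb_iff)
  then show thesis by (rule that)
qed

lemma cuntz_le_refl:
  assumes "positive a"
  shows "cuntz_le a a"
proof -
  obtain s where s: "star s = s" "s * s = a" by (rule positive_sqrt[OF assms])
  obtain u where u: "(\<lambda>n. s * u n) \<longlonglongrightarrow> s" by (rule approx_unit_right)
  have "(\<lambda>n. star (s * u n) * (s * u n)) \<longlonglongrightarrow> a"
    using tendsto_mult[OF tendsto_star[OF u] u] by (simp only: s)
  moreover have "star (s * u n) * (s * u n) = star (u n) * a * u n" for n
    by (simp add: star_mult s(1) mult.assoc flip: s(2))
  ultimately show ?thesis unfolding cuntz_le_def by auto
qed

lemma cuntz_le_uemb:
  assumes "positive a"
  shows "cuntz_le (uemb a) (uemb b) \<longleftrightarrow> cuntz_le a b"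
proof
  assume "cuntz_le a b"
  then obtain x :: "nat \<Rightarrow> 'a" where x: "(\<lambda>n. star (x n) * b * x n) \<longlonglongrightarrow> a" by (auto simp: cuntz_le_def)
  then have "(\<lambda>n. star (uemb (x n)) * uemb b * uemb (x n)) \<longlonglongrightarrow> uemb a"
    unfolding uemb_simps(5,7)[symmetric] tendsto_uemb_iff .
  then show "cuntz_le (uemb a) (uemb b)" unfolding cuntz_le_def by (rule exI[where x="\<lambda>n. uemb (x n)"])
next
  assume ab: "cuntz_le (uemb a) (uemb b)"
  show "cuntz_le a b"
  proof (rule cuntz_le_closed)
    fix e :: real assume "0 < e"
    then obtain u where u: "norm (star u * a * u - a) < e" using cuntz_le_approx[OF cuntz_le_refl[OF assms]] by blast
    obtain x where x: "(\<lambda>n. star (x n) * uemb b * x n) \<longlonglongrightarrow> uemb a" using ab by (auto simp: cuntz_le_def)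
    \<comment> \<open>The algebra is an ideal of its unitization, so multiplying by \<open>u\<close>
      turns a witness from the unitization into one from the algebra.\<close>
    define y where "y n = ubase (x n * uemb u)" for n
    have y: "uemb (y n) = x n * uemb u" for n unfolding y_def by (rule uemb_ubase) simp
    have "(\<lambda>n. star (uemb u) * (star (x n) * uemb b * x n) * uemb u) \<longlonglongrightarrow> star (uemb u) * uemb a * uemb u"
      by (intro tendsto_intros x)
    then have "(\<lambda>n. uemb (star (y n) * b * y n)) \<longlonglongrightarrow> uemb (star u * a * u)"
      by (simp add: uemb_simps y star_mult mult.assoc)
    then have "(\<lambda>n. star (y n) * b * y n) \<longlonglongrightarrow> star u * a * u" by (simp only: tendsto_uemb_iff)
    then have "cuntz_le (star u * a * u) b" unfolding cuntz_le_def by blast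
    with u show "\<exists>c. norm (c - a) < e \<and> cuntz_le c b" by blast
  qed
qed

lemma cuntz_le_star_mult: "cuntz_le (star w * w) (w * star w)"
  using cuntz_le_star_mult_unital[of "uemb w"]
  unfolding uemb_simps(5,7)[symmetric] cuntz_le_uemb[OF positive_star_mult] .

lemma cuntz_le_mult_star: "cuntz_le (w * star w) (star w * w)"
  using cuntz_le_star_mult[of "star w"] by (simp add: star_star)

lemma cuntz_le_if_positive_diff: 
  assumes "positive x" "positive (y - x)"
  shows "cuntz_le x y"
  using cuntz_le_if_psd_diff[of "uemb x" "uemb y"] assms
  by (simp add: cuntz_le_uemb psd_uemb flip: uemb_simps)

lemma cuntz_le_zero: "cuntz_le 0 a"
  using cuntz_le_conj[of 0 a] by simp

subsection \<open>Cutting down positive elements\<close>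

text \<open>The element written \<open>(a - e)\<^sub>+\<close>. For \<open>0 \<le> e\<close> the
  function vanishes at \<open>0\<close>, so \<open>ubase\<close> discards no scalar part.\<close>

definition cut :: "real \<Rightarrow> 'a::cstar_algebra \<Rightarrow> 'a"
  where "cut e a = ubase (cfc (\<lambda>t. max (t - e) 0) (uemb a))"

lemma uemb_cut:
  assumes "positive a" "0 \<le> e"
  shows "uemb (cut e a) = cfc (\<lambda>t. max (t - e) 0) (uemb a)"
  unfolding cut_def
  by (rule uemb_ubase) (use assms in \<open>simp add: uscal_cfc[OF positive_psdD _ continuous_cut]\<close>)

lemma positive_cut: "positive a \<Longrightarrow> 0 \<le> e \<Longrightarrow> positive (cut e a)"
  by (simp add: psd_uemb[symmetric] uemb_cut psd_cfc continuous_cut)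

lemma cut_cut:
  assumes "positive a" "0 \<le> e" "0 \<le> d"
  shows "cut d (cut e a) = cut (d + e) a"
proof -
  have a: "psd (uemb a)" using assms by (simp add: psd_uemb)
  have "uemb (cut d (cut e a)) = cfc (\<lambda>t. max (max (t - e) 0 - d) 0) (uemb a)"
    using assms by (simp add: uemb_cut positive_cut cfc_compose[OF a continuous_cut _ continuous_cut])
  also have "\<dots> = cfc (\<lambda>t. max (t - (d + e)) 0) (uemb a)" by (rule cfc_cong) (use assms in auto)
  also have "\<dots> = uemb (cut (d + e) a)" using assms by (simp add: uemb_cut)
  finally show ?thesis by (simp add: uemb_eq_iff)
qed

lemma norm_cut_diff_le:
  assumes "positive a" "0 \<le> e"
  shows "norm (cut e a - a) \<le> e"
proof -
  have a: "psd (uemb a)" using assms by (simp add: psd_uemb)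
  have "norm (cfc (\<lambda>t. max (t - e) 0) (uemb a) - cfc (\<lambda>t. t) (uemb a)) \<le> e"
    by (rule norm_cfc_diff_le[OF a]) (use assms in \<open>auto intro!: continuous_intros\<close>)
  then show ?thesis using assms by (simp add: cfc_id[OF a] uemb_cut[symmetric] norm_uemb flip: uemb_simps)
qed

lemma positive_diff_cut: 
  assumes "positive a" "0 \<le> e"
  shows "positive (a - cut e a)"
proof -
  have a: "psd (uemb a)" using assms by (simp add: psd_uemb)
  have "uemb (a - cut e a) = cfc (\<lambda>t. t - max (t - e) 0) (uemb a)"
    using assms by (simp add: uemb_simps uemb_cut cfc_diff[OF a continuous_on_id continuous_cut] cfc_id[OF a])
  moreover have "psd \<dots>" by (rule psd_cfc[OF a]) (use assms in \<open>auto intro!: continuous_intros\<close>)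
  ultimately show ?thesis by (simp add: psd_uemb[symmetric])
qed

lemma cuntz_le_cut_self: "positive a \<Longrightarrow> 0 \<le> e \<Longrightarrow> cuntz_le (cut e a) a"
  by (intro cuntz_le_if_positive_diff positive_cut positive_diff_cut)

lemma cuntz_le_cut_mono:
  assumes "positive a" "0 \<le> e" "e \<le> d"
  shows "cuntz_le (cut d a) (cut e a)"
  using cuntz_le_cut_self[of "cut e a" "d - e"] assms by (simp add: cut_cut positive_cut)

lemma cuntz_le_cut:
  assumes "positive a" "positive b" "norm (a - b) < e"
  shows "cuntz_le (cut e a) b"
proof -
  have e: "0 \<le> e" using assms(3) norm_ge_zero[of "a - b"] by linarith
  have "cuntz_le (cfc (\<lambda>t. max (t - e) 0) (uemb a)) (uemb b)"
    by (rule cuntz_le_cfc_cut) (use assms in \<open>simp_all add: psd_uemb norm_uemb flip: uemb_simps\<close>)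
  then show ?thesis using assms e by (simp add: uemb_cut[symmetric] cuntz_le_uemb positive_cut)
qed

text \<open>Cutting \<open>b\<close> moves it by at most \<open>d\<close>, so the gap
  \<open>e - d\<close> has to pay only for the distance of \<open>a\<close> and \<open>b\<close>.
  The levels in all later approximations are chosen by this rule.\<close>

lemma cuntz_le_cut_cut:
  assumes "positive a" "positive b" "0 \<le> d" "norm (a - b) < e - d"
  shows "cuntz_le (cut e a) (cut d b)"
proof (rule cuntz_le_cut)
  have "a - cut d b = (a - b) - (cut d b - b)" by simp
  then have "norm (a - cut d b) \<le> norm (a - b) + norm (cut d b - b)" by (metis norm_triangle_ineq4)
  then show "norm (a - cut d b) < e" using assms norm_cut_diff_le[of b d] by linarith
qed (use assms positive_cut in auto)

lemma cuntz_le_if_cuts: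
  assumes "positive a" "\<And>e. 0 < e \<Longrightarrow> cuntz_le (cut e a) b"
  shows "cuntz_le a b"
proof (rule cuntz_le_closed)
  fix e :: real assume e: "0 < e"
  show "\<exists>c. norm (c - a) < e \<and> cuntz_le c b"
    using norm_cut_diff_le[OF assms(1), of "e / 2"] assms(2)[of "e / 2"] e by (intro exI[of _ "cut (e / 2) a"]) auto
qed

lemma cuntz_le_if_le_scaleR:
  assumes "positive x" "positive y" "positive (r *\<^sub>R y - x)" "0 \<le> r"
  shows "cuntz_le x y"
  using cuntz_le_trans[OF cuntz_le_if_positive_diff[OF assms(1,3)] cuntz_le_scaleR[OF cuntz_le_refl[OF assms(2)] assms(4)]] .

lemma pev_mult_star_intertwine: "pev p (w * star w) * w = w * pev p (star w * w)"
  by (induction p) (simp_all add: algebra_simps mult.assoc)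

lemma cfc_mult_star_intertwine:
  fixes w :: "'a::unital_cstar_algebra"
  assumes f: "continuous_on {0..} f"
  shows "cfc f (w * star w) * w = w * cfc f (star w * w)"
proof (rule LIMSEQ_unique)
  have ww: "psd (w * star w)" using psd_star_mult[of "star w"] by (simp add: star_star)
  show "(\<lambda>n. pev (poly_approx f n) (w * star w) * w) \<longlonglongrightarrow> cfc f (w * star w) * w"
    by (intro tendsto_intros cfc_tendsto ww f)
  show "(\<lambda>n. pev (poly_approx f n) (w * star w) * w) \<longlonglongrightarrow> w * cfc f (star w * w)"
    unfolding pev_mult_star_intertwine by (intro tendsto_intros cfc_tendsto psd_star_mult f)
qed

lemma cut_factorization:
  fixes t e :: real
  assumes "0 < e" "0 \<le> t"
  defines "k \<equiv> \<lambda>t. sqrt (max (t - e) 0 / max t e)"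
  shows "k t * t * k t = max (t - e) 0"
proof -
  have "k t * t * k t = (k t * k t) * t" by simp
  also have "k t * k t = max (t - e) 0 / max t e" using assms by (simp add: k_def)
  also have "\<dots> * t = max (t - e) 0" using assms by (auto simp: max_def)
  finally show ?thesis .
qed

text \<open>If \<open>k * t * k\<close> is the cut-down function, then
  \<open>v = W * k (star W * W) = k (W * star W) * W\<close> has the two cut-downs as
  \<open>star v * v\<close> and \<open>v * star v\<close>.\<close>

lemma cuntz_le_cut_star_mult:
  assumes e: "0 < e"
  shows "cuntz_le (cut e (star w * w)) (cut e (w * star w))"
proof -
  define W where "W = uemb w"
  have a: "psd (star W * W)" by (rule psd_star_mult)
  have b: "psd (W * star W)" using psd_star_mult[of "star W"] by (simp add: star_star)
  define k where "k = (\<lambda>t. sqrt (max (t - e) 0 / max t e))"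
  have kc: "continuous_on {0..} k" unfolding k_def using e by (auto intro!: continuous_intros)
  have cut: "cfc (\<lambda>t. max (t - e) 0) c = cfc k c * c * cfc k c" if "psd c" for c :: "'a unitization"
    unfolding cfc_conj_id[OF that kc] by (rule cfc_cong) (simp add: k_def cut_factorization[OF e])
  define v where "v = W * cfc k (star W * W)"
  have v: "v = cfc k (W * star W) * W" unfolding v_def by (rule cfc_mult_star_intertwine[OF kc, symmetric])
  have 1: "star v * v = cfc (\<lambda>t. max (t - e) 0) (star W * W)"
    unfolding cut[OF a] by (simp add: v_def star_mult star_cfc[OF a kc] mult.assoc)
  have 2: "v * star v = cfc (\<lambda>t. max (t - e) 0) (W * star W)"
    unfolding cut[OF b] by (simp add: v star_mult star_cfc[OF b kc] mult.assoc)
  have 3: "star W * W = uemb (star w * w)" "W * star W = uemb (w * star w)" by (simp_all add: W_def uemb_simps)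
  show ?thesis
    using cuntz_le_star_mult_unital[of v] e unfolding 1 2 3
    by (simp add: uemb_cut[symmetric] positive_star_mult positive_mult_star cuntz_le_uemb positive_cut)
qed

lemma cut_add_orthogonal:
  assumes "positive a" "positive b" "a * b = 0" "0 \<le> e"
  shows "cut e (a + b) = cut e a + cut e b"
proof -
  have "uemb a * uemb b = 0" using assms(3) by (simp flip: uemb_simps)
  then have "uemb (cut e (a + b)) = uemb (cut e a + cut e b)"
    using assms by (simp add: uemb_cut positive_add uemb_simps cfc_add_orthogonal psd_uemb continuous_cut)
  then show ?thesis by (simp add: uemb_eq_iff)
qed

lemma cut_hom:
  fixes \<phi> :: "'a::cstar_algebra \<Rightarrow> 'b::cstar_algebra"
  assumes bl: "bounded_linear \<phi>" and \<phi>: "\<And>c x. \<phi> (c *\<^sub>C x) = c *\<^sub>C \<phi> x" "\<And>x y. \<phi> (x * y) = \<phi> x * \<phi> y"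
    "\<And>x. \<phi> (star x) = star (\<phi> x)"
    and a: "positive a" and e: "0 \<le> e"
  shows "cut e (\<phi> a) = \<phi> (cut e a)"
proof -
  interpret bounded_linear \<phi> by (rule bl)
  \<comment> \<open>The calculus lives in the unitization, so \<open>\<phi>\<close> is extended to a
    unital homomorphism of unitizations.\<close>
  define \<pi> where "\<pi> x = Unitization (\<phi> (ubase x)) (uscal x)" for x
  have [simp]: "ubase (\<pi> x) = \<phi> (ubase x)" "uscal (\<pi> x) = uscal x" for x by (simp_all add: \<pi>_def)
  have \<pi>u: "\<pi> (uemb x) = uemb (\<phi> x)" for x by (simp add: \<pi>_def uemb_def)
  obtain K where K: "0 \<le> K" "\<And>x. norm (\<phi> x) \<le> norm x * K" using nonneg_bounded by blast
  have "bounded_linear \<pi>"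
  proof (rule bounded_linear_intro)
    fix x y and r :: real
    show "\<pi> (x + y) = \<pi> x + \<pi> y" "\<pi> (r *\<^sub>R x) = r *\<^sub>R \<pi> x" by (auto intro!: unitization_eqI simp: add scale)
    have "norm (\<pi> x) \<le> norm (\<phi> (ubase x)) + cmod (uscal x)" using norm_unitization_le[of "\<pi> x"] by simp
    also have "\<dots> \<le> norm (ubase x) * K + norm x" by (intro add_mono K norm_uscal_le_norm)
    also have "\<dots> \<le> (2 * norm x) * K + norm x" by (intro add_mono mult_right_mono norm_ubase_le_norm K) simp
    finally show "norm (\<pi> x) \<le> norm x * (2 * K + 1)" by (simp add: algebra_simps)
  qed
  then have "\<pi> (cfc (\<lambda>t. max (t - e) 0) (uemb a)) = cfc (\<lambda>t. max (t - e) 0) (\<pi> (uemb a))"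
    by (rule cfc_hom[rotated 2]) (auto intro!: unitization_eqI simp: zero \<phi> add psd_uemb a continuous_cut)
  then show ?thesis unfolding \<pi>u unfolding cut_def by (metis \<open>\<And>x. ubase (\<pi> x) = \<phi> (ubase x)\<close>)
qed

subsection \<open>Complements and decompositions\<close>

lemma psd_scale_conj:
  fixes x a :: "'a::unital_cstar_algebra"
  assumes "star a = a"
  shows "psd (norm a *\<^sub>R (star x * x) - star x * a * x)"
proof -
  have "psd (norm a *\<^sub>R 1 - a)" by (rule psd_diff_of_norm_le[OF assms order_refl])
  from psd_conj[OF this, of x] show ?thesis by (simp add: right_diff_distrib left_diff_distrib)
qed

text \<open>A parallelogram identity. For \<open>u = 1\<close> and \<open>v = G\<close> it bounds
  \<open>b\<close> by twice the sum of its two compressions, although \<open>G\<close> need not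
  commute with \<open>b\<close>.\<close>

lemma conj_diff_add_self:
  fixes u v x :: "'a::ring"
  shows "(u - (v + v)) * x * (u - (v + v)) =
    ((u - v) * x * (u - v) + v * x * v) + ((u - v) * x * (u - v) + v * x * v) - u * x * u"
  by (simp add: algebra_simps)

text \<open>If \<open>a\<close> is approximately \<open>z\<^sup>*bz\<close> then \<open>x = sqrt b z\<close> moves it to \<open>xx\<^sup>*\<close> in the hereditary subalgebra of \<open>b\<close>;
  there one cuts \<open>b\<close> by a function \<open>G\<close> of \<open>xx\<^sup>*\<close> and its complement \<open>1 - G\<close>.\<close>

lemma cuntz_le_complement:
  fixes a b :: "'a::cstar_algebra"
  assumes a: "positive a" and b: "positive b" and ab: "cuntz_le a b" and e: "0 < e"
  obtains p c d where "positive p" "positive c" "positive d" "p * c = 0" "cuntz_le (p + c) b"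
    "cuntz_le (cut (3 * e) a) p" "cuntz_le b (c + d)" "cuntz_le d a"
proof -
  obtain z where z: "norm (star z * b * z - a) < e" using cuntz_le_approx[OF ab e] by blast
  obtain s where s: "star s = s" "s * s = b" by (rule positive_sqrt[OF b])
  define x where "x = s * z"
  have xx: "star x * x = star z * b * z" by (simp add: x_def star_mult s(1) mult.assoc flip: s(2))
  define A where "A = uemb (x * star x)"
  have pA: "psd A" by (simp add: A_def psd_uemb positive_mult_star)
  define B where "B = uemb b"
  have pB: "psd B" using b by (simp add: B_def psd_uemb)
  define S where "S = uemb s"
  have S: "star S = S" "S * S = B" by (simp_all add: S_def B_def s flip: uemb_simps)
  define Z where "Z = uemb (z * star z)"
  have Zs: "star Z = Z" by (simp add: Z_def positive_star positive_mult_star flip: uemb_simps)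
  have AS: "A = S * Z * S" by (simp add: A_def S_def Z_def x_def star_mult s(1) uemb_simps mult.assoc)
  \<comment> \<open>A ramp from \<open>0\<close> at \<open>e\<close> to \<open>1\<close> at
    \<open>2 * e\<close>. Since \<open>1 - f\<close> vanishes from \<open>2 * e\<close> on,
    \<open>p\<close> and \<open>c\<close> are orthogonal; since \<open>f\<close> vanishes up to
    \<open>e\<close>, it is divisible by \<open>t\<close> and its square is controlled by the cut at
    \<open>e\<close>.\<close>
  define f where "f = (\<lambda>t. max (t - e) 0 / max (max (t - e) 0) e)"
  have fc: "continuous_on {0..} f" unfolding f_def using e by (auto intro!: continuous_intros)
  have f1c: "continuous_on {0..} (\<lambda>t. 1 - f t)" by (intro continuous_intros fc)
  define \<kappa> where "\<kappa> = (\<lambda>t. f t / max t e)"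
  have \<kappa>c: "continuous_on {0..} \<kappa>" unfolding \<kappa>_def using e by (intro continuous_intros fc) auto
  have cutc: "continuous_on {0..} (\<lambda>t. max (t - r) 0)" for r :: real by (rule continuous_cut)
  define G where "G = cfc f A"
  have G: "star G = G" unfolding G_def by (rule star_cfc[OF pA fc])
  have G1: "1 - G = cfc (\<lambda>t. 1 - f t) A"
    using cfc_diff[OF pA continuous_on_const fc, of 1] by (simp add: G_def cfc_const[OF pA])
  have G1s: "star (1 - G) = 1 - G" by (simp add: star_diff star_one G)
  define K where "K = cfc \<kappa> A"
  have Ks: "star K = K" unfolding K_def by (rule star_cfc[OF pA \<kappa>c])
  have GK: "G = A * K"
  proof -
    have "A * K = cfc (\<lambda>t. t * \<kappa> t) A"
      unfolding K_def using cfc_mult[OF pA continuous_on_id \<kappa>c] by (simp only: cfc_id[OF pA])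
    also have "\<dots> = G" unfolding G_def
      by (rule cfc_cong) (use e in \<open>auto simp: \<kappa>_def f_def max_def\<close>)
    finally show ?thesis by simp
  qed
  have GK': "G = K * A"
    using cfc_commute[OF pA \<kappa>c, of A] by (simp add: GK K_def)
  define p where "p = cut (2 * e) (x * star x)"
  define C where "C = (1 - G) * B * (1 - G)"
  define D where "D = G * B * G"
  have "uscal C = 0" "uscal D = 0" by (simp_all add: C_def D_def B_def)
  then obtain c d where c: "uemb c = C" and d: "uemb d = D" by (metis uemb_ubase)
  have P: "uemb p = cfc (\<lambda>t. max (t - 2 * e) 0) A" using e by (simp add: p_def A_def uemb_cut positive_mult_star)
  have pp: "positive p" using e by (simp add: p_def positive_cut positive_mult_star)
  have "psd C" using psd_conj[OF pB, of "1 - G"] by (simp add: C_def G1s)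
  then have cp: "positive c" by (simp add: c psd_uemb[symmetric])
  have "psd D" using psd_conj[OF pB, of G] by (simp add: D_def G)
  then have dp: "positive d" by (simp add: d psd_uemb[symmetric])
  have "uemb p * (1 - G) = cfc (\<lambda>t. max (t - 2 * e) 0 * (1 - f t)) A"
    unfolding P G1 by (rule cfc_mult[OF pA cutc f1c, symmetric])
  also have "\<dots> = cfc (\<lambda>t. 0) A"
    by (rule cfc_cong) (use e in \<open>auto simp: f_def max_def\<close>)
  also have "\<dots> = 0" using cfc_const[OF pA, of 0] by simp
  finally have "uemb p * C = 0" by (simp add: C_def mult.assoc[symmetric])
  then have "uemb (p * c) = uemb 0" by (simp add: uemb_simps c)
  then have pc: "p * c = 0" by (simp only: uemb_eq_iff)
  have "cuntz_le (p + c) b"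
  proof -
    \<comment> \<open>Because \<open>G = A * K\<close> and \<open>A = S * Z * S\<close>, a factor
      \<open>S\<close> can be pulled out of \<open>(1 - G) * S\<close> to the left. This places
      \<open>C\<close> below a multiple of \<open>B\<close>, as needed for
      \<open>p + c\<close>.\<close>
    define m where "m = 1 - Z * S * K * S"
    have "(1 - G) * S = S * m" by (simp add: GK AS m_def algebra_simps mult.assoc)
    moreover have "C = ((1 - G) * S) * star ((1 - G) * S)" by (simp add: C_def star_mult G1s S mult.assoc flip: S(2))
    ultimately have CS: "C = star S * (m * star m) * S" by (simp add: star_mult S mult.assoc)
    define r where "r = norm (m * star m) + norm Z"
    have "psd (norm (m * star m) *\<^sub>R (star S * S) - star S * (m * star m) * S)"
      by (rule psd_scale_conj) (simp add: star_mult star_star)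
    then have 1: "psd (norm (m * star m) *\<^sub>R B - C)" by (simp add: CS S)
    have 2: "psd (norm Z *\<^sub>R B - A)" using psd_scale_conj[OF Zs, of S] by (simp add: S AS)
    have 3: "psd (A - uemb p)"
      using positive_diff_cut[OF positive_mult_star[of x], of "2 * e"] e
      by (simp add: A_def p_def psd_uemb flip: uemb_simps)
    have "psd ((norm (m * star m) *\<^sub>R B - C) + ((norm Z *\<^sub>R B - A) + (A - uemb p)))"
      by (intro psd_add 1 2 3)
    then have "psd (uemb (r *\<^sub>R b - (p + c)))" by (simp add: uemb_simps c r_def B_def scaleR_add_left algebra_simps)
    then show ?thesis
      by (intro cuntz_le_if_le_scaleR[of _ _ r] positive_add pp cp b) (auto simp: psd_uemb r_def)
  qed
  moreover have "cuntz_le (cut (3 * e) a) p"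
  proof (rule cuntz_le_trans)
    \<comment> \<open>The distance below \<open>e\<close> between \<open>a\<close> and
      \<open>star x * x\<close> costs one level: \<open>p\<close> is cut at \<open>2 * e\<close>, so
      \<open>a\<close> must be cut at \<open>3 * e\<close>.\<close>
    show "cuntz_le (cut (3 * e) a) (cut (2 * e) (star x * x))"
      using z e by (intro cuntz_le_cut_cut a positive_star_mult) (auto simp: xx norm_minus_commute)
    show "cuntz_le (cut (2 * e) (star x * x)) p" unfolding p_def using e by (intro cuntz_le_cut_star_mult) simp
  qed
  moreover have "cuntz_le b (c + d)"
  proof (rule cuntz_le_if_le_scaleR[of _ _ 2])
    define u where "u = 1 - (G + G)"
    have us: "star u = u" by (simp add: u_def star_diff star_one star_add G del: mult_2)
    have "psd (star u * B * u)" by (rule psd_conj[OF pB])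
    also have "star u * B * u = (C + D) + (C + D) - B"
      unfolding us unfolding u_def C_def D_def conj_diff_add_self by (simp only: mult_1_left mult_1_right)
    also have "(C + D) + (C + D) = 2 *\<^sub>R (C + D)" by (rule scaleR_2[symmetric])
    finally show "positive (2 *\<^sub>R (c + d) - b)" by (simp add: psd_uemb[symmetric] uemb_simps c d B_def)
  qed (use b cp dp positive_add in auto)
  moreover have "cuntz_le d a"
  proof -
    define q where "q = cut e (x * star x)"
    have qp: "positive q" using e by (simp add: q_def positive_cut positive_mult_star)
    have Q: "uemb q = cfc (\<lambda>t. max (t - e) 0) A" using e by (simp add: q_def A_def uemb_cut positive_mult_star)
    \<comment> \<open>Chosen so that \<open>k * max (t - e) 0 * k\<close> is the square of
      \<open>f\<close>. Thus \<open>G * G\<close>, which dominates \<open>D\<close> up to the factor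
      \<open>norm B\<close>, is a conjugate of \<open>q\<close>.\<close>
    define k where "k = (\<lambda>t. sqrt (max (t - e) 0) / max (max (t - e) 0) e)"
    have kc: "continuous_on {0..} k" unfolding k_def using e by (auto intro!: continuous_intros)
    have "cfc k A * uemb q * cfc k A = cfc (\<lambda>t. k t * max (t - e) 0 * k t) A" unfolding Q by (rule cfc_conj[OF pA kc cutc])
    also have "\<dots> = cfc (\<lambda>t. f t * f t) A"
      by (rule cfc_cong) (simp add: k_def f_def)
    also have "\<dots> = G * G" unfolding G_def by (rule cfc_mult[OF pA fc fc])
    finally have GG: "G * G = star (cfc k A) * uemb q * cfc k A" by (simp add: star_cfc[OF pA kc])
    have 1: "psd (norm B *\<^sub>R (G * G) - D)"
      using psd_scale_conj[OF psd_self_adjoint[OF pB], of G] by (simp add: G D_def)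
    have "cuntz_le D (norm B *\<^sub>R (G * G))" by (rule cuntz_le_if_psd_diff[OF \<open>psd D\<close> 1])
    moreover have "cuntz_le (norm B *\<^sub>R (G * G)) (uemb q)"
      unfolding GG by (intro cuntz_le_scaleR cuntz_le_conj) simp
    ultimately have "cuntz_le (uemb d) (uemb q)" unfolding d by (rule cuntz_le_trans)
    then have dq: "cuntz_le d q" by (simp add: cuntz_le_uemb dp)
    have "cuntz_le q (cut e (star x * x))"
      using cuntz_le_cut_star_mult[OF e, of "star x"] by (simp add: q_def star_star)
    moreover have "cuntz_le (cut e (star x * x)) a"
      using z by (intro cuntz_le_cut a positive_star_mult) (simp add: xx)
    ultimately show ?thesis using dq cuntz_le_trans by blast
  qed
  ultimately show thesis using that pp cp dp pc by blast
qed

text \<open>The approximant \<open>w\<close> of \<open>a\<close> is a sum of conjugates of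
  \<open>b\<close> and \<open>c\<close>. A further conjugation by \<open>g\<close> with
  \<open>g * w * g = cut e w\<close> keeps this splitting, and both summands lie below
  \<open>cut e w\<close>, hence Cuntz below \<open>a\<close>.\<close>

lemma cuntz_le_add_decompose:
  fixes a b c :: "'a::cstar_algebra"
  assumes a: "positive a" and b: "positive b" and c: "positive c" and abc: "cuntz_le a (b + c)" and e: "0 < e"
  obtains b' c' where "positive b'" "positive c'" "cuntz_le (cut (2 * e) a) (b' + c')"
    "cuntz_le b' b" "cuntz_le b' a" "cuntz_le c' c" "cuntz_le c' a"
proof -
  obtain z where z: "norm (star z * (b + c) * z - a) < e" using cuntz_le_approx[OF abc e] by blast
  define w where "w = star z * (b + c) * z"
  have w: "positive w" unfolding w_def by (intro positive_conj positive_add b c)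
  have W: "psd (uemb w)" using w by (simp add: psd_uemb)
  define f where "f = (\<lambda>t. sqrt (max (t - e) 0 / max t e))"
  have fc: "continuous_on {0..} f" unfolding f_def using e by (auto intro!: continuous_intros)
  have "uscal (cfc f (uemb w)) = 0" using uscal_cfc[OF W _ fc] e by (simp add: f_def)
  then obtain g where g: "uemb g = cfc f (uemb w)" by (metis uemb_ubase)
  have "uemb (star g) = uemb g" using star_cfc[OF W fc] by (simp add: uemb_simps g)
  then have gs: "star g = g" by (simp add: uemb_eq_iff)
  have "uemb (g * w * g) = cfc (\<lambda>t. max (t - e) 0) (uemb w)"
    unfolding uemb_simps g cfc_conj_id[OF W fc] by (rule cfc_cong) (simp add: f_def cut_factorization[OF e])
  also have "\<dots> = uemb (cut e w)" using w e by (simp add: uemb_cut)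
  finally have gw: "g * w * g = cut e w" by (simp only: uemb_eq_iff)
  define b' where "b' = star (z * g) * b * (z * g)"
  define c' where "c' = star (z * g) * c * (z * g)"
  have bc: "b' + c' = cut e w" unfolding gw[symmetric] by (simp add: b'_def c'_def w_def star_mult gs algebra_simps)
  have b': "positive b'" "positive c'" unfolding b'_def c'_def by (intro positive_conj b c)+
  have wa: "cuntz_le (cut e w) a" using z by (intro cuntz_le_cut w a) (simp add: w_def)
  show thesis
  proof (rule that[OF b'])
    show "cuntz_le (cut (2 * e) a) (b' + c')" unfolding bc
      using z e by (intro cuntz_le_cut_cut w a) (auto simp: w_def norm_minus_commute)
    have "cuntz_le b' (b' + c')" "cuntz_le c' (b' + c')" by (rule cuntz_le_if_positive_diff; simp add: b')+
    then show "cuntz_le b' a" "cuntz_le c' a" unfolding bc using wa cuntz_le_trans by blast+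
  qed (simp_all add: b'_def c'_def cuntz_le_conj)
qed

section \<open>Isometries with orthogonal ranges on a stabilization\<close>

lemma strict_mono_prod_encode: "strict_mono (\<lambda>m. prod_encode (k, m))"
  by (rule strict_monoI_Suc) (simp add: prod_encode_def)

text \<open>The isometry \<open>V\<^sub>k\<close> sends the basis vector with index \<open>m\<close>
  to that with index \<open>prod_encode (k, m)\<close>, so different \<open>k\<close> have
  orthogonal ranges.\<close>

lift_definition ell2_shift :: "nat \<Rightarrow> ell2 \<Rightarrow> ell2"
  is "\<lambda>k x n. if fst (prod_decode n) = k then x (snd (prod_decode n)) else 0"
proof -
  fix k and x :: "nat \<Rightarrow> complex"
  let ?y = "\<lambda>n. if fst (prod_decode n) = k then x (snd (prod_decode n)) else 0"
  assume "summable (\<lambda>n. (cmod (x n))\<^sup>2)"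
  moreover have "summable (\<lambda>n. (cmod (?y (prod_encode (k, n))))\<^sup>2) \<longleftrightarrow> summable (\<lambda>n. (cmod (?y n))\<^sup>2)"
    by (rule summable_mono_reindex[OF strict_mono_prod_encode])
      (auto simp: image_iff, metis prod.collapse prod_decode_inverse)
  ultimately show "summable (\<lambda>n. (cmod (?y n))\<^sup>2)" by simp
qed

lemma ell2_shift_linear:
  "ell2_shift k (x + y) = ell2_shift k x + ell2_shift k y"
  "ell2_shift k (r *\<^sub>R x) = r *\<^sub>R ell2_shift k x"
  "ell2_shift k (c *\<^sub>C x) = c *\<^sub>C ell2_shift k x"
  by (transfer; auto)+

lemma ell2_shift_inner: "ell2_shift k x \<bullet> ell2_shift l y = (if k = l then x \<bullet> y else 0)"
proof (cases "k = l")
  case True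
  have "(\<Sum>n. coord (ell2_shift k x) (prod_encode (k, n)) \<bullet> coord (ell2_shift k y) (prod_encode (k, n))) =
      (\<Sum>n. coord (ell2_shift k x) n \<bullet> coord (ell2_shift k y) n)"
    by (rule suminf_mono_reindex[OF strict_mono_prod_encode])
      (auto simp: image_iff ell2_shift.rep_eq, metis prod.collapse prod_decode_inverse)
  then show ?thesis using True by (simp add: inner_ell2_def ell2_shift.rep_eq)
next
  case False
  then have "coord (ell2_shift k x) n \<bullet> coord (ell2_shift l y) n = 0" for n
    by (simp add: ell2_shift.rep_eq)
  with False show ?thesis by (simp add: inner_ell2_def)
qed

lemma bounded_linear_ell2_shift: "bounded_linear (ell2_shift k)"
  by (rule bounded_linear_intro[where K=1]) (auto simp: ell2_shift_linear norm_ell2_def ell2_shift_inner)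

lift_definition shift_blinfun :: "nat \<Rightarrow> ell2 \<Rightarrow>\<^sub>L ell2" is ell2_shift
  by (rule bounded_linear_ell2_shift)

lift_definition compact_shift :: "nat \<Rightarrow> compact_op \<Rightarrow> compact_op" is "\<lambda>k T. shift_blinfun k o\<^sub>L T"
  by (intro conjI allI compact_image_compose_left) (auto simp: shift_blinfun.rep_eq ell2_shift_linear)

lemma compact_shift_linear:
  "compact_shift k (S + T) = compact_shift k S + compact_shift k T"
  "compact_shift k (c *\<^sub>C T) = c *\<^sub>C compact_shift k T"
  by (transfer; rule blinfun_eqI; simp add: blinfun.add_left blinfun.add_right shift_blinfun.rep_eq ell2_shift_linear)+

lemma shift_blinfun_adjoint_comp:
  "blinfun_adjoint (shift_blinfun k o\<^sub>L S) o\<^sub>L (shift_blinfun l o\<^sub>L T) = (if k = l then blinfun_adjoint S o\<^sub>L T else 0)"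
  by (rule blinfun_eqI, rule inner_ext)
    (simp add: blinfun_adjoint_works[symmetric] shift_blinfun.rep_eq ell2_shift_inner)

lemma compact_shift_star_mult:
  "star (compact_shift k S) * compact_shift l T = (if k = l then star S * T else 0)"
  by transfer (rule shift_blinfun_adjoint_comp)

section \<open>The isometries on the tensor product\<close>

lemma cbilinear_compact_shift:
  "cbilinear \<phi> \<Longrightarrow> cbilinear (\<lambda>a b. \<phi> a (compact_shift k b))"
  unfolding cbilinear_def by (simp add: compact_shift_linear)

text \<open>Tensors are functionals on bilinear forms, so an operator on the second factor acts by
  precomposing the forms with it.\<close>

lift_definition alg_shift :: "nat \<Rightarrow> ('a::cstar_algebra, compact_op) alg_tensor \<Rightarrow> ('a, compact_op) alg_tensor"
  is "\<lambda>k F \<phi>. if cbilinear \<phi> then F (\<lambda>a b. \<phi> a (compact_shift k b)) else 0"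
proof -
  fix k and F :: "('a \<Rightarrow> compact_op \<Rightarrow> complex) \<Rightarrow> complex"
  assume "F \<in> range tensor_functional"
  then obtain xs where F: "F = tensor_functional xs" by blast
  have "(\<Sum>(a, b)\<leftarrow>xs. \<phi> a (compact_shift k b)) = (\<Sum>(a, b)\<leftarrow>map (\<lambda>(a, b). (a, compact_shift k b)) xs. \<phi> a b)" for \<phi> :: "'a \<Rightarrow> compact_op \<Rightarrow> complex"
    by (induction xs) auto
  then have "(\<lambda>\<phi>. if cbilinear \<phi> then F (\<lambda>a b. \<phi> a (compact_shift k b)) else 0) =
      tensor_functional (map (\<lambda>(a, b). (a, compact_shift k b)) xs)"
    unfolding F tensor_functional_def by (intro ext) (simp add: cbilinear_compact_shift)
  then show "(\<lambda>\<phi>. if cbilinear \<phi> then F (\<lambda>a b. \<phi> a (compact_shift k b)) else 0) \<in> range tensor_functional" by blast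
qed

lemma alg_shift_linear:
  "alg_shift k (x + y) = alg_shift k x + alg_shift k y"
  "alg_shift k (c *\<^sub>C x) = c *\<^sub>C alg_shift k x"
  by (rule alg_tensor_eqI, simp add: alg_shift.rep_eq plus_alg_tensor.rep_eq scaleC_alg_tensor.rep_eq)+

lemma alg_shift_diff: "alg_shift k (x - y) = alg_shift k x - alg_shift k y"
  using alg_shift_linear(1)[of k "x - y" y] by simp

lemma alg_shift_star_mult:
  "star (alg_shift k x) * alg_shift l y = (if k = l then star x * y else 0)"
proof (rule alg_tensor_eqI)
  fix \<phi> :: "'a \<Rightarrow> compact_op \<Rightarrow> complex" assume \<phi>: "cbilinear \<phi>"
  have l: "cbilinear (\<lambda>c d. \<phi> (a * c) (b * d))" for a b by (rule cbilinear_mult_left[OF \<phi>])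
  have 1: "cbilinear (\<lambda>a b. tensor_eval y (\<lambda>c d. \<phi> (a * c) (b * d)))" for y
    by (intro cbilinear_eval cbilinear_mult_left cbilinear_mult_right \<phi>)
  have 2: "cbilinear (\<lambda>a b. tensor_eval y (\<lambda>c d. \<phi> (a * c) (b * compact_shift l d)))" for y
    by (intro cbilinear_eval cbilinear_compact_shift[OF l])
      (use cbilinear_mult_right[OF \<phi>] in blast)
  have "tensor_eval (star (alg_shift k x) * alg_shift l y) \<phi> =
      cnj (tensor_eval x (\<lambda>a b. cnj (tensor_eval y (\<lambda>c d. \<phi> (star a * c) (star (compact_shift k b) * compact_shift l d)))))"
    using \<phi> l 1 2 cbilinear_star[OF 2[of y]]
    by (simp add: times_alg_tensor.rep_eq star_alg_tensor.rep_eq alg_shift.rep_eq cbilinear_star)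
  also have "\<dots> = tensor_eval (if k = l then star x * y else 0) \<phi>"
  proof (cases "k = l")
    case True
    then show ?thesis using \<phi> 1
      by (simp add: times_alg_tensor.rep_eq star_alg_tensor.rep_eq compact_shift_star_mult)
  next
    case False
    have "\<phi> a 0 = 0" for a
      using \<phi> unfolding cbilinear_def by (metis mult_zero_left scaleC_zero_left)
    then show ?thesis
      using False tensor_eval_scale[OF cbilinear_zero, of y 0] tensor_eval_scale[OF cbilinear_zero, of x 0]
      by (simp add: compact_shift_star_mult zero_alg_tensor.rep_eq)
  qed
  finally show "tensor_eval (star (alg_shift k x) * alg_shift l y) \<phi> = tensor_eval (if k = l then star x * y else 0) \<phi>" .
qed

text \<open>The relation \<open>alg_shift_star_mult\<close> with equal indices and the C*-identity
  already force an isometry, whatever seminorms enter the supremum.\<close>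

lemma max_norm_alg_shift: "max_norm (alg_shift k x) = max_norm x"
proof -
  have "(max_norm (alg_shift k x))\<^sup>2 = (max_norm x)\<^sup>2"
    unfolding max_norm_cstar[symmetric] by (simp add: alg_shift_star_mult)
  then show ?thesis by (simp add: power2_eq_iff_nonneg max_norm_nonneg)
qed

lemma max_rel_alg_shift: "max_rel X Y \<Longrightarrow> max_rel (\<lambda>n. alg_shift k (X n)) (\<lambda>n. alg_shift k (Y n))"
  by (erule max_rel_Lipschitz[where K=1]) (simp add: alg_shift_diff[symmetric] max_norm_alg_shift)

text \<open>Left multiplication by \<open>1 \<otimes> V\<^sub>k\<close>, an isometric multiplier that is not an element of the algebra.\<close>

lift_definition shift :: "nat \<Rightarrow> 'a::cstar_algebra stabilization \<Rightarrow> 'a stabilization"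
  is "\<lambda>k X n. alg_shift k (X n)"
  by (rule max_rel_alg_shift)

lemma shift_add: "shift k (x + y) = shift k x + shift k y"
  and shift_scaleC: "shift k (c *\<^sub>C x) = c *\<^sub>C shift k x"
  and shift_star_mult: "star (shift k x) * shift l y = (if k = l then star x * y else 0)"
proof -
  obtain X where X: "max_rel X X" "x = abs_cstar_tensor X" by (rule cstar_tensor_cases)
  obtain Y where Y: "max_rel Y Y" "y = abs_cstar_tensor Y" by (rule cstar_tensor_cases)
  note simps = X Y cstar_tensor_abs_eq cstar_tensor_rel shift.abs_eq max_rel_alg_shift
  show "shift k (x + y) = shift k x + shift k y" "shift k (c *\<^sub>C x) = c *\<^sub>C shift k x"
    by (simp_all add: simps alg_shift_linear)
  show "star (shift k x) * shift l y = (if k = l then star x * y else 0)"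
    by (simp add: simps alg_shift_star_mult)
qed

lemma shift_scaleR: "shift k (r *\<^sub>R x) = r *\<^sub>R shift k x"
  using shift_scaleC[of k "complex_of_real r" x] by (simp add: scaleC_of_real)

lemma norm_shift: "norm (shift k x) = norm x"
proof -
  have "(norm (shift k x))\<^sup>2 = (norm x)\<^sup>2"
    unfolding cstar_identity[symmetric] by (simp add: shift_star_mult)
  then show ?thesis by (simp add: power2_eq_iff_nonneg)
qed

lemma bounded_linear_shift: "bounded_linear (shift k)"
  by (rule bounded_linear_intro[where K=1]) (auto simp: shift_add shift_scaleR norm_shift)

lemma shift_zero: "shift k 0 = 0"
  by (rule linear_0[OF bounded_linear.linear[OF bounded_linear_shift]])

text \<open>An isometry for the algebra-valued inner product \<open>x\<^sup>*y\<close> is automatically a module map.\<close>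

lemma shift_mult: "shift k (x * b) = shift k x * b"
proof -
  define d where "d = shift k (x * b) - shift k x * b"
  have *: "star (shift k z) * (shift k x * b) = star z * (x * b)" for z
    by (simp add: mult.assoc[symmetric] shift_star_mult)
  have **: "(star b * star (shift k x)) * shift k y = star b * (star x * y)" for y
    by (simp add: mult.assoc shift_star_mult)
  have "star d * d = 0"
    by (simp add: d_def star_diff star_mult algebra_simps shift_star_mult * **[unfolded mult.assoc])
  then have "d = 0" using cstar_identity[of d] by simp
  then show ?thesis by (simp add: d_def)
qed

text \<open>Conjugation \<open>x \<mapsto> (1 \<otimes> V\<^sub>k) x (1 \<otimes> V\<^sub>k)\<^sup>*\<close>.\<close>

definition corner :: "nat \<Rightarrow> 'a::cstar_algebra stabilization \<Rightarrow> 'a stabilization"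
  where "corner k x = shift k (star (shift k (star x)))"

lemma norm_corner: "norm (corner k x) = norm x"
  by (simp add: corner_def norm_shift norm_star)

lemma corner_add: "corner k (x + y) = corner k x + corner k y"
  by (simp add: corner_def star_add shift_add)

lemma corner_scaleC: "corner k (c *\<^sub>C x) = c *\<^sub>C corner k x"
  by (simp add: corner_def star_scaleC shift_scaleC)

lemma corner_scaleR: "corner k (r *\<^sub>R x) = r *\<^sub>R corner k x"
  by (simp add: corner_def star_scaleR shift_scaleR)

lemma bounded_linear_corner: "bounded_linear (corner k)"
  by (rule bounded_linear_intro[where K=1]) (auto simp: corner_add corner_scaleR norm_corner)

lemma corner_mult_star: "corner k (x * star y) = shift k x * star (shift k y)"
proof -
  have "shift k (star (x * star y)) = shift k y * star x" by (simp add: star_mult star_star shift_mult)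
  then show ?thesis by (simp add: corner_def star_mult star_star shift_mult)
qed

lemma corner_mult: "corner k (x * y) = corner k x * corner k y"
proof -
  have "corner k x * corner k y = shift k (star (shift k (star x)) * shift k (star (shift k (star y))))"
    unfolding corner_def by (simp add: shift_mult)
  also have "\<dots> = shift k (x * star (shift k (star y)))" by (simp add: shift_star_mult star_star)
  also have "\<dots> = corner k (x * y)" using corner_mult_star[of k x "star y"] by (simp add: star_star shift_mult)
  finally show ?thesis by simp
qed

text \<open>On products \<open>x * u\<close> it follows from \<open>corner_mult_star\<close>, and
  every element is a limit of such products.\<close>

lemma corner_star: "corner k (star x) = star (corner k x)"
proof -
  obtain u where u: "(\<lambda>n. x * u n) \<longlonglongrightarrow> x" by (rule approx_unit_right)
  note lim = bounded_linear.tendsto[OF bounded_linear_corner]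
  have "corner k (star (x * u n)) = star (corner k (x * u n))" for n
    using corner_mult_star[of k "star (u n)" x] corner_mult_star[of k x "star (u n)"] by (simp add: star_mult star_star)
  then have "(\<lambda>n. corner k (star (x * u n))) \<longlonglongrightarrow> star (corner k x)"
    using tendsto_star[OF lim[OF u]] by simp
  with lim[OF tendsto_star[OF u]] show ?thesis by (rule LIMSEQ_unique)
qed

lemma corner_orthogonal: "k \<noteq> l \<Longrightarrow> corner k x * corner l y = 0"
  using shift_star_mult[of k "star (shift k x)" l "star (shift l (star y))"] corner_star[of k "star x"]
  by (simp add: corner_def star_star)

lemma positive_corner: "positive a \<Longrightarrow> positive (corner k a)"
  by (auto simp: positive_def corner_mult corner_star)

text \<open>For a square root \<open>s\<close> of \<open>a\<close>, the single element
  \<open>shift k s\<close> has \<open>a\<close> and \<open>corner k a\<close> as its two products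
  with its adjoint.\<close>

lemma cuntz_equiv_corner:
  assumes "positive a"
  shows "cuntz_le a (corner k a)" "cuntz_le (corner k a) a"
proof -
  obtain s where s: "star s = s" "s * s = a" by (rule positive_sqrt[OF assms])
  have 1: "star (shift k s) * shift k s = a" by (simp add: shift_star_mult s)
  have 2: "shift k s * star (shift k s) = corner k a" unfolding corner_mult_star[symmetric] by (simp add: s)
  show "cuntz_le a (corner k a)" "cuntz_le (corner k a) a"
    using cuntz_le_star_mult[of "shift k s"] cuntz_le_mult_star[of "shift k s"] unfolding 1 2 .
qed

lemma cut_corner: "positive a \<Longrightarrow> 0 \<le> e \<Longrightarrow> cut e (corner k a) = corner k (cut e a)"
  by (rule cut_hom[OF bounded_linear_corner corner_scaleC corner_mult corner_star])

text \<open>Corners \<open>0\<close> and \<open>1\<close> are orthogonal for all \<open>a\<close>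
  and \<open>b\<close>, which gives a canonical orthogonal representative of the sum of two
  classes.\<close>

definition oplus :: "'a::cstar_algebra stabilization \<Rightarrow> 'a stabilization \<Rightarrow> 'a stabilization"  (infixl \<open>\<oplus>\<^sub>c\<close> 65)
  where "a \<oplus>\<^sub>c b = corner 0 a + corner 1 b"

lemma positive_oplus: "positive a \<Longrightarrow> positive b \<Longrightarrow> positive (a \<oplus>\<^sub>c b)"
  by (simp add: oplus_def positive_add positive_corner)

lemma cut_oplus: "positive a \<Longrightarrow> positive b \<Longrightarrow> 0 \<le> e \<Longrightarrow> cut e (a \<oplus>\<^sub>c b) = cut e a \<oplus>\<^sub>c cut e b"
  by (simp add: oplus_def cut_add_orthogonal positive_corner corner_orthogonal cut_corner)

lemma oplus_mono:
  assumes "cuntz_le a a'" "cuntz_le b b'"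
  shows "cuntz_le (a \<oplus>\<^sub>c b) (a' \<oplus>\<^sub>c b')"
proof -
  obtain x :: "nat \<Rightarrow> 'a stabilization" where x: "(\<lambda>n. star (x n) * a' * x n) \<longlonglongrightarrow> a"
    using assms(1) by (auto simp: cuntz_le_def)
  obtain y :: "nat \<Rightarrow> 'a stabilization" where y: "(\<lambda>n. star (y n) * b' * y n) \<longlonglongrightarrow> b"
    using assms(2) by (auto simp: cuntz_le_def)
  have "(\<lambda>n. corner 0 (star (x n) * a' * x n) + corner 1 (star (y n) * b' * y n)) \<longlonglongrightarrow> a \<oplus>\<^sub>c b"
    unfolding oplus_def by (intro tendsto_intros bounded_linear.tendsto[OF bounded_linear_corner] x y)
  moreover have "corner 0 (star (x n) * a' * x n) + corner 1 (star (y n) * b' * y n) =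
      star (x n \<oplus>\<^sub>c y n) * (a' \<oplus>\<^sub>c b') * (x n \<oplus>\<^sub>c y n)" for n
  proof -
    have o: "corner 0 u * (corner (Suc 0) v * w) = 0" "corner (Suc 0) u * (corner 0 v * w) = 0"
      "corner 0 u * corner (Suc 0) v = 0" "corner (Suc 0) u * corner 0 v = 0" for u v w :: "'a stabilization"
      by (simp_all add: mult.assoc[symmetric] corner_orthogonal)
    show ?thesis
      by (simp add: oplus_def star_add corner_star[symmetric] distrib_left distrib_right corner_mult mult.assoc o)
  qed
  ultimately show ?thesis unfolding cuntz_le_def by (intro exI[of _ "\<lambda>n. x n \<oplus>\<^sub>c y n"]) simp
qed

text \<open>With square roots \<open>s\<close>, \<open>t\<close> and
  \<open>y = shift 0 s + shift 1 t\<close>, always \<open>star y * y = a + b\<close>. Orthogonality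
  passes to the roots and removes the cross terms from \<open>y * star y\<close>.\<close>

lemma cuntz_equiv_oplus:
  assumes a: "positive a" and b: "positive b" and ab: "a * b = 0"
  shows "cuntz_le (a + b) (a \<oplus>\<^sub>c b)" "cuntz_le (a \<oplus>\<^sub>c b) (a + b)"
proof -
  obtain s where s: "star s = s" "s * s = a" by (rule positive_sqrt[OF a])
  obtain t where t: "star t = t" "t * t = b" by (rule positive_sqrt[OF b])
  have "star (s * b) * (s * b) = star b * (a * b)" by (simp add: star_mult s(1) mult.assoc flip: s(2))
  then have "s * b = 0" using cstar_identity[of "s * b"] ab by simp
  moreover have "(s * t) * star (s * t) = s * b * star s" by (simp add: star_mult t(1) mult.assoc flip: t(2))
  ultimately have st: "s * t = 0" using cstar_identity[of "star (s * t)"] by (simp add: star_star norm_star)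
  have ts: "t * s = 0" using arg_cong[OF st, of star] unfolding star_mult s t star_zero .
  define y where "y = shift 0 s + shift 1 t"
  have 1: "star y * y = a + b"
    by (simp add: y_def star_add distrib_left distrib_right shift_star_mult s t)
  have Ls: "shift 1 t * s = 0" and Lt: "shift 0 s * t = 0" by (simp_all add: shift_mult[symmetric] st ts shift_zero)
  have "s * star (shift 1 t) = 0" using arg_cong[OF Ls, of star] unfolding star_mult s star_zero .
  moreover have "t * star (shift 0 s) = 0" using arg_cong[OF Lt, of star] unfolding star_mult t star_zero .
  ultimately have "shift 0 s * star (shift 1 t) = 0" "shift 1 t * star (shift 0 s) = 0"
    by (metis shift_mult shift_zero)+
  then have 2: "y * star y = a \<oplus>\<^sub>c b"
    using corner_mult_star[of 0 s s] corner_mult_star[of 1 t t]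
    by (simp add: y_def star_add distrib_left distrib_right oplus_def s t)
  show "cuntz_le (a + b) (a \<oplus>\<^sub>c b)" "cuntz_le (a \<oplus>\<^sub>c b) (a + b)"
    using cuntz_le_star_mult[of y] cuntz_le_mult_star[of y] unfolding 1 2 .
qed

text \<open>Without orthogonality the cross terms of \<open>y * star y\<close> remain; changing one
  sign gives \<open>z\<close> whose cross terms cancel them, so \<open>y * star y\<close> lies below
  \<open>2 *\<^sub>R (a \<oplus>\<^sub>c b)\<close>.\<close>

lemma cuntz_le_add_oplus:
  assumes a: "positive a" and b: "positive b"
  shows "cuntz_le (a + b) (a \<oplus>\<^sub>c b)"
proof -
  obtain s where s: "star s = s" "s * s = a" by (rule positive_sqrt[OF a])
  obtain t where t: "star t = t" "t * t = b" by (rule positive_sqrt[OF b])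
  define y where "y = shift 0 s + shift 1 t"
  define z where "z = shift 0 s - shift 1 t"
  have "star y * y = a + b"
    by (simp add: y_def star_add distrib_left distrib_right shift_star_mult s t)
  then have 1: "cuntz_le (a + b) (y * star y)" using cuntz_le_star_mult[of y] by simp
  have "y * star y + z * star z = (shift 0 s * star (shift 0 s) + shift 1 t * star (shift 1 t)) +
      (shift 0 s * star (shift 0 s) + shift 1 t * star (shift 1 t))"
    by (simp add: y_def z_def star_add star_diff algebra_simps)
  also have "\<dots> = 2 *\<^sub>R (a \<oplus>\<^sub>c b)"
    unfolding corner_mult_star[symmetric] by (simp add: s t oplus_def scaleR_2)
  finally have "z * star z = 2 *\<^sub>R (a \<oplus>\<^sub>c b) - y * star y" by (simp add: algebra_simps)
  then have "positive (2 *\<^sub>R (a \<oplus>\<^sub>c b) - y * star y)" using positive_mult_star[of z] by simp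
  then have "cuntz_le (y * star y) (a \<oplus>\<^sub>c b)"
    by (intro cuntz_le_if_le_scaleR[of _ _ 2] positive_mult_star positive_oplus a b) auto
  with 1 show ?thesis by (rule cuntz_le_trans)
qed

section \<open>Suprema of increasing sequences\<close>

lemma cuntz_le_chain:
  assumes "\<And>n. positive (a n)" "\<And>n. cuntz_le (a n) (a (Suc n))" "m \<le> n"
  shows "cuntz_le (a m) (a n)"
  using assms(3) by (induction n rule: dec_induct) (use assms(1,2) cuntz_le_refl cuntz_le_trans in blast)+

lemma pos_mult_divide_cancel: "0 < k \<Longrightarrow> k * (x / k) = (x :: real)"
  by simp

lemma norm_diff_triangle: "norm (x - z) \<le> norm (x - y) + norm (y - z :: 'a::real_normed_vector)"
  using norm_triangle_ineq[of "x - y" "y - z"] by simp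

lemma cuntz_le_approx_mult:
  assumes "cuntz_le a b" "0 < e"
  obtains z where "norm (star (z * w) * b * (z * w) - star w * a * w) < e"
proof -
  obtain z :: "nat \<Rightarrow> 'a" where z: "(\<lambda>n. star (z n) * b * z n) \<longlonglongrightarrow> a" using assms(1) by (auto simp: cuntz_le_def)
  have "(\<lambda>n. star w * (star (z n) * b * z n) * w) \<longlonglongrightarrow> star w * a * w" by (intro tendsto_intros z)
  from LIMSEQ_D[OF this assms(2)] show thesis using that by (auto simp: star_mult mult.assoc)
qed

text \<open>Here \<open>w' = z w + c y\<close>: the factor \<open>z\<close> moves \<open>w\<close> to level \<open>a'\<close>, and \<open>y\<close> stores \<open>b\<close> in the unused corner \<open>N\<close>.\<close>

lemma supremum_step:
  fixes a a' b w :: "'a::cstar_algebra stabilization"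
  assumes aa': "cuntz_le a a'" and b: "positive b" "cuntz_le b a'"
    and w: "\<And>k x. N \<le> k \<Longrightarrow> w * shift k x = 0" and t: "0 < t" and e: "0 < e"
  obtains w' x where "\<And>k x. Suc N \<le> k \<Longrightarrow> w' * shift k x = 0"
    "norm (star w' * a' * w' - star w * a * w) < t"
    "norm (star x * (star w' * a' * w') * x - b) < e"
proof -
  obtain z where zw: "norm (star (z * w) * a' * (z * w) - star w * a * w) < t / 2"
    using cuntz_le_approx_mult[OF aa', of "t / 2"] t by auto
  \<comment> \<open>With no unit to insert, \<open>b\<close> is first replaced by a nearby conjugate
    of itself, so that \<open>shift N u\<close> can later read it out of the corner.\<close>
  obtain u where u: "norm (star u * b * u - b) < e / 2"
    using cuntz_le_approx[OF cuntz_le_refl[OF b(1)], of "e / 2"] e by auto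
  obtain v where "norm (star (v * u) * a' * (v * u) - star u * b * u) < e / 2"
    using cuntz_le_approx_mult[OF b(2), of "e / 2"] e by auto
  then have vu: "norm (star (v * u) * a' * (v * u) - b) < e"
    using u norm_diff_triangle[of "star (v * u) * a' * (v * u)" b "star u * b * u"] by linarith
  \<comment> \<open>This is \<open>v\<close> times the adjoint of \<open>V\<^sub>N\<close>: it acts
    as \<open>v\<close> on corner \<open>N\<close> and vanishes on all others.\<close>
  define y where "y = star (shift N (star v))"
  define w' where "w' c = z * w + c *\<^sub>R y" for c :: real
  have "(\<lambda>n. star (w' (inverse (real (Suc n)))) * a' * w' (inverse (real (Suc n))))
      \<longlonglongrightarrow> star (z * w + 0 *\<^sub>R y) * a' * (z * w + 0 *\<^sub>R y)"
    unfolding w'_def by (intro tendsto_intros LIMSEQ_inverse_real_of_nat)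
  then have "(\<lambda>n. star (w' (inverse (real (Suc n)))) * a' * w' (inverse (real (Suc n)))) \<longlonglongrightarrow> star (z * w) * a' * (z * w)"
    by simp
  then obtain n where n: "norm (star (w' (inverse (real (Suc n)))) * a' * w' (inverse (real (Suc n))) - star (z * w) * a' * (z * w)) < t / 2"
    using LIMSEQ_D[of _ _ "t / 2"] t by (meson half_gt_zero order_refl)
  define c where "c = inverse (real (Suc n))"
  have c: "0 < c" by (simp add: c_def)
  show thesis
  proof (rule that[of "w' c" "(1 / c) *\<^sub>R shift N u"])
    fix k x assume k: "Suc N \<le> k"
    then have "y * shift k x = 0" by (simp add: y_def shift_star_mult)
    with k w[of k x] show "w' c * shift k x = 0" by (simp add: w'_def distrib_right mult.assoc)
  next
    show "norm (star (w' c) * a' * w' c - star w * a * w) < t"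
      using n[folded c_def] zw norm_diff_triangle[of "star (w' c) * a' * w' c" "star w * a * w" "star (z * w) * a' * (z * w)"]
      by linarith
  next
    \<comment> \<open>The factor \<open>1 / c\<close> undoes the small weight \<open>c\<close> of
      the stored copy, and \<open>z * w\<close> does not interfere because \<open>w\<close> vanishes
      on corner \<open>N\<close>.\<close>
    have "w' c * ((1 / c) *\<^sub>R shift N u) = v * u"
      using c w[of N u] by (simp add: w'_def y_def distrib_right mult.assoc shift_star_mult star_star)
    moreover have "star ((1 / c) *\<^sub>R shift N u) * (star (w' c) * a' * w' c) * ((1 / c) *\<^sub>R shift N u) =
        star (w' c * ((1 / c) *\<^sub>R shift N u)) * a' * (w' c * ((1 / c) *\<^sub>R shift N u))"
      by (simp only: star_mult mult.assoc)
    ultimately show "norm (star ((1 / c) *\<^sub>R shift N u) * (star (w' c) * a' * w' c) * ((1 / c) *\<^sub>R shift N u) - b) < e"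
      using vu by (simp only:)
  qed
qed

text \<open>Dependent choice of pairs \<open>(w\<^sub>n, T\<^sub>n)\<close>, where the tolerance
  \<open>T\<^sub>n\<close> bounds all later movement. The limit then still recovers every stored
  copy, and it is approximated by conjugates of the \<open>a n\<close>.\<close>

lemma cuntz_supremum_exists:
  fixes a :: "nat \<Rightarrow> 'a::cstar_algebra stabilization"
  assumes pos: "\<And>n. positive (a n)" and inc: "\<And>n. cuntz_le (a n) (a (Suc n))"
  obtains s where "positive s" "\<And>n. cuntz_le (a n) s"
    "\<And>e. 0 < e \<Longrightarrow> \<exists>n x. norm (star x * a n * x - s) < e"
proof -
  \<comment> \<open>The pairing makes every \<open>a n\<close> a target infinitely often, with
    errors tending to \<open>0\<close>; a target at stage \<open>N\<close> has index at most
    \<open>N\<close> and so is Cuntz below \<open>a (Suc N)\<close>.\<close>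
  define tgt where "tgt N = a (fst (prod_decode N))" for N
  define P :: "nat \<Rightarrow> 'a stabilization \<times> real \<Rightarrow> bool"
    where "P N p \<longleftrightarrow> 0 < snd p \<and> (\<forall>k x. N \<le> k \<longrightarrow> fst p * shift k x = 0)" for N p
  define A where "A N p = star (fst p) * a N * fst p" for N and p :: "'a stabilization \<times> real"
  \<comment> \<open>The new tolerance and the present move each use at most half of the old
    tolerance. The last clause stores a witness that works for everything within the new tolerance,
    in particular for the limit.\<close>
  define Q where "Q N p q \<longleftrightarrow> snd q \<le> snd p / 2 \<and> norm (A (Suc N) q - A N p) \<le> snd p / 2 \<and>
    (\<exists>x. \<forall>c. norm (c - A (Suc N) q) \<le> snd q \<longrightarrow> norm (star x * c * x - tgt N) < inverse (real (Suc N)))" for N p q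
  have "\<exists>f. \<forall>n. P n (f n) \<and> Q n (f n) (f (Suc n))"
  proof (rule dependent_nat_choice)
    show "\<exists>p. P 0 p" by (rule exI[of _ "(0, 1)"]) (simp add: P_def)
    fix p N assume p: "P N p"
    define e where "e = inverse (real (Suc N))"
    have e: "0 < e" by (simp add: e_def)
    have "fst (prod_decode N) \<le> Suc N"
      using le_prod_encode_1[of "fst (prod_decode N)" "snd (prod_decode N)"] by simp
    then have tgt: "cuntz_le (tgt N) (a (Suc N))" unfolding tgt_def by (rule cuntz_le_chain[where a=a, OF pos inc])
    have tp: "positive (tgt N)" by (simp add: tgt_def pos)
    have wp: "\<And>k x. N \<le> k \<Longrightarrow> fst p * shift k x = 0" and p0: "0 < snd p / 2" and e2: "0 < e / 2"
      using p e by (auto simp: P_def)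
    obtain w' x where w': "\<And>k x. Suc N \<le> k \<Longrightarrow> w' * shift k x = 0"
      "norm (star w' * a (Suc N) * w' - star (fst p) * a N * fst p) < snd p / 2"
      "norm (star x * (star w' * a (Suc N) * w') * x - tgt N) < e / 2"
      using supremum_step[where N=N and w="fst p" and b="tgt N", OF inc tp tgt wp p0 e2] by blast
    define A' where "A' = star w' * a (Suc N) * w'"
    have x1: "0 < (norm x)\<^sup>2 + 1" by (simp add: add_nonneg_pos)
    \<comment> \<open>Conjugation by \<open>x\<close> enlarges an error by at most the square of
      \<open>norm x\<close>; the added \<open>1\<close> avoids division by zero.\<close>
    define t where "t = min (snd p / 2) (e / 2 / ((norm x)\<^sup>2 + 1))"
    have t: "0 < t" using p0 e2 x1 by (simp add: t_def)
    have "norm (star x * c * x - tgt N) < e" if c: "norm (c - A') \<le> t" for c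
    proof -
      have "norm (star x * (c - A') * x) \<le> (norm x)\<^sup>2 * norm (c - A')" by (rule norm_conj_le)
      also have "\<dots> \<le> ((norm x)\<^sup>2 + 1) * (e / 2 / ((norm x)\<^sup>2 + 1))"
        using c by (intro mult_mono) (auto simp: t_def)
      also have "\<dots> = e / 2" using x1 by (intro pos_mult_divide_cancel)
      finally have "norm (star x * (c - A') * x) \<le> e / 2" .
      then show ?thesis unfolding conj_diff_distrib
        using w'(3)[folded A'_def] norm_diff_triangle[of "star x * c * x" "tgt N" "star x * A' * x"] by linarith
    qed
    then have "\<exists>x. \<forall>c. norm (c - A') \<le> t \<longrightarrow> norm (star x * c * x - tgt N) < inverse (real (Suc N))"
      unfolding e_def by blast
    moreover have "t \<le> snd p / 2" unfolding t_def by (rule min.cobounded1)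
    ultimately have "Q N p (w', t)"
      unfolding Q_def A_def fst_conv snd_conv using less_imp_le[OF w'(2)] by (fold A'_def) (intro conjI)
    moreover have "P (Suc N) (w', t)" using w'(1) t by (simp add: P_def)
    ultimately show "\<exists>q. P (Suc N) q \<and> Q N p q" by blast
  qed
  then obtain f where f: "\<And>n. P n (f n)" "\<And>n. Q n (f n) (f (Suc n))" by blast
  define T where "T n = snd (f n)" for n
  define B where "B n = A n (f n)" for n
  have T: "0 < T n" "T (Suc n) \<le> T n / 2" and B: "norm (B (Suc n) - B n) \<le> T n / 2" for n
    using f(1)[of n] f(2)[of n] by (auto simp: P_def Q_def T_def B_def)
  have T0: "T n \<le> T 0 * (1 / 2) ^ n" for n
    by (induction n) (use T in \<open>auto intro: order_trans\<close>)
  have "norm (T n - 0) \<le> T 0 * (1 / 2) ^ n" for n using T0[of n] T(1)[of n] by simp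
  then have Tlim: "T \<longlonglongrightarrow> 0"
    by (rule tendsto_if_norm_diff_le) (intro tendsto_mult_right_zero LIMSEQ_realpow_zero, auto)
  \<comment> \<open>Subtracting \<open>T (n + k)\<close> makes the induction close: half of a
    tolerance pays for the move, and the next tolerance is at most the other half.\<close>
  have Bdiff: "norm (B (n + k) - B n) \<le> T n - T (n + k)" for n k
  proof (induction k)
    case (Suc k)
    have "norm (B (n + Suc k) - B n) \<le> norm (B (Suc (n + k)) - B (n + k)) + norm (B (n + k) - B n)"
      using norm_triangle_ineq[of "B (Suc (n + k)) - B (n + k)" "B (n + k) - B n"] by simp
    also have "\<dots> \<le> T (n + k) / 2 + (T n - T (n + k))" by (intro add_mono B Suc.IH)
    also have "\<dots> \<le> T n - T (n + Suc k)" using T(2)[of "n + k"] by simp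
    finally show ?case .
  qed simp
  have Bn: "norm (B m - B n) \<le> T n" if "n \<le> m" for m n
    using Bdiff[of n "m - n"] T(1)[of m] that by simp
  have "Cauchy B"
  proof (rule metric_CauchyI)
    fix e :: real assume "0 < e"
    then obtain N where N: "\<And>n. N \<le> n \<Longrightarrow> norm (T n) < e / 2" using LIMSEQ_D[OF Tlim, of "e / 2"] by auto
    have "dist (B m) (B n) < e" if "N \<le> m" "N \<le> n" for m n
      using norm_triangle_ineq4[of "B m - B N" "B n - B N"] Bn[OF that(1)] Bn[OF that(2)] N[of N] by (simp add: dist_norm)
    then show "\<exists>M. \<forall>m\<ge>M. \<forall>n\<ge>M. dist (B m) (B n) < e" by blast
  qed
  then obtain s where s: "B \<longlonglongrightarrow> s" using Cauchy_convergent convergent_def by blast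
  have sB: "norm (s - B n) \<le> T n" for n
  proof (rule LIMSEQ_le_const2)
    show "(\<lambda>m. norm (B m - B n)) \<longlonglongrightarrow> norm (s - B n)" by (intro tendsto_intros s)
  qed (use Bn in blast)
  show thesis
  proof (rule that[of s])
    show "positive s" by (rule positive_limit[OF _ s]) (simp add: B_def A_def positive_conj pos)
  next
    fix n
    show "cuntz_le (a n) s" unfolding cuntz_le_iff
    proof (intro allI impI)
      fix e :: real assume "0 < e"
      then obtain m where m: "inverse (real (Suc m)) < e" using reals_Archimedean by blast
      define N where "N = prod_encode (n, m)"
      have "m \<le> N" unfolding N_def by (rule le_prod_encode_2)
      then have "inverse (real (Suc N)) \<le> inverse (real (Suc m))" by (intro le_imp_inverse_le) auto
      moreover obtain x where "norm (star x * s * x - tgt N) < inverse (real (Suc N))"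
        using f(2)[of N] sB[of "Suc N"] unfolding Q_def B_def T_def by blast
      moreover have "tgt N = a n" by (simp add: tgt_def N_def)
      ultimately have "norm (star x * s * x - a n) < e" using m by (simp only:)
      then show "\<exists>x. norm (star x * s * x - a n) < e" by blast
    qed
  next
    fix e :: real assume "0 < e"
    then obtain n where "norm (T n) < e" using LIMSEQ_D[OF Tlim] by auto
    then have "norm (star (fst (f n)) * a n * fst (f n) - s) < e"
      using sB[of n] T(1)[of n] by (simp add: B_def A_def norm_minus_commute)
    then show "\<exists>n x. norm (star x * a n * x - s) < e" by blast
  qed
qed

section \<open>The axioms of the Cuntz semigroup\<close>

lemma equiv_cuntz_rel: "equiv {a. positive a} cuntz_rel"
proof (rule equivI)
  show "trans cuntz_rel" unfolding cuntz_rel_def by (rule transI) (auto intro: cuntz_le_trans)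
qed (auto simp: cuntz_rel_def refl_on_def sym_def cuntz_le_refl)

lemma mem_cuntz_class:
  "b \<in> cuntz_class a \<longleftrightarrow> positive a \<and> positive b \<and> cuntz_le a b \<and> cuntz_le b a"
  by (auto simp: cuntz_class_def cuntz_rel_def)

lemma cuntz_class_eq_iff:
  "positive a \<Longrightarrow> positive b \<Longrightarrow> cuntz_class a = cuntz_class b \<longleftrightarrow> cuntz_le a b \<and> cuntz_le b a"
  unfolding cuntz_class_def using eq_equiv_class_iff[OF equiv_cuntz_rel, of a b] by (simp add: cuntz_rel_def)

abbreviation (input) CuA :: "'a::cstar_algebra stabilization set ordered_semigroup"
  where "CuA \<equiv> Cu TYPE('a)"

lemma carrier_Cu: "X \<in> carrier CuA \<longleftrightarrow> (\<exists>a. positive a \<and> X = cuntz_class a)"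
  by (auto simp: Cu_def quotient_def cuntz_class_def)

lemma cuntz_class_in_Cu: "positive a \<Longrightarrow> cuntz_class a \<in> carrier CuA"
  by (auto simp: carrier_Cu)

lemma ole_Cu:
  assumes "positive a" "positive b"
  shows "ole CuA (cuntz_class a) (cuntz_class b) \<longleftrightarrow> cuntz_le a b"
proof -
  have "ole CuA (cuntz_class a) (cuntz_class b) \<longleftrightarrow> (\<exists>a'\<in>cuntz_class a. \<exists>b'\<in>cuntz_class b. cuntz_le a' b')"
    by (simp add: Cu_def)
  also have "\<dots> \<longleftrightarrow> cuntz_le a b"
  proof
    assume "\<exists>a'\<in>cuntz_class a. \<exists>b'\<in>cuntz_class b. cuntz_le a' b'"
    then obtain a' b' where *: "cuntz_le a a'" "cuntz_le a' b'" "cuntz_le b' b" by (auto simp: mem_cuntz_class)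
    show "cuntz_le a b" by (rule cuntz_le_trans[OF *(1) cuntz_le_trans[OF *(2,3)]])
  next
    assume "cuntz_le a b"
    then show "\<exists>a'\<in>cuntz_class a. \<exists>b'\<in>cuntz_class b. cuntz_le a' b'"
      using assms by (intro bexI[of _ a] bexI[of _ b]) (simp_all add: mem_cuntz_class cuntz_le_refl)
  qed
  finally show ?thesis .
qed

lemma ozero_Cu: "ozero CuA = cuntz_class 0"
  by (simp add: Cu_def)

text \<open>Every orthogonal pair of representatives has a sum equivalent to its
  \<open>\<oplus>\<^sub>c\<close>, which is monotone. So the description in \<open>osum\<close> has
  exactly one value.\<close>

lemma osum_Cu_orthogonal:
  assumes a: "positive a" and b: "positive b" and ab: "a * b = 0"
  shows "osum CuA (cuntz_class a) (cuntz_class b) = cuntz_class (a + b)"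
proof -
  have "(THE u. \<exists>a'\<in>cuntz_class a. \<exists>b'\<in>cuntz_class b. a' * b' = 0 \<and> u = cuntz_class (a' + b')) = cuntz_class (a + b)"
  proof (rule the_equality)
    show "\<exists>a'\<in>cuntz_class a. \<exists>b'\<in>cuntz_class b. a' * b' = 0 \<and> cuntz_class (a + b) = cuntz_class (a' + b')"
      using a b ab by (intro bexI[of _ a] bexI[of _ b]) (auto simp: mem_cuntz_class cuntz_le_refl)
    fix u assume "\<exists>a'\<in>cuntz_class a. \<exists>b'\<in>cuntz_class b. a' * b' = 0 \<and> u = cuntz_class (a' + b')"
    then obtain a' b' where a': "positive a'" "cuntz_le a a'" "cuntz_le a' a"
      and b': "positive b'" "cuntz_le b b'" "cuntz_le b' b" and ab': "a' * b' = 0" and u: "u = cuntz_class (a' + b')"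
      by (auto simp: mem_cuntz_class)
    note e = cuntz_equiv_oplus[OF a b ab] and e' = cuntz_equiv_oplus[OF a'(1) b'(1) ab']
    have "cuntz_le (a' + b') (a + b)"
      by (rule cuntz_le_trans[OF e'(1) cuntz_le_trans[OF oplus_mono[OF a'(3) b'(3)] e(2)]])
    moreover have "cuntz_le (a + b) (a' + b')"
      by (rule cuntz_le_trans[OF e(1) cuntz_le_trans[OF oplus_mono[OF a'(2) b'(2)] e'(2)]])
    ultimately show "u = cuntz_class (a + b)" unfolding u by (simp add: cuntz_class_eq_iff positive_add a b a' b')
  qed
  then show ?thesis by (simp add: Cu_def)
qed

lemma osum_Cu:
  assumes a: "positive a" and b: "positive b"
  shows "osum CuA (cuntz_class a) (cuntz_class b) = cuntz_class (a \<oplus>\<^sub>c b)"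
proof -
  have "cuntz_class a = cuntz_class (corner 0 a)" "cuntz_class b = cuntz_class (corner 1 b)"
    by (simp_all add: cuntz_class_eq_iff assms positive_corner cuntz_equiv_corner)
  then show ?thesis
    using osum_Cu_orthogonal[of "corner 0 a" "corner 1 b"] by (simp add: positive_corner assms corner_orthogonal oplus_def)
qed

lemma Cu_cases:
  assumes "X \<in> carrier CuA"
  obtains a where "positive a" "X = cuntz_class a"
  using assms by (auto simp: carrier_Cu)

text \<open>Three parallel corners are pairwise orthogonal, so both bracketings become the same
  ordinary sum in the algebra.\<close>

lemma osum_Cu_assoc:
  assumes a: "positive a" and b: "positive b" and c: "positive c"
  shows "osum CuA (osum CuA (cuntz_class a) (cuntz_class b)) (cuntz_class c) =
    osum CuA (cuntz_class a) (osum CuA (cuntz_class b) (cuntz_class c))"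
proof -
  define A where "A = corner 0 a"
  define B where "B = corner 1 b"
  define C where "C = corner 2 c"
  have p: "positive A" "positive B" "positive C" by (simp_all add: A_def B_def C_def positive_corner a b c)
  have o: "A * B = 0" "A * C = 0" "B * C = 0" by (simp_all add: A_def B_def C_def corner_orthogonal)
  have c: "cuntz_class a = cuntz_class A" "cuntz_class b = cuntz_class B" "cuntz_class c = cuntz_class C"
    by (simp_all add: cuntz_class_eq_iff a b c A_def B_def C_def positive_corner cuntz_equiv_corner)
  show ?thesis
    unfolding c using p o by (simp add: osum_Cu_orthogonal positive_add distrib_left distrib_right add.assoc)
qed

lemma osum_Cu_commute:
  assumes "positive a" "positive b"
  shows "osum CuA (cuntz_class a) (cuntz_class b) = osum CuA (cuntz_class b) (cuntz_class a)"
proof -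
  define A where "A = corner 0 a"
  define B where "B = corner 1 b"
  have p: "positive A" "positive B" by (simp_all add: A_def B_def positive_corner assms)
  have o: "A * B = 0" "B * A = 0" by (simp_all add: A_def B_def corner_orthogonal)
  have c: "cuntz_class a = cuntz_class A" "cuntz_class b = cuntz_class B"
    by (simp_all add: cuntz_class_eq_iff assms A_def B_def positive_corner cuntz_equiv_corner)
  show ?thesis unfolding c using p o by (simp add: osum_Cu_orthogonal add.commute)
qed

lemma is_ordered_semigroup_Cu: "is_ordered_semigroup CuA"
  unfolding is_ordered_semigroup_def
proof (intro conjI ballI impI)
  show "ozero CuA \<in> carrier CuA" by (simp add: ozero_Cu cuntz_class_in_Cu positive_zero)
next
  fix x y :: "'a stabilization set" assume "x \<in> carrier CuA" "y \<in> carrier CuA"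
  then obtain a b where ab: "positive a" "x = cuntz_class a" "positive b" "y = cuntz_class b"
    using Cu_cases by metis
  show "osum CuA x y \<in> carrier CuA" using ab by (simp add: osum_Cu cuntz_class_in_Cu positive_oplus)
  show "osum CuA x y = osum CuA y x" using ab by (simp add: osum_Cu_commute)
  show "x = y" if "ole CuA x y" "ole CuA y x"
    using that ab by (simp add: ole_Cu cuntz_class_eq_iff)
  fix z :: "'a stabilization set" assume "z \<in> carrier CuA"
  then obtain c where c: "positive c" "z = cuntz_class c" using Cu_cases by metis
  show "osum CuA (osum CuA x y) z = osum CuA x (osum CuA y z)" using ab c by (simp add: osum_Cu_assoc)
  show "ole CuA x z" if "ole CuA x y" "ole CuA y z"
    using that ab c cuntz_le_trans by (simp add: ole_Cu) blast
  show "ole CuA (osum CuA x z) (osum CuA y z)" if "ole CuA x y"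
    using that ab c by (simp add: ole_Cu osum_Cu positive_oplus oplus_mono cuntz_le_refl)
next
  fix x :: "'a stabilization set" assume "x \<in> carrier CuA"
  then obtain a where a: "positive a" "x = cuntz_class a" using Cu_cases by metis
  show "osum CuA (ozero CuA) x = x" using a by (simp add: ozero_Cu osum_Cu_orthogonal positive_zero)
  show "ole CuA x x" using a by (simp add: ole_Cu cuntz_le_refl)
  show "ole CuA (ozero CuA) x" using a by (simp add: ole_Cu ozero_Cu positive_zero cuntz_le_zero)
qed

section \<open>Suprema and the relation \<open>way_below\<close> in terms of elements\<close>

lemma increasing_Cu_iff:
  assumes "\<And>n. positive (a n)"
  shows "increasing CuA (\<lambda>n. cuntz_class (a n)) \<longleftrightarrow> (\<forall>n. cuntz_le (a n) (a (Suc n)))"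
  using assms by (auto simp: increasing_def cuntz_class_in_Cu ole_Cu)

lemma increasing_Cu_cases:
  assumes "increasing CuA f"
  obtains a where "\<And>n. positive (a n)" "f = (\<lambda>n. cuntz_class (a n))" "\<And>n. cuntz_le (a n) (a (Suc n))"
proof -
  have "\<forall>n. \<exists>a. positive a \<and> f n = cuntz_class a" using assms by (simp add: increasing_def carrier_Cu)
  then obtain a where a: "\<And>n. positive (a n)" "\<And>n. f n = cuntz_class (a n)" by metis
  then have f: "f = (\<lambda>n. cuntz_class (a n))" by blast
  with assms have "\<And>n. cuntz_le (a n) (a (Suc n))" using increasing_Cu_iff[OF a(1)] by simp
  then show thesis using that a(1) f by blast
qed

definition cuntz_sup :: "(nat \<Rightarrow> 'a::cstar_algebra) \<Rightarrow> 'a \<Rightarrow> bool"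
  where "cuntz_sup a s \<longleftrightarrow> (\<forall>n. cuntz_le (a n) s) \<and> (\<forall>u. positive u \<longrightarrow> (\<forall>n. cuntz_le (a n) u) \<longrightarrow> cuntz_le s u)"

lemma is_supremum_Cu_iff:
  assumes "\<And>n. positive (a n)" "positive s"
  shows "is_supremum CuA (\<lambda>n. cuntz_class (a n)) (cuntz_class s) \<longleftrightarrow> cuntz_sup a s"
proof -
  have "(\<forall>u\<in>carrier CuA. (\<forall>n. ole CuA (cuntz_class (a n)) u) \<longrightarrow> ole CuA (cuntz_class s) u) \<longleftrightarrow>
    (\<forall>u. positive u \<longrightarrow> (\<forall>n. cuntz_le (a n) u) \<longrightarrow> cuntz_le s u)"
  proof (intro iffI allI impI ballI)
    fix u assume *: "\<forall>u\<in>carrier CuA. (\<forall>n. ole CuA (cuntz_class (a n)) u) \<longrightarrow> ole CuA (cuntz_class s) u"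
      and u: "positive u" "\<forall>n. cuntz_le (a n) u"
    from bspec[OF * cuntz_class_in_Cu[OF u(1)]] show "cuntz_le s u" using u assms by (simp add: ole_Cu)
  next
    fix u assume *: "\<forall>u. positive u \<longrightarrow> (\<forall>n. cuntz_le (a n) u) \<longrightarrow> cuntz_le s u"
      and u: "u \<in> carrier CuA" "\<forall>n. ole CuA (cuntz_class (a n)) u"
    obtain v where v: "positive v" "u = cuntz_class v" by (rule Cu_cases[OF u(1)])
    show "ole CuA (cuntz_class s) u" using * u(2) v assms by (simp add: ole_Cu)
  qed
  then show ?thesis using assms by (simp add: is_supremum_def cuntz_sup_def cuntz_class_in_Cu ole_Cu)
qed

lemma is_supremum_Cu_cases:
  assumes "is_supremum CuA (\<lambda>n. cuntz_class (a n)) x" "\<And>n. positive (a n)"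
  obtains s where "positive s" "x = cuntz_class s" "cuntz_sup a s"
proof -
  have "x \<in> carrier CuA" using assms(1) by (simp add: is_supremum_def)
  then obtain s where "positive s" "x = cuntz_class s" by (rule Cu_cases)
  then show thesis using that assms is_supremum_Cu_iff by blast
qed

lemma cuntz_sup_exists:
  fixes a :: "nat \<Rightarrow> 'a::cstar_algebra stabilization"
  assumes pos: "\<And>n. positive (a n)" and inc: "\<And>n. cuntz_le (a n) (a (Suc n))"
  obtains s where "positive s" "cuntz_sup a s" "\<And>e. 0 < e \<Longrightarrow> \<exists>n x. norm (star x * a n * x - s) < e"
proof -
  obtain s where s: "positive s" "\<And>n. cuntz_le (a n) s" "\<And>e. 0 < e \<Longrightarrow> \<exists>n x. norm (star x * a n * x - s) < e"
    using cuntz_supremum_exists[of a, OF pos inc] by blast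
  have "cuntz_le s u" if u: "\<forall>n. cuntz_le (a n) u" for u
  proof (rule cuntz_le_closed)
    fix e :: real assume "0 < e"
    then obtain n x where "norm (star x * a n * x - s) < e" using s(3) by blast
    moreover have "cuntz_le (star x * a n * x) u" using cuntz_le_trans[OF cuntz_le_conj] u by blast
    ultimately show "\<exists>c. norm (c - s) < e \<and> cuntz_le c u" by blast
  qed
  then have "cuntz_sup a s" using s(2) by (simp add: cuntz_sup_def)
  then show thesis using that s by blast
qed

text \<open>An arbitrary supremum lies below the constructed one by minimality, and that one is
  approximated by conjugates of some \<open>a n\<close>. So is \<open>t\<close>, within
  \<open>e\<close>: half for the witness of \<open>t\<close>, half for the supremum.\<close>

lemma cut_compact:
  fixes a :: "nat \<Rightarrow> 'a::cstar_algebra stabilization"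
  assumes pos: "\<And>n. positive (a n)" and inc: "\<And>n. cuntz_le (a n) (a (Suc n))"
    and s: "cuntz_sup a s" and t: "positive t" "cuntz_le t s" and e: "0 < e"
  shows "\<exists>n. cuntz_le (cut e t) (a n)"
proof -
  obtain s' where s': "positive s'" "cuntz_sup a s'" "\<And>e. 0 < e \<Longrightarrow> \<exists>n x. norm (star x * a n * x - s') < e"
    using cuntz_sup_exists[of a, OF pos inc] by blast
  have "cuntz_le s s'" using s s' by (simp add: cuntz_sup_def)
  with t(2) have "cuntz_le t s'" by (rule cuntz_le_trans)
  then obtain y where y: "norm (star y * s' * y - t) < e / 2" using cuntz_le_approx[of t s' "e / 2"] e by auto
  have y1: "0 < (norm y)\<^sup>2 + 1" by (simp add: add_nonneg_pos)
  then obtain n x where x: "norm (star x * a n * x - s') < e / 2 / ((norm y)\<^sup>2 + 1)"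
    using s'(3)[of "e / 2 / ((norm y)\<^sup>2 + 1)"] e by auto
  have "norm (star y * (star x * a n * x - s') * y) \<le> (norm y)\<^sup>2 * norm (star x * a n * x - s')" by (rule norm_conj_le)
  also have "\<dots> \<le> ((norm y)\<^sup>2 + 1) * (e / 2 / ((norm y)\<^sup>2 + 1))" using x by (intro mult_mono) auto
  also have "\<dots> = e / 2" using y1 by (rule pos_mult_divide_cancel)
  finally have "norm (star y * (star x * a n * x) * y - star y * s' * y) \<le> e / 2" by (simp only: conj_diff_distrib)
  then have "norm (star y * (star x * a n * x) * y - t) < e"
    using norm_diff_triangle[of "star y * (star x * a n * x) * y" t "star y * s' * y"] y by linarith
  then have "cuntz_le (cut e t) (star y * (star x * a n * x) * y)"
    by (intro cuntz_le_cut t positive_conj pos) (simp add: norm_minus_commute)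
  then show ?thesis using cuntz_le_trans cuntz_le_conj by blast
qed

lemma cuntz_sup_if_cuts:
  assumes t: "positive t" and g: "\<And>n. cuntz_le (g n) t" and e: "\<And>e. 0 < e \<Longrightarrow> \<exists>n. cuntz_le (cut e t) (g n)"
  shows "cuntz_sup g t"
  unfolding cuntz_sup_def
proof (intro conjI allI impI g)
  fix u assume "\<forall>n. cuntz_le (g n) u"
  then show "cuntz_le t u" using e cuntz_le_trans by (intro cuntz_le_if_cuts[OF t]) blast
qed

lemma cuntz_sup_cut_sequence:
  assumes "positive t"
  shows "cuntz_sup (\<lambda>n. cut (inverse (real (Suc n))) t) t"
proof (rule cuntz_sup_if_cuts[OF assms])
  fix e :: real assume "0 < e"
  then obtain n where "inverse (real (Suc n)) < e" using reals_Archimedean by blast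
  then show "\<exists>n. cuntz_le (cut e t) (cut (inverse (real (Suc n))) t)"
    by (intro exI[of _ n] cuntz_le_cut_mono assms) auto
qed (simp add: cuntz_le_cut_self assms)

text \<open>One direction tests \<open>way_below\<close> on the cut-downs of \<open>t\<close>, an
  increasing sequence with supremum \<open>t\<close>; the other is
  \<open>cut_compact\<close>.\<close>

lemma way_below_Cu_iff:
  fixes s t :: "'a::cstar_algebra stabilization"
  assumes s: "positive s" and t: "positive t"
  shows "way_below CuA (cuntz_class s) (cuntz_class t) \<longleftrightarrow> (\<exists>e>0. cuntz_le s (cut e t))"
proof
  assume wb: "way_below CuA (cuntz_class s) (cuntz_class t)"
  define a where "a n = cut (inverse (real (Suc n))) t" for n
  have a: "positive (a n)" for n by (simp add: a_def positive_cut t)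
  have "cuntz_le (a n) (a (Suc n))" for n
    unfolding a_def by (intro cuntz_le_cut_mono t) (auto intro!: le_imp_inverse_le)
  then have "increasing CuA (\<lambda>n. cuntz_class (a n))" by (simp add: increasing_Cu_iff a)
  moreover have "is_supremum CuA (\<lambda>n. cuntz_class (a n)) (cuntz_class t)"
    unfolding is_supremum_Cu_iff[OF a t] using cuntz_sup_cut_sequence[OF t] by (simp add: a_def[abs_def])
  moreover have "ole CuA (cuntz_class t) (cuntz_class t)" by (simp add: ole_Cu t cuntz_le_refl)
  ultimately obtain n where "ole CuA (cuntz_class s) (cuntz_class (a n))"
    using wb unfolding way_below_def by blast
  then have "cuntz_le s (cut (inverse (real (Suc n))) t)" using ole_Cu[OF s a] by (simp add: a_def)
  then show "\<exists>e>0. cuntz_le s (cut e t)" by (intro exI[of _ "inverse (real (Suc n))"]) simp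
next
  assume "\<exists>e>0. cuntz_le s (cut e t)"
  then obtain e where e: "0 < e" "cuntz_le s (cut e t)" by blast
  have "\<exists>n. ole CuA (cuntz_class s) (f n)"
    if f: "increasing CuA f" "is_supremum CuA f u" "ole CuA (cuntz_class t) u" for f u
  proof -
    obtain a where a: "\<And>n. positive (a n)" "f = (\<lambda>n. cuntz_class (a n))" "\<And>n. cuntz_le (a n) (a (Suc n))"
      by (rule increasing_Cu_cases[OF f(1)]) blast
    obtain v where v: "positive v" "u = cuntz_class v" "cuntz_sup a v"
      by (rule is_supremum_Cu_cases[OF f(2)[unfolded a(2)] a(1)])
    have "cuntz_le t v" using f(3) v t by (simp add: ole_Cu)
    then obtain n where "cuntz_le (cut e t) (a n)" using cut_compact[of a, OF a(1,3) v(3) t _ e(1)] by blast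
    with e(2) have "cuntz_le s (a n)" by (rule cuntz_le_trans)
    then show ?thesis using s a(1) by (auto simp: a(2) ole_Cu)
  qed
  then show "way_below CuA (cuntz_class s) (cuntz_class t)"
    unfolding way_below_def using s t cuntz_class_in_Cu by blast
qed

section \<open>Verification of the axioms\<close>

lemma axiom_O1_Cu: "axiom_O1 CuA"
  unfolding axiom_O1_def
proof (intro allI impI)
  fix f :: "nat \<Rightarrow> 'a stabilization set" assume "increasing CuA f"
  then obtain a where a: "\<And>n. positive (a n)" "f = (\<lambda>n. cuntz_class (a n))" "\<And>n. cuntz_le (a n) (a (Suc n))"
    by (rule increasing_Cu_cases) blast
  obtain s where s: "positive s" "cuntz_sup a s" using cuntz_sup_exists[of a, OF a(1,3)] by blast
  show "\<exists>s. is_supremum CuA f s"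
    by (rule exI[of _ "cuntz_class s"]) (simp add: a(2) is_supremum_Cu_iff[OF a(1) s(1)] s(2))
qed

lemma axiom_O2_Cu: "axiom_O2 CuA"
  unfolding axiom_O2_def
proof
  fix x :: "'a stabilization set" assume "x \<in> carrier CuA"
  then obtain t where t: "positive t" "x = cuntz_class t" by (rule Cu_cases)
  define a where "a n = cut (inverse (real (Suc n))) t" for n
  have a: "positive (a n)" for n by (simp add: a_def positive_cut t)
  have "way_below CuA (cuntz_class (a n)) (cuntz_class (a (Suc n)))" for n
    unfolding way_below_Cu_iff[OF a a]
  proof (intro exI conjI)
    \<comment> \<open>Levels of successive cuts add, so cutting \<open>a (Suc n)\<close> by the
      difference of the two levels yields \<open>a n\<close> itself.\<close>
    have "inverse (real (Suc (Suc n))) < inverse (real (Suc n))" by (rule less_imp_inverse_less) auto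
    then show "0 < inverse (real (Suc n)) - inverse (real (Suc (Suc n)))" by simp
    then show "cuntz_le (a n) (cut (inverse (real (Suc n)) - inverse (real (Suc (Suc n)))) (a (Suc n)))"
      unfolding a_def using t by (subst cut_cut) (auto intro!: cuntz_le_refl positive_cut)
  qed
  moreover have "is_supremum CuA (\<lambda>n. cuntz_class (a n)) x"
    unfolding t(2) is_supremum_Cu_iff[OF a t(1)] using cuntz_sup_cut_sequence[OF t(1)] by (simp add: a_def[abs_def])
  ultimately show "\<exists>f. (\<forall>n. f n \<in> carrier CuA \<and> way_below CuA (f n) (f (Suc n))) \<and> is_supremum CuA f x"
    using cuntz_class_in_Cu[OF a] by (intro exI[of _ "\<lambda>n. cuntz_class (a n)"]) simp
qed

lemma way_below_Cu_cases:
  assumes "way_below CuA x y"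
  obtains s t e where "positive s" "positive t" "x = cuntz_class s" "y = cuntz_class t" "0 < e" "cuntz_le s (cut e t)"
proof -
  have "x \<in> carrier CuA" "y \<in> carrier CuA" using assms by (simp_all add: way_below_def)
  then obtain s t where st: "positive s" "x = cuntz_class s" "positive t" "y = cuntz_class t" using Cu_cases by metis
  then obtain e where "0 < e" "cuntz_le s (cut e t)" using assms way_below_Cu_iff by blast
  then show thesis using that st by blast
qed

lemma axiom_O3_Cu: "axiom_O3 CuA"
  unfolding axiom_O3_def
proof (intro allI impI)
  fix x1 y1 x2 y2 :: "'a stabilization set"
  assume w1: "way_below CuA x1 y1" and w2: "way_below CuA x2 y2"
  obtain s1 t1 e1 where 1: "positive s1" "positive t1" "x1 = cuntz_class s1" "y1 = cuntz_class t1" "0 < e1" "cuntz_le s1 (cut e1 t1)"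
    by (rule way_below_Cu_cases[OF w1])
  obtain s2 t2 e2 where 2: "positive s2" "positive t2" "x2 = cuntz_class s2" "y2 = cuntz_class t2" "0 < e2" "cuntz_le s2 (cut e2 t2)"
    by (rule way_below_Cu_cases[OF w2])
  define e where "e = min e1 e2"
  have e: "0 < e" "e \<le> e1" "e \<le> e2" using 1 2 by (simp_all add: e_def)
  have "cuntz_le s1 (cut e t1)" "cuntz_le s2 (cut e t2)"
    using 1 2 e cuntz_le_cut_mono[of t1 e e1] cuntz_le_cut_mono[of t2 e e2] cuntz_le_trans by (blast intro: less_imp_le)+
  then have "cuntz_le (s1 \<oplus>\<^sub>c s2) (cut e (t1 \<oplus>\<^sub>c t2))" using 1 2 e by (simp add: cut_oplus oplus_mono)
  then have "way_below CuA (cuntz_class (s1 \<oplus>\<^sub>c s2)) (cuntz_class (t1 \<oplus>\<^sub>c t2))"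
    using way_below_Cu_iff[OF positive_oplus[OF 1(1) 2(1)] positive_oplus[OF 1(2) 2(2)]] e(1) by blast
  then show "way_below CuA (osum CuA x1 x2) (osum CuA y1 y2)" using 1 2 by (simp add: osum_Cu)
qed

text \<open>Cutting distributes over \<open>\<oplus>\<^sub>c\<close>, so the two suprema can be
  tested separately and a common index is the maximum.\<close>

lemma axiom_O4_Cu: "axiom_O4 CuA"
  unfolding axiom_O4_def
proof (intro allI impI)
  fix f g :: "nat \<Rightarrow> 'a stabilization set" and x y
  assume f: "increasing CuA f" and g: "increasing CuA g" and fx: "is_supremum CuA f x" and gy: "is_supremum CuA g y"
  obtain a where a: "\<And>n. positive (a n)" "f = (\<lambda>n. cuntz_class (a n))" "\<And>n. cuntz_le (a n) (a (Suc n))"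
    by (rule increasing_Cu_cases[OF f]) blast
  obtain b where b: "\<And>n. positive (b n)" "g = (\<lambda>n. cuntz_class (b n))" "\<And>n. cuntz_le (b n) (b (Suc n))"
    by (rule increasing_Cu_cases[OF g]) blast
  obtain s where s: "positive s" "x = cuntz_class s" "cuntz_sup a s"
    by (rule is_supremum_Cu_cases[OF fx[unfolded a(2)] a(1)])
  obtain t where t: "positive t" "y = cuntz_class t" "cuntz_sup b t"
    by (rule is_supremum_Cu_cases[OF gy[unfolded b(2)] b(1)])
  have "cuntz_sup (\<lambda>n. a n \<oplus>\<^sub>c b n) (s \<oplus>\<^sub>c t)"
  proof (rule cuntz_sup_if_cuts)
    show "cuntz_le (a n \<oplus>\<^sub>c b n) (s \<oplus>\<^sub>c t)" for n using s t by (intro oplus_mono) (simp_all add: cuntz_sup_def)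
    fix e :: real assume e: "0 < e"
    obtain m where m: "cuntz_le (cut e s) (a m)" using cut_compact[of a, OF a(1,3) s(3,1) cuntz_le_refl[OF s(1)] e] by blast
    obtain n where n: "cuntz_le (cut e t) (b n)" using cut_compact[of b, OF b(1,3) t(3,1) cuntz_le_refl[OF t(1)] e] by blast
    have "cuntz_le (cut e s \<oplus>\<^sub>c cut e t) (a (max m n) \<oplus>\<^sub>c b (max m n))"
      by (intro oplus_mono cuntz_le_trans[OF m] cuntz_le_trans[OF n] cuntz_le_chain[where a=a, OF a(1,3)]
          cuntz_le_chain[where a=b, OF b(1,3)]) auto
    then show "\<exists>n. cuntz_le (cut e (s \<oplus>\<^sub>c t)) (a n \<oplus>\<^sub>c b n)" using s t e by (auto simp: cut_oplus)
  qed (simp add: positive_oplus s t)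
  then show "is_supremum CuA (\<lambda>n. osum CuA (f n) (g n)) (osum CuA x y)"
    using is_supremum_Cu_iff[of "\<lambda>n. a n \<oplus>\<^sub>c b n" "s \<oplus>\<^sub>c t"] a b s t by (simp add: osum_Cu positive_oplus)
qed

lemma cuntz_le_oplus_commute: "positive a \<Longrightarrow> positive b \<Longrightarrow> cuntz_le (a \<oplus>\<^sub>c b) (b \<oplus>\<^sub>c a)"
  using osum_Cu_commute[of a b] by (simp add: osum_Cu cuntz_class_eq_iff positive_oplus)

lemma axiom_O5_Cu: "axiom_O5 CuA"
  unfolding axiom_O5_def
proof (intro ballI impI)
  fix x' x y :: "'a stabilization set"
  assume y: "y \<in> carrier CuA" and w: "way_below CuA x' x" and xy: "ole CuA x y"
  obtain s' s e where s: "positive s'" "positive s" "x' = cuntz_class s'" "x = cuntz_class s" "0 < e" "cuntz_le s' (cut e s)"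
    by (rule way_below_Cu_cases[OF w])
  obtain t where t: "positive t" "y = cuntz_class t" by (rule Cu_cases[OF y])
  have st: "cuntz_le s t" using xy s t by (simp add: ole_Cu)
  \<comment> \<open>The complement costs a cut at three times its parameter.\<close>
  have "0 < e / 3" using s(5) by simp
  then obtain p c d where p: "positive p" "positive c" "positive d" "p * c = 0" "cuntz_le (p + c) t"
      "cuntz_le (cut (3 * (e / 3)) s) p" "cuntz_le t (c + d)" "cuntz_le d s"
    by (rule cuntz_le_complement[OF s(2) t(1) st])
  have "cuntz_le s' p" using s(6) p(6) cuntz_le_trans by simp
  then have "cuntz_le (s' \<oplus>\<^sub>c c) (p \<oplus>\<^sub>c c)" by (intro oplus_mono cuntz_le_refl p)
  then have "cuntz_le (s' \<oplus>\<^sub>c c) t"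
    using cuntz_equiv_oplus(2)[OF p(1,2,4)] p(5) cuntz_le_trans by blast
  \<comment> \<open>The summands \<open>c\<close> and \<open>d\<close> are not known to be
    orthogonal, so their sum is only bounded by \<open>\<oplus>\<^sub>c\<close>, which is the
    direction required here.\<close>
  moreover have "cuntz_le t (s \<oplus>\<^sub>c c)"
  proof -
    have "cuntz_le t (c \<oplus>\<^sub>c d)" by (rule cuntz_le_trans[OF p(7) cuntz_le_add_oplus[OF p(2,3)]])
    also have "cuntz_le (c \<oplus>\<^sub>c d) (c \<oplus>\<^sub>c s)" by (intro oplus_mono cuntz_le_refl p)
    note cuntz_le_trans[OF calculation this]
    then show ?thesis using cuntz_le_oplus_commute[OF p(2) s(2)] by (rule cuntz_le_trans)
  qed
  ultimately show "\<exists>r\<in>carrier CuA. ole CuA (osum CuA x' r) y \<and> ole CuA y (osum CuA x r)"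
    using s t p(2) by (intro bexI[of _ "cuntz_class c"]) (simp_all add: osum_Cu ole_Cu positive_oplus cuntz_class_in_Cu)
qed

lemma axiom_O6_Cu: "axiom_O6 CuA"
  unfolding axiom_O6_def
proof (intro ballI impI)
  fix x y z x' :: "'a stabilization set"
  assume yz: "y \<in> carrier CuA" "z \<in> carrier CuA" and le: "ole CuA x (osum CuA y z)" and w: "way_below CuA x' x"
  obtain s' s e where s: "positive s'" "positive s" "x' = cuntz_class s'" "x = cuntz_class s" "0 < e" "cuntz_le s' (cut e s)"
    by (rule way_below_Cu_cases[OF w])
  obtain r t where rt: "positive r" "y = cuntz_class r" "positive t" "z = cuntz_class t" using Cu_cases yz by metis
  have "cuntz_le s (r \<oplus>\<^sub>c t)" using le s rt by (simp add: osum_Cu ole_Cu positive_oplus)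
  then have "cuntz_le s (corner 0 r + corner 1 t)" by (simp only: oplus_def)
  \<comment> \<open>The decomposition costs a cut at twice its parameter. It is applied to the two
    corners, whose ordinary sum is \<open>r \<oplus>\<^sub>c t\<close>.\<close>
  moreover have "0 < e / 2" using s(5) by simp
  ultimately obtain b c where b: "positive b" "positive c" "cuntz_le (cut (2 * (e / 2)) s) (b + c)"
    "cuntz_le b (corner 0 r)" "cuntz_le b s" "cuntz_le c (corner 1 t)" "cuntz_le c s"
    by (rule cuntz_le_add_decompose[OF s(2) positive_corner[OF rt(1)] positive_corner[OF rt(3)]])
  have "cuntz_le s' (b \<oplus>\<^sub>c c)"
    using s(6) b(3) cuntz_le_add_oplus[OF b(1,2)] cuntz_le_trans by simp blast
  moreover have "cuntz_le b r" "cuntz_le c t"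
    using b(4,6) cuntz_equiv_corner(2) rt cuntz_le_trans by blast+
  ultimately show "\<exists>r'\<in>carrier CuA. \<exists>t'\<in>carrier CuA. ole CuA x' (osum CuA r' t') \<and>
      ole CuA r' y \<and> ole CuA r' x \<and> ole CuA t' z \<and> ole CuA t' x"
    using s rt b by (intro bexI[of _ "cuntz_class b"] bexI[of _ "cuntz_class c"])
      (simp_all add: osum_Cu ole_Cu positive_oplus cuntz_class_in_Cu)
qed

text \<open>Cut-downs of \<open>star x * x\<close> at countably many levels suffice: a cut absorbs
  the error of replacing \<open>t\<close> by a nearby element, and levels decreasing fast enough
  keep the sequence rapidly increasing.\<close>

lemma countable_dense_Cu:
  fixes C :: "'a::cstar_algebra stabilization set"
  assumes C: "countable C" "closure C = UNIV"
  shows "\<exists>D. countable D \<and> is_dense (Cu TYPE('a)) D"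
proof -
  \<comment> \<open>With ratio \<open>1/8\<close>, the level \<open>q m / 4 + q (Suc m)\<close> is
    \<open>3/8\<close> of \<open>q m\<close>. It leaves a gap of \<open>q m / 8\<close> below
    \<open>q m / 2\<close>, more than the next approximation error
    \<open>q (Suc m) / 2\<close>.\<close>
  define q :: "nat \<Rightarrow> real" where "q m = (1 / 8) ^ m" for m
  have q: "0 < q m" "q (Suc m) = q m / 8" for m by (simp_all add: q_def)
  define D where "D = (\<lambda>(m, x). cuntz_class (cut (q m) (star x * x))) ` (UNIV \<times> C)"
  have "countable D" unfolding D_def using C(1) by (intro countable_image countable_SIGMA) auto
  moreover have "is_dense CuA D"
    unfolding is_dense_def
  proof (intro conjI ballI)
    have cp: "positive (cut (q m) (star x * x))" for m x
      using q(1)[of m] by (simp add: positive_cut positive_star_mult)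
    show "D \<subseteq> carrier CuA" by (auto simp: D_def intro!: cuntz_class_in_Cu cp)
    fix y :: "'a stabilization set" assume "y \<in> carrier CuA"
    then obtain t where t: "positive t" "y = cuntz_class t" by (rule Cu_cases)
    \<comment> \<open>It is \<open>z\<close> that is approximated from \<open>C\<close>, not
      \<open>t\<close>, so that the approximants \<open>star x * x\<close> are positive.\<close>
    then obtain z where z: "t = star z * z" by (auto simp: positive_def)
    have "z \<in> closure C" using C(2) by simp
    then obtain X where X: "\<And>n. X n \<in> C" "X \<longlonglongrightarrow> z" by (auto simp: closure_sequential)
    have Xt: "(\<lambda>n. star (X n) * X n) \<longlonglongrightarrow> t" unfolding z by (intro tendsto_intros X)
    have "\<exists>x\<in>C. norm (t - star x * x) < q m / 2" for m
      using LIMSEQ_D[OF Xt, of "q m / 2"] q(1)[of m] X(1) by (metis half_gt_zero norm_minus_commute order_refl)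
    then obtain x where x: "\<And>m. x m \<in> C" "\<And>m. norm (t - star (x m) * x m) < q m / 2" by metis
    define c where "c m = star (x m) * x m" for m
    have c: "positive (c m)" "norm (t - c m) < q m / 2" for m using x(2) by (simp_all add: c_def positive_star_mult)
    define g where "g m = cut (q m) (c m)" for m
    have g: "positive (g m)" for m unfolding g_def c_def by (rule cp)
    have le: "cuntz_le (g m) (cut (q m / 2) t)" for m
      unfolding g_def using c[of m] q(1)[of m] t by (intro cuntz_le_cut_cut) (auto simp: norm_minus_commute)
    have "way_below CuA (cuntz_class (g m)) (cuntz_class (g (Suc m)))" for m
      unfolding way_below_Cu_iff[OF g g]
    proof (intro exI conjI)
      show "0 < q m / 4" using q(1)[of m] by simp
      have "cuntz_le (cut (q m / 2) t) (cut (q m / 4 + q (Suc m)) (c (Suc m)))"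
        using c[of "Suc m"] q(1)[of m] t by (intro cuntz_le_cut_cut) (auto simp: q(2))
      also have "cut (q m / 4 + q (Suc m)) (c (Suc m)) = cut (q m / 4) (g (Suc m))"
        unfolding g_def using q(1)[of m] q(1)[of "Suc m"] c by (intro cut_cut[symmetric]) auto
      finally show "cuntz_le (g m) (cut (q m / 4) (g (Suc m)))" using le[of m] cuntz_le_trans by blast
    qed
    moreover have "cuntz_sup g t"
    proof (rule cuntz_sup_if_cuts[OF t(1)])
      show "cuntz_le (g n) t" for n
        using le[of n] cuntz_le_cut_self[OF t(1), of "q n / 2"] q(1)[of n] cuntz_le_trans by (meson half_gt_zero less_imp_le)
      fix e :: real assume "0 < e"
      have "q \<longlonglongrightarrow> 0" unfolding q_def[abs_def] by (rule LIMSEQ_realpow_zero) auto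
      then obtain n where "norm (q n - 0) < e / 2" using LIMSEQ_D[of q 0 "e / 2"] \<open>0 < e\<close> by auto
      then have "cuntz_le (cut e t) (g n)"
        unfolding g_def using c[of n] q(1)[of n] t by (intro cuntz_le_cut_cut) auto
      then show "\<exists>n. cuntz_le (cut e t) (g n)" by blast
    qed
    then have "is_supremum CuA (\<lambda>m. cuntz_class (g m)) y" unfolding t(2) by (simp add: is_supremum_Cu_iff g t)
    moreover have "cuntz_class (g m) \<in> D" for m
      using x(1)[of m] by (auto simp: D_def g_def c_def)
    ultimately show "\<exists>f. (\<forall>n. f n \<in> D \<and> way_below CuA (f n) (f (Suc n))) \<and> is_supremum CuA f y"
      by (intro exI[of _ "\<lambda>m. cuntz_class (g m)"]) simp
  qed
  ultimately show ?thesis by blast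
qed

section \<open>Separability of the stabilization\<close>

lemma ell2_single_inner: "ell2_single i c \<bullet> y = c \<bullet> coord y i"
proof -
  have "ell2_single i c \<bullet> y = (\<Sum>n\<in>{i}. coord (ell2_single i c) n \<bullet> coord y n)"
    unfolding inner_ell2_def by (rule suminf_finite) (auto simp: ell2_single.rep_eq)
  then show ?thesis by (simp add: ell2_single.rep_eq)
qed

lemma ell2_single_inner_right: "y \<bullet> ell2_single i c = coord y i \<bullet> c"
  using ell2_single_inner[of i c y] by (simp only: inner_commute)

lemma norm_ell2_single: "norm (ell2_single i c) = cmod c"
  by (simp add: norm_ell2_def ell2_single_inner ell2_single.rep_eq flip: norm_eq_sqrt_inner)

lemma scaleC_ell2_single: "c *\<^sub>C ell2_single i d = ell2_single i (c * d)"
  by transfer auto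

lemma bounded_linear_ell2_single: "bounded_linear (ell2_single i)"
  by (rule bounded_linear_intro[where K=1]) (auto simp: ell2_single_add ell2_single_scaleR norm_ell2_single)

definition matrix_unit_blinfun :: "nat \<Rightarrow> nat \<Rightarrow> ell2 \<Rightarrow>\<^sub>L ell2"
  where "matrix_unit_blinfun i j = Blinfun (\<lambda>x. ell2_single i (coord x j))"

lemma matrix_unit_blinfun_apply: "blinfun_apply (matrix_unit_blinfun i j) x = ell2_single i (coord x j)"
proof -
  have "bounded_linear (\<lambda>x. coord x j)"
    by (rule bounded_linear_intro[where K=1])
      (auto simp: plus_ell2.rep_eq scaleR_ell2.rep_eq scaleR_conv_of_real coord_norm_le)
  from bounded_linear_compose[OF bounded_linear_ell2_single this]
  show ?thesis by (simp add: matrix_unit_blinfun_def bounded_linear_Blinfun_apply)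
qed

lift_definition matrix_unit :: "nat \<Rightarrow> nat \<Rightarrow> compact_op" is matrix_unit_blinfun
proof (intro conjI allI)
  fix i j c x
  show "blinfun_apply (matrix_unit_blinfun i j) (c *\<^sub>C x) = c *\<^sub>C blinfun_apply (matrix_unit_blinfun i j) x"
    by (simp add: matrix_unit_blinfun_apply scaleC_ell2_single scaleC_ell2.rep_eq)
  show "compact (closure (blinfun_apply (matrix_unit_blinfun i j) ` cball 0 1))"
  proof (rule compact_closure_subset)
    show "compact (ell2_single i ` cball 0 1)"
      by (intro compact_continuous_image linear_continuous_on bounded_linear_ell2_single compact_cball)
    show "blinfun_apply (matrix_unit_blinfun i j) ` cball 0 1 \<subseteq> ell2_single i ` cball 0 1"
      using coord_norm_le order_trans by (fastforce simp: matrix_unit_blinfun_apply)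
  qed
qed

lemma compact_op_eqI:
  "(\<And>x. blinfun_apply (op_blinfun S) x = blinfun_apply (op_blinfun T) x) \<Longrightarrow> S = T"
  by (simp add: op_blinfun_inject[symmetric] blinfun_eqI)

lemma matrix_unit_apply: "blinfun_apply (op_blinfun (matrix_unit i j)) x = ell2_single i (coord x j)"
  by (simp add: matrix_unit.rep_eq matrix_unit_blinfun_apply)

lemma star_matrix_unit: "star (matrix_unit i j) = matrix_unit j i"
  by transfer (rule blinfun_adjoint_eqI, simp add: matrix_unit_blinfun_apply ell2_single_inner ell2_single_inner_right)

lemma matrix_unit_mult: "matrix_unit i j * matrix_unit k l = (if j = k then matrix_unit i l else 0)"
  by (rule compact_op_eqI)
    (auto simp: times_compact_op.rep_eq matrix_unit_apply ell2_single.rep_eq zero_compact_op.rep_eq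
      bounded_linear.linear[OF bounded_linear_ell2_single, THEN linear_0])

lemma matrix_unit_sandwich:
  "matrix_unit i i * T * matrix_unit j j = coord (blinfun_apply (op_blinfun T) (ell2_single j 1)) i *\<^sub>C matrix_unit i j"
proof (rule compact_op_eqI)
  fix x
  have "blinfun_apply (op_blinfun T) (ell2_single j (coord x j)) = coord x j *\<^sub>C blinfun_apply (op_blinfun T) (ell2_single j 1)"
    by (simp add: op_scaleC[symmetric] scaleC_ell2_single)
  then show "blinfun_apply (op_blinfun (matrix_unit i i * T * matrix_unit j j)) x =
      blinfun_apply (op_blinfun (coord (blinfun_apply (op_blinfun T) (ell2_single j 1)) i *\<^sub>C matrix_unit i j)) x"
    by (simp add: times_compact_op.rep_eq scaleC_compact_op.rep_eq matrix_unit_apply scaleC_ell2.rep_eq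
        scaleC_ell2_single mult.commute)
qed

definition truncation :: "nat \<Rightarrow> compact_op"
  where "truncation n = (\<Sum>i<n. matrix_unit i i)"

lemma op_blinfun_sum: "op_blinfun (sum f I) = (\<Sum>i\<in>I. op_blinfun (f i))"
  by (induction I rule: infinite_finite_induct) (simp_all add: zero_compact_op.rep_eq plus_compact_op.rep_eq)

lemma truncation_apply: "blinfun_apply (op_blinfun (truncation n)) x = (\<Sum>m<n. ell2_single m (coord x m))"
  by (simp add: truncation_def op_blinfun_sum blinfun.sum_left matrix_unit_apply)

lemma star_sum: "star (sum f I) = (\<Sum>i\<in>I. star (f i))"
  by (induction I rule: infinite_finite_induct) (simp_all add: star_zero star_add)

lemma star_truncation: "star (truncation n) = truncation n"
  by (simp add: truncation_def star_sum star_matrix_unit)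

lemma norm_truncation_le: "norm (truncation n) \<le> 1"
proof -
  have "truncation n * truncation n = truncation n"
    by (simp add: truncation_def sum_product matrix_unit_mult)
  then have "norm (truncation n) * norm (truncation n) = norm (truncation n)"
    using cstar_identity[of "truncation n"] by (simp add: star_truncation power2_eq_square)
  then have "norm (truncation n) = 0 \<or> norm (truncation n) = 1" unfolding mult_cancel_right2 .
  then show ?thesis by linarith
qed

text \<open>Truncations converge to the identity only pointwise, but they are contractions and the
  image of the unit ball under \<open>T\<close> is totally bounded, so the convergence is uniform
  there.\<close>

lemma truncation_mult_tendsto: "(\<lambda>n. truncation n * T) \<longlonglongrightarrow> T"
proof (rule LIMSEQ_I)
  fix e :: real assume e: "0 < e"
  define d where "d = e / 4"
  have d: "0 < d" using e by (simp add: d_def)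
  let ?T = "blinfun_apply (op_blinfun T)" and ?P = "\<lambda>n. blinfun_apply (op_blinfun (truncation n))"
  obtain F where F: "finite F" "?T ` cball 0 1 \<subseteq> (\<Union>z\<in>F. cball z d)"
    using compact_closureD[OF op_compact d] by blast
  have "\<forall>\<^sub>F n in sequentially. \<forall>z\<in>F. norm (?P n z - z) < d"
  proof (rule eventually_ball_finite[OF F(1)], intro ballI)
    fix z
    have "(\<lambda>n. ?P n z) \<longlonglongrightarrow> z" unfolding truncation_apply by (rule ell2_truncations_tendsto)
    from LIMSEQ_D[OF this d] show "\<forall>\<^sub>F n in sequentially. norm (?P n z - z) < d"
      unfolding eventually_sequentially by blast
  qed
  then obtain N where N: "\<And>n z. N \<le> n \<Longrightarrow> z \<in> F \<Longrightarrow> norm (?P n z - z) < d"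
    unfolding eventually_sequentially by blast
  have "norm (truncation n * T - T) < e" if n: "N \<le> n" for n
  proof -
    have Pn: "norm (?P n x) \<le> norm x" for x
    proof -
      have "norm (?P n x) \<le> norm (truncation n) * norm x"
        unfolding norm_compact_op.rep_eq by (rule norm_blinfun)
      also have "\<dots> \<le> 1 * norm x" by (intro mult_right_mono norm_truncation_le) simp
      finally show ?thesis by simp
    qed
    have ball: "norm (?P n (?T x) - ?T x) \<le> 3 * d" if x: "norm x \<le> 1" for x
    proof -
      have "?T x \<in> ?T ` cball 0 1" using x by simp
      then obtain z where z: "z \<in> F" "norm (z - ?T x) \<le> d" using F(2) by (auto simp: dist_norm)
      have "?P n (?T x) - ?T x = - ?P n (z - ?T x) + (?P n z - z) + (z - ?T x)" by (simp add: blinfun.diff_right)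
      also have "norm \<dots> \<le> norm (?P n (z - ?T x)) + norm (?P n z - z) + norm (z - ?T x)"
        by (metis norm_add_rule_thm norm_minus_cancel norm_triangle_mono order_refl)
      also have "\<dots> \<le> d + d + d" using z N[OF n z(1)] Pn[of "z - ?T x"] by (intro add_mono) auto
      finally show ?thesis by simp
    qed
    have "norm (op_blinfun (truncation n * T - T)) \<le> 3 * d"
    proof (rule norm_blinfun_bound)
      fix x
      show "norm (blinfun_apply (op_blinfun (truncation n * T - T)) x) \<le> 3 * d * norm x"
      proof (cases "x = 0")
        case False
        have "norm (?P n (?T ((1 / norm x) *\<^sub>R x)) - ?T ((1 / norm x) *\<^sub>R x)) \<le> 3 * d"
          using False by (intro ball) simp
        then have "norm ((1 / norm x) *\<^sub>R (?P n (?T x) - ?T x)) \<le> 3 * d"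
          by (simp add: blinfun.scaleR_right scaleR_diff_right del: norm_scaleR)
        then show ?thesis using False
          by (simp add: minus_compact_op.rep_eq times_compact_op.rep_eq blinfun.diff_left divide_le_eq)
      qed simp
    qed (use d in simp)
    then show ?thesis using e by (simp add: norm_compact_op.rep_eq d_def)
  qed
  then show "\<exists>N. \<forall>n\<ge>N. norm (truncation n * T - T) < e" by blast
qed

lemma truncation_sandwich_tendsto: "(\<lambda>n. truncation n * T * truncation n) \<longlonglongrightarrow> T"
proof -
  have 1: "(\<lambda>n. T * truncation n) \<longlonglongrightarrow> T"
    using tendsto_star[OF truncation_mult_tendsto[of "star T"]] by (simp add: star_mult star_star star_truncation)
  have lim: "(\<lambda>n. norm (T * truncation n - T) + norm (truncation n * T - T)) \<longlonglongrightarrow> 0"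
    using tendsto_add[OF tendsto_norm[OF LIM_zero[OF 1]] tendsto_norm[OF LIM_zero[OF truncation_mult_tendsto[of T]]]] by simp
  have le: "norm (truncation n * T * truncation n - T) \<le> norm (T * truncation n - T) + norm (truncation n * T - T)" for n
  proof -
    have "truncation n * T * truncation n - T = truncation n * (T * truncation n - T) + (truncation n * T - T)"
      by (simp add: algebra_simps)
    also have "norm \<dots> \<le> norm (truncation n) * norm (T * truncation n - T) + norm (truncation n * T - T)"
      by (rule order_trans[OF norm_triangle_ineq]) (simp add: norm_mult_ineq)
    also have "\<dots> \<le> 1 * norm (T * truncation n - T) + norm (truncation n * T - T)"
      by (intro add_mono mult_right_mono norm_truncation_le) auto
    finally show ?thesis by simp
  qed
  show ?thesis by (rule tendsto_if_norm_diff_le[OF le lim])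
qed

section \<open>Elementary tensors and a countable dense set\<close>

lemma elem_tensor_simps:
  "(a + a') \<otimes>\<^sub>a\<^sub>l\<^sub>g b = a \<otimes>\<^sub>a\<^sub>l\<^sub>g b + a' \<otimes>\<^sub>a\<^sub>l\<^sub>g b" "a \<otimes>\<^sub>a\<^sub>l\<^sub>g (b + b') = a \<otimes>\<^sub>a\<^sub>l\<^sub>g b + a \<otimes>\<^sub>a\<^sub>l\<^sub>g b'"
  "a \<otimes>\<^sub>a\<^sub>l\<^sub>g (c *\<^sub>C b) = (c *\<^sub>C a) \<otimes>\<^sub>a\<^sub>l\<^sub>g b"
  by (rule alg_tensor_eqI, simp add: plus_alg_tensor.rep_eq, simp add: cbilinear_def)+

definition tensor :: "'a::cstar_algebra \<Rightarrow> compact_op \<Rightarrow> 'a stabilization"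
  where "tensor a T = abs_cstar_tensor (\<lambda>_. a \<otimes>\<^sub>a\<^sub>l\<^sub>g T)"

lemma tensor_simps:
  "tensor (a + a') T = tensor a T + tensor a' T" "tensor a (T + T') = tensor a T + tensor a T'"
  "tensor a (c *\<^sub>C T) = tensor (c *\<^sub>C a) T"
  by (simp_all add: tensor_def elem_tensor_simps plus_cstar_tensor.abs_eq max_rel_const)

lemma norm_tensor_le: "norm (tensor a T) \<le> norm a * norm T"
  by (simp add: tensor_def norm_abs_const max_norm_elem)

lemma tensor_diff_left: "tensor (a - a') T = tensor a T - tensor a' T"
  using tensor_simps(1)[of "a - a'" a' T] by simp

lemma tensor_diff_right: "tensor a (T - T') = tensor a T - tensor a T'"
  using tensor_simps(2)[of a "T - T'" T'] by simp

lemma tendsto_tensor_left: "(\<lambda>n. tensor (X n) T) \<longlonglongrightarrow> tensor a T" if X: "X \<longlonglongrightarrow> a"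
proof (rule tendsto_if_norm_diff_le)
  show "norm (tensor (X n) T - tensor a T) \<le> norm (X n - a) * norm T" for n
    unfolding tensor_diff_left[symmetric] by (rule norm_tensor_le)
qed (rule tendsto_mult_left_zero[OF tendsto_norm_zero[OF LIM_zero[OF X]]])

lemma tendsto_tensor_right: "(\<lambda>n. tensor a (X n)) \<longlonglongrightarrow> tensor a T" if X: "X \<longlonglongrightarrow> T"
proof (rule tendsto_if_norm_diff_le)
  show "norm (tensor a (X n) - tensor a T) \<le> norm a * norm (X n - T)" for n
    unfolding tensor_diff_right[symmetric] by (rule norm_tensor_le)
qed (rule tendsto_mult_right_zero[OF tendsto_norm_zero[OF LIM_zero[OF X]]])

text \<open>Finite sums of \<open>tensor a (matrix_unit i j)\<close> with \<open>a\<close> from a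
  countable dense set suffice: matrix coefficients are absorbed into \<open>a\<close>, so the
  closure \<open>V\<close> has to be stable only under addition.\<close>

lemma separable_stabilization:
  assumes "separable_space (euclidean :: 'a::cstar_algebra topology)"
  shows "\<exists>C :: 'a stabilization set. countable C \<and> closure C = UNIV"
proof -
  obtain A :: "'a set" where A: "countable A" "closure A = UNIV"
    using assms by (auto simp: separable_space_def)
  define C where "C = (\<lambda>l. \<Sum>(a, i, j)\<leftarrow>l. tensor a (matrix_unit i j)) ` lists (A \<times> UNIV \<times> UNIV)"
  have "countable C" unfolding C_def using A(1) by (intro countable_image countable_lists countable_SIGMA) auto
  define V where "V = closure C"
  have V: "closed V" by (simp add: V_def)
  have "0 \<in> C" unfolding C_def by (rule image_eqI[of _ _ "[]"]) auto
  then have V0: "0 \<in> V" unfolding V_def using closure_subset by blast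
  have C_add: "x + y \<in> C" if xy: "x \<in> C" "y \<in> C" for x y
  proof -
    obtain k where k: "k \<in> lists (A \<times> UNIV \<times> UNIV)" "x = (\<Sum>(a, i, j)\<leftarrow>k. tensor a (matrix_unit i j))"
      using xy(1) unfolding C_def by blast
    obtain l where l: "l \<in> lists (A \<times> UNIV \<times> UNIV)" "y = (\<Sum>(a, i, j)\<leftarrow>l. tensor a (matrix_unit i j))"
      using xy(2) unfolding C_def by blast
    show ?thesis unfolding C_def by (rule image_eqI[of _ _ "k @ l"]) (use k l in auto)
  qed
  have V_add: "x + y \<in> V" if xy: "x \<in> V" "y \<in> V" for x y
  proof -
    obtain X where X: "\<And>n. X n \<in> C" "X \<longlonglongrightarrow> x" using xy(1) by (auto simp: V_def closure_sequential)
    obtain Y where Y: "\<And>n. Y n \<in> C" "Y \<longlonglongrightarrow> y" using xy(2) by (auto simp: V_def closure_sequential)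
    have "(\<lambda>n. X n + Y n) \<longlonglongrightarrow> x + y" by (intro tendsto_intros X Y)
    with C_add[OF X(1) Y(1)] show ?thesis unfolding V_def closure_sequential by (intro exI[of _ "\<lambda>n. X n + Y n"]) blast
  qed
  have V_unit: "tensor a (matrix_unit i j) \<in> V" for a i j
  proof -
    have "a \<in> closure A" by (simp add: A)
    then obtain X where X: "\<And>n. X n \<in> A" "X \<longlonglongrightarrow> a" by (auto simp: closure_sequential)
    have "tensor (X n) (matrix_unit i j) \<in> C" for n
      unfolding C_def by (rule image_eqI[of _ _ "[(X n, i, j)]"]) (use X in auto)
    then have "tensor (X n) (matrix_unit i j) \<in> V" for n unfolding V_def using closure_subset by blast
    then show ?thesis by (rule closed_sequentially[OF V _ tendsto_tensor_left[OF X(2)]])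
  qed
  have V_sum: "tensor a (sum f I) \<in> V" if "\<And>i. i \<in> I \<Longrightarrow> tensor a (f i) \<in> V" for a I and f :: "nat \<Rightarrow> compact_op"
  proof -
    have z: "tensor a 0 = 0" using tensor_simps(2)[of a 0 0] by simp
    show ?thesis using that by (induction I rule: infinite_finite_induct) (auto simp: z V0 tensor_simps V_add)
  qed
  have V_tensor: "tensor a T \<in> V" for a T
  proof (rule closed_sequentially[OF V _ tendsto_tensor_right[OF truncation_sandwich_tendsto]])
    fix n
    \<comment> \<open>The truncated operator is a finite sum of scalar multiples of matrix units, by
      \<open>matrix_unit_sandwich\<close>.\<close>
    have "truncation n * T * truncation n = (\<Sum>i<n. \<Sum>j<n. matrix_unit i i * T * matrix_unit j j)"
      by (simp add: truncation_def sum_distrib_left sum_distrib_right) (rule sum.swap)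
    then show "tensor a (truncation n * T * truncation n) \<in> V"
      by (simp only: matrix_unit_sandwich) (intro V_sum, simp add: tensor_simps V_unit)
  qed
  have V_alg: "abs_cstar_tensor (\<lambda>_. x) \<in> V" for x :: "('a, compact_op) alg_tensor"
  proof (induction x rule: alg_tensor_induct)
    case zero
    then show ?case using V0 by (simp add: zero_cstar_tensor.abs_eq)
  next
    case (add a b x)
    show ?case using V_add[OF V_tensor[of a b] add] by (simp add: tensor_def plus_cstar_tensor.abs_eq max_rel_const)
  qed
  have "x \<in> V" for x :: "'a stabilization"
  proof -
    obtain X where X: "max_rel X X" "x = abs_cstar_tensor X" by (rule cstar_tensor_cases)
    have "x \<in> closure V" unfolding closure_approachable
    proof (intro allI impI)
      fix e :: real assume "0 < e"
      from cstar_tensor_approx[OF X(1) this] obtain n where "norm (x - abs_cstar_tensor (\<lambda>_. X n)) < e"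
        unfolding X(2) by blast
      then show "\<exists>y\<in>V. dist y x < e" using V_alg[of "X n"] by (intro bexI) (simp_all add: dist_norm norm_minus_commute)
    qed
    then show ?thesis using V by simp
  qed
  then show ?thesis using \<open>countable C\<close> unfolding V_def by blast
qed

theorem proposition5p1p1:
  shows "is_ordered_semigroup (Cu TYPE('a::cstar_algebra)) \<and>
    axiom_O1 (Cu TYPE('a)) \<and> axiom_O2 (Cu TYPE('a)) \<and> axiom_O3 (Cu TYPE('a)) \<and>
    axiom_O4 (Cu TYPE('a)) \<and> axiom_O5 (Cu TYPE('a)) \<and> axiom_O6 (Cu TYPE('a)) \<and>
    (separable_space (euclidean :: 'a topology) \<longrightarrow>
      (\<exists>D. countable D \<and> is_dense (Cu TYPE('a)) D))"
  using is_ordered_semigroup_Cu axiom_O1_Cu axiom_O2_Cu axiom_O3_Cu axiom_O4_Cu axiom_O5_Cu axiom_O6_Cu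
    separable_stabilization countable_dense_Cu by blast

end
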